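(* Suppose $d\ge2$ and $p\in(0,1)$. Then there exists $\sigma>0$ such that if $(B_n)_{n\ge1}$ is any sequence of nonempty finite subsets of $\mathbb{Z}^d$ with vanishing relative boundary and with $\liminf(B_n)=\mathbb{Z}^d$, then, as $n\to\infty$, $|B_n|^{-1/2}(\Lambda(B_n)-\mathbb{E}\Lambda(B_n))$ converges in distribution to $\mathcal{N}(0,\sigma^2)$ and $$\sup_{j\in\mathbb{Z}}\left||B_n|^{1/2}P[\Lambda(B_n)=j]-\sigma^{-1}\phi\!\left(\frac{j-\mathbb{E}\Lambda(B_n)}{\sigma|B_n|^{1/2}}\right)\right|\to0.$$
   Context: Site percolation with parameter $p$ on $\mathbb{Z}^d$: each site of $\mathbb{Z}^d$ is open with probability $p$ and closed otherwise, independently of all other sites. For finite $B\subset\mathbb{Z}^d$, the open clusters in $B$ are the components of the random graph whose vertices are the open sites in $B$, with an edge between each pair of open sites in $B$ at unit Euclidean distance from each other. $\Lambda(B)$ denotes the number of open clusters in $B$. $|B|$ is the number of elements of $B$, and $|\partial B|$ is the number of elements of $\mathbb{Z}^d\setminus B$ at unit Euclidean distance from some element of $B$. A sequence $(B_n)$ of nonempty finite subsets of $\mathbb{Z}^d$ has vanishing relative boundary if $\lim_{n\to\infty}|\partial B_n|/|B_n|=0$. $\liminf(B_n):=\bigcup_{n\ge1}\bigcap_{m\ge n}B_m$. $\phi(x)=(2\pi)^{-1/2}e^{-x^2/2}$. *)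

theory Defs
  imports "HOL-Probability.Probability"
begin

text \<open>The lattice is \<^typ>\<open>int ^ 'd\<close>, of dimension \<open>CARD('d)\<close>. A configuration maps a site to
  \<^const>\<open>True\<close> if the site is open and to \<^const>\<open>False\<close> if it is closed.\<close>

definition site_percolation :: "real \<Rightarrow> (int ^ 'd \<Rightarrow> bool) measure" where
  "site_percolation p = (\<Pi>\<^sub>M x\<in>UNIV. measure_pmf (bernoulli_pmf p))"

text \<open>The library has no metric on \<^typ>\<open>int\<close>, so the Euclidean distance is taken in
  \<^typ>\<open>real ^ 'd\<close>.\<close>

definition lattice_adj :: "int ^ 'd \<Rightarrow> int ^ 'd \<Rightarrow> bool" where
  "lattice_adj x y \<longleftrightarrow>
     dist (\<chi> i. real_of_int (x $ i) :: real ^ 'd) (\<chi> i. real_of_int (y $ i)) = 1"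

definition outer_boundary :: "(int ^ 'd) set \<Rightarrow> (int ^ 'd) set" where
  "outer_boundary B = {z. z \<notin> B \<and> (\<exists>y\<in>B. lattice_adj z y)}"

definition open_sites :: "(int ^ 'd) set \<Rightarrow> (int ^ 'd \<Rightarrow> bool) \<Rightarrow> (int ^ 'd) set" where
  "open_sites B \<omega> = {x \<in> B. \<omega> x}"

definition open_edges :: "(int ^ 'd) set \<Rightarrow> (int ^ 'd \<Rightarrow> bool) \<Rightarrow> (int ^ 'd) rel" where
  "open_edges B \<omega> = {(x, y). x \<in> open_sites B \<omega> \<and> y \<in> open_sites B \<omega> \<and> lattice_adj x y}"

definition open_clusters :: "(int ^ 'd) set \<Rightarrow> (int ^ 'd \<Rightarrow> bool) \<Rightarrow> (int ^ 'd) set set" where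
  "open_clusters B \<omega> = open_sites B \<omega> // {(x, y). x \<in> open_sites B \<omega> \<and> (x, y) \<in> (open_edges B \<omega>)\<^sup>*}"

definition num_clusters :: "(int ^ 'd) set \<Rightarrow> (int ^ 'd \<Rightarrow> bool) \<Rightarrow> nat" where
  "num_clusters B \<omega> = card (open_clusters B \<omega>)"

definition mean_clusters :: "real \<Rightarrow> (int ^ 'd) set \<Rightarrow> real" where
  "mean_clusters p B = (\<integral>\<omega>. real (num_clusters B \<omega>) \<partial>site_percolation p)"

text \<open>Sequences are indexed from 1: the set \<open>B 0\<close> is unconstrained, and it is irrelevant to
  the limits.\<close>

definition vanishing_relative_boundary :: "(nat \<Rightarrow> (int ^ 'd) set) \<Rightarrow> bool" where
  "vanishing_relative_boundary B \<longleftrightarrow>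
     (\<lambda>n. real (card (outer_boundary (B n))) / real (card (B n))) \<longlonglongrightarrow> 0"

definition set_liminf :: "(nat \<Rightarrow> 'a set) \<Rightarrow> 'a set" where
  "set_liminf B = (\<Union>n\<in>{1..}. \<Inter>m\<in>{n..}. B m)"

lemma prob_space_site_percolation: "prob_space (site_percolation p)"
  unfolding site_percolation_def by (intro prob_space_PiM measure_pmf.prob_space_axioms)

lemma open_clusters_restrict:
  "open_clusters B (restrict \<omega> B) = open_clusters B \<omega>"
proof -
  have "open_sites B (restrict \<omega> B) = open_sites B \<omega>"
    by (auto simp: open_sites_def)
  then show ?thesis by (simp add: open_clusters_def open_edges_def)
qed

lemma measurable_num_clusters:
  fixes B :: "(int ^ 'd) set"
  assumes "finite B"
  shows "num_clusters B \<in> measurable (site_percolation p) (count_space UNIV)"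
proof -
  let ?S = "\<Pi>\<^sub>E x\<in>B. (UNIV :: bool set)"
  have fin: "finite ?S" using assms by (intro finite_PiE) auto
  have comp: "(\<lambda>\<omega>. \<omega> x) \<in> measurable (site_percolation p) (count_space UNIV)" for x :: "int ^ 'd"
  proof -
    have "(\<lambda>\<omega>. \<omega> x) \<in> measurable (site_percolation p) (measure_pmf (bernoulli_pmf p))"
      unfolding site_percolation_def by (rule measurable_component_singleton) simp
    then show ?thesis by simp
  qed
  have pre: "{\<omega> \<in> space (site_percolation p). restrict \<omega> B = f} \<in> sets (site_percolation p)"
    if "f \<in> ?S" for f
  proof -
    have "{\<omega> \<in> space (site_percolation p). restrict \<omega> B = f}
        = {\<omega> \<in> space (site_percolation p). \<forall>x\<in>B. \<omega> x = f x}"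
      using that by (auto simp: fun_eq_iff PiE_def extensional_def restrict_def)
    also have "\<dots> \<in> sets (site_percolation p)"
    proof (rule sets.sets_Collect_finite_All[OF _ assms])
      fix x
      have "(\<lambda>\<omega>. \<omega> x) -` {f x} \<inter> space (site_percolation p) \<in> sets (site_percolation p)"
        by (rule measurable_sets[OF comp]) simp
      then show "{\<omega> \<in> space (site_percolation p). \<omega> x = f x} \<in> sets (site_percolation p)"
        by (simp add: vimage_def Int_def conj_commute)
    qed
    finally show ?thesis .
  qed
  have "(\<lambda>\<omega>. restrict \<omega> B) \<in> measurable (site_percolation p) (count_space ?S)"
    using fin pre by (subst measurable_count_space_eq2) (auto simp: vimage_def Int_def conj_commute)
  then have "(\<lambda>\<omega>. num_clusters B (restrict \<omega> B)) \<in> measurable (site_percolation p) (count_space UNIV)"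
    by (rule measurable_compose) simp
  then show ?thesis by (simp add: num_clusters_def open_clusters_restrict[abs_def] cong: measurable_cong)
qed

end

theory Submission
  imports Defs
begin

text \<open>
  The number of clusters in a finite set \<open>B\<close> depends only on the finite set \<open>S \<subseteq> B\<close> of open sites, so
  expectations are finite sums over \<open>Pow B\<close>. Write \<open>q = 1 - p\<close>, let \<open>D\<close> bound the degrees of the graph,
  let \<open>\<partial>C\<close> be the set of sites of \<open>B\<close> outside a cluster \<open>C\<close> that are adjacent to it (all of them closed),
  and let \<open>R\<^sub>K\<close> be the number of clusters with more than \<open>K\<close> sites. The difficulty is that the effect of
  one site on the number of clusters is not local: whether two neighbours of a site belong to the same
  cluster may be decided far away. Three ideas deal with it.

  Large clusters carry little variance. By the Efron-Stein inequality, \<open>Var R\<^sub>K\<close> is at most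
  \<open>p q\<close> times the sum of the mean squared effects of flipping one site. Opening a site leaves \<open>R\<^sub>K\<close> unchanged, or creates a large
  cluster out of small ones, or replaces the \<open>N \<ge> 1\<close> large clusters that it touches by one, which
  lowers \<open>R\<^sub>K\<close> by \<open>N - 1 \<le> D\<close>. As merging only lowers \<open>R\<^sub>K\<close>, the squared effects are controlled by the
  mean effect and by the probability of a creation. The mean effect is given by a formula of Russo type:
  up to the factor \<open>- p q\<close>, the sum of the mean effects is the expectation of the sum of \<open>p |\<partial>C| - q |C|\<close> over the large clusters \<open>C\<close>. The
  cluster of a given site equals \<open>A\<close> with probability \<open>p\<^bsup>|A|\<^esup> q\<^bsup>|\<partial>A|\<^esup>\<close>, and these numbers sum to at most 1
  for every value of the parameter; comparing two values bounds an exponential moment of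
  \<open>p |\<partial>C| - q |C|\<close>. Since there are at most \<open>|B| / K\<close> large clusters, the sum is at most of order \<open>|B| / sqrt K\<close>.
  Creations at geometrically growing values of \<open>K\<close> are disjoint events. Averaging \<open>R\<^sub>K\<close> over \<open>J\<close> such values
  therefore gives a variable of variance at most \<open>const * |B| / J\<close>, for every finite \<open>B\<close> (\<open>bvar_tail\<close>).

  What remains is local. After the averaged number of large clusters is subtracted, the number of
  clusters is a sum of bounded variables with a finite range of dependence. The characteristic function
  of such a sum nearly solves \<open>\<phi>' = - v t \<phi>\<close>, so it is close to a Gaussian one
  (\<open>cf_gaussian\<close>). Away from the boundary all sites contribute the same covariance,
  so the variance per site converges along sets with vanishing relative boundary (\<open>bvar_csum_density\<close>). Letting
  \<open>J\<close> tend to infinity gives the variance limit and the central limit theorem (\<open>variance_limit\<close>, \<open>cf_limit\<close>).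

  Isolated sites smooth the distribution. If all neighbours of a site are closed, its own state adds an
  independent Bernoulli variable to the count, and a positive fraction of the sites can be used in this
  way at the same time. Hence the characteristic function of the count is at most
  \<open>exp (- c t\<^sup>2 |B|)\<close> on \<open>[-\<pi>, \<pi>]\<close> (\<open>cf_decay\<close>). This makes the limiting variance positive and supplies the
  integrable bound with which one passes to the limit in the Fourier inversion formula
  (\<open>local_limit\<close>).
\<close>

section \<open>Expectations of functions of finitely many independent sites\<close>

text \<open>A configuration is identified with its set of open sites. The values lie in a normed field so that
  the same definition serves for means and for characteristic functions.\<close>

definition bexp :: "real \<Rightarrow> 'v set \<Rightarrow> ('v set \<Rightarrow> 'a::real_normed_field) \<Rightarrow> 'a" where
  "bexp p B f = (\<Sum>S\<in>Pow B. (p ^ card S * (1 - p) ^ card (B - S)) *\<^sub>R f S)"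

lemma bexp_empty [simp]: "bexp p {} f = f {}"
  by (simp add: bexp_def)

lemma bexp_cong: "(\<And>S. S \<subseteq> B \<Longrightarrow> f S = g S) \<Longrightarrow> bexp p B f = bexp p B g"
  unfolding bexp_def by (intro sum.cong) auto

lemma bexp_insert:
  assumes "finite B" "x \<notin> B"
  shows "bexp p (insert x B) f = p *\<^sub>R bexp p B (\<lambda>S. f (insert x S)) + (1 - p) *\<^sub>R bexp p B f"
proof -
  have "inj_on (insert x) (Pow B)"
    using assms by (auto simp: inj_on_def)
  moreover have "card (insert x S) = Suc (card S)" "insert x B - insert x S = B - S"
    "card (insert x B - S) = Suc (card (B - S))" if "S \<subseteq> B" for S
  proof -
    show "card (insert x S) = Suc (card S)"
      using assms that by (meson card_insert_disjoint finite_subset subsetD)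
    show "insert x B - insert x S = B - S" using assms that by auto
    have "insert x B - S = insert x (B - S)" using assms that by auto
    then show "card (insert x B - S) = Suc (card (B - S))" using assms by auto
  qed
  moreover have "Pow B \<inter> insert x ` Pow B = {}" using assms by auto
  ultimately show ?thesis
    using assms unfolding bexp_def
    by (simp add: Pow_insert sum.union_disjoint sum.reindex scaleR_sum_right mult.assoc mult.left_commute)
qed

lemma bexp_add: "bexp p B (\<lambda>S. f S + g S) = bexp p B f + bexp p B g"
  by (simp add: bexp_def sum.distrib scaleR_add_right)

lemma bexp_diff: "bexp p B (\<lambda>S. f S - g S) = bexp p B f - bexp p B g"
  by (simp add: bexp_def sum_subtractf scaleR_diff_right)

lemma bexp_minus: "bexp p B (\<lambda>S. - f S) = - bexp p B f"
  by (simp add: bexp_def sum_negf)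

lemma bexp_cmult: "bexp p B (\<lambda>S. c * f S) = c * bexp p B f"
  by (simp add: bexp_def sum_distrib_left)

lemma bexp_cmult_right: "bexp p B (\<lambda>S. f S * c) = bexp p B f * c"
  by (simp add: bexp_def sum_distrib_right)

lemma bexp_sum: "bexp p B (\<lambda>S. \<Sum>i\<in>I. f i S) = (\<Sum>i\<in>I. bexp p B (f i))"
  unfolding bexp_def by (subst sum.swap) (simp add: scaleR_sum_right)

lemma bexp_const: "finite B \<Longrightarrow> bexp p B (\<lambda>_. c) = c"
proof (induction B rule: finite_induct)
  case (insert x B)
  then show ?case by (simp add: bexp_insert flip: scaleR_left.add)
qed simp

lemma bexp_of_real: "bexp p B (\<lambda>S. of_real (f S)) = of_real (bexp p B f)"
  by (simp add: bexp_def scaleR_conv_of_real)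

lemma bexp_mono:
  fixes f g :: "'v set \<Rightarrow> real"
  assumes "0 \<le> p" "p \<le> 1" "\<And>S. S \<subseteq> B \<Longrightarrow> f S \<le> g S"
  shows "bexp p B f \<le> bexp p B g"
  unfolding bexp_def using assms by (intro sum_mono) (auto intro!: mult_left_mono)

lemma bexp_nonneg:
  fixes f :: "'v set \<Rightarrow> real"
  assumes "0 \<le> p" "p \<le> 1" "\<And>S. S \<subseteq> B \<Longrightarrow> 0 \<le> f S"
  shows "0 \<le> bexp p B f"
  unfolding bexp_def using assms by (intro sum_nonneg) auto

lemma norm_bexp_le:
  assumes "0 \<le> p" "p \<le> 1"
  shows "norm (bexp p B f) \<le> bexp p B (\<lambda>S. norm (f S))"
  unfolding bexp_def using assms by (intro sum_norm_le) simp

lemma norm_bexp_le_const: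
  assumes "0 \<le> p" "p \<le> 1" "finite B" "\<And>S. S \<subseteq> B \<Longrightarrow> norm (f S) \<le> c"
  shows "norm (bexp p B f) \<le> c"
proof -
  have "norm (bexp p B f) \<le> bexp p B (\<lambda>S. norm (f S))"
    using assms by (intro norm_bexp_le)
  also have "\<dots> \<le> bexp p B (\<lambda>_. c)" using assms by (intro bexp_mono)
  finally show ?thesis using assms by (simp add: bexp_const)
qed

lemma bexp_union:
  assumes "finite A" "finite B" "A \<inter> B = {}"
  shows "bexp p (A \<union> B) f = bexp p A (\<lambda>S. bexp p B (\<lambda>T. f (S \<union> T)))"
  using assms
proof (induction A arbitrary: f rule: finite_induct)
  case (insert x A)
  then show ?case by (simp add: bexp_insert)
qed simp

lemma bexp_superset:
  assumes "finite B" "A \<subseteq> B" "\<And>S. S \<subseteq> B \<Longrightarrow> f S = f (S \<inter> A)"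
  shows "bexp p B f = bexp p A f"
proof -
  have fin: "finite A" "finite (B - A)" using assms finite_subset by auto
  have "bexp p B f = bexp p (A \<union> (B - A)) f"
    using assms by (simp add: Un_absorb1)
  also have "\<dots> = bexp p A (\<lambda>S. bexp p (B - A) (\<lambda>T. f (S \<union> T)))"
    using fin by (intro bexp_union) auto
  also have "\<dots> = bexp p A f"
  proof (rule bexp_cong)
    fix S assume S: "S \<subseteq> A"
    have "bexp p (B - A) (\<lambda>T. f (S \<union> T)) = bexp p (B - A) (\<lambda>T. f S)"
    proof (rule bexp_cong)
      fix T assume T: "T \<subseteq> B - A"
      have "f (S \<union> T) = f ((S \<union> T) \<inter> A)" using S T assms(2) by (intro assms) auto
      also have "(S \<union> T) \<inter> A = S" using S T by auto
      finally show "f (S \<union> T) = f S" .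
    qed
    then show "bexp p (B - A) (\<lambda>T. f (S \<union> T)) = f S" using fin by (simp add: bexp_const)
  qed
  finally show ?thesis .
qed

lemma bexp_indep:
  assumes "finite B" "A \<inter> A' = {}"
    and f: "\<And>S. S \<subseteq> B \<Longrightarrow> f S = f (S \<inter> A)"
    and g: "\<And>S. S \<subseteq> B \<Longrightarrow> g S = g (S \<inter> A')"
  shows "bexp p B (\<lambda>S. f S * g S) = bexp p B f * bexp p B g"
proof -
  define A1 where "A1 = B \<inter> A"
  define A2 where "A2 = B - A"
  have f1: "f S = f (S \<inter> A1)" and g1: "g S = g (S \<inter> A2)" if "S \<subseteq> B" for S
  proof -
    have "S \<inter> A1 = S \<inter> A" "S \<inter> A' = (S \<inter> A2) \<inter> A'" using that assms(2) by (auto simp: A1_def A2_def)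
    then show "f S = f (S \<inter> A1)" "g S = g (S \<inter> A2)"
      using f[OF that] g[OF that] g[of "S \<inter> A2"] that by (metis, metis inf.coboundedI1)
  qed
  have fin: "finite A1" "finite A2" and B: "A1 \<union> A2 = B" and d: "A1 \<inter> A2 = {}"
    and sub: "A1 \<subseteq> B" "A2 \<subseteq> B"
    using assms by (auto simp: A1_def A2_def)
  have "bexp p B (\<lambda>S. f S * g S) = bexp p A1 (\<lambda>S. bexp p A2 (\<lambda>T. f (S \<union> T) * g (S \<union> T)))"
    using bexp_union[OF fin d, of p "\<lambda>S. f S * g S"] B by simp
  also have "\<dots> = bexp p A1 (\<lambda>S. bexp p A2 (\<lambda>T. f S * g T))"
  proof (intro bexp_cong)
    fix S T assume S: "S \<subseteq> A1" and T: "T \<subseteq> A2"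
    have "(S \<union> T) \<inter> A1 = S" "(S \<union> T) \<inter> A2 = T" "S \<union> T \<subseteq> B"
      using S T d sub by auto
    then show "f (S \<union> T) * g (S \<union> T) = f S * g T"
      using f1[of "S \<union> T"] g1[of "S \<union> T"] by simp
  qed
  also have "\<dots> = bexp p A1 f * bexp p A2 g"
    by (simp add: bexp_cmult bexp_cmult_right)
  also have "bexp p A1 f = bexp p B f"
    using assms sub f1 by (intro bexp_superset[symmetric]) auto
  also have "bexp p A2 g = bexp p B g"
    using assms sub g1 by (intro bexp_superset[symmetric]) auto
  finally show ?thesis .
qed

lemma bexp_image:
  assumes "finite B" "inj_on \<tau> B"
  shows "bexp p (\<tau> ` B) f = bexp p B (\<lambda>S. f (\<tau> ` S))"
proof -
  have "bexp p (\<tau> ` B) f = (\<Sum>S\<in>(\<lambda>S. \<tau> ` S) ` Pow B. (p ^ card S * (1 - p) ^ card (\<tau> ` B - S)) *\<^sub>R f S)"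
    unfolding bexp_def by (rule sum.cong) (auto simp: image_Pow_surj)
  also have "\<dots> = (\<Sum>S\<in>Pow B. (p ^ card (\<tau> ` S) * (1 - p) ^ card (\<tau> ` B - \<tau> ` S)) *\<^sub>R f (\<tau> ` S))"
    using assms by (subst sum.reindex) (auto intro: inj_on_image_Pow)
  also have "\<dots> = bexp p B (\<lambda>S. f (\<tau> ` S))"
    unfolding bexp_def
  proof (rule sum.cong)
    fix S assume S: "S \<in> Pow B"
    have "card (\<tau> ` S) = card S" using assms S by (intro card_image) (auto intro: inj_on_subset)
    moreover have "card (\<tau> ` B - \<tau> ` S) = card (B - S)"
    proof -
      have "\<tau> ` B - \<tau> ` S = \<tau> ` (B - S)" using assms S by (auto simp: inj_on_def)
      then show ?thesis using assms by (metis card_image inj_on_subset Diff_subset)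
    qed
    ultimately show "(p ^ card (\<tau> ` S) * (1 - p) ^ card (\<tau> ` B - \<tau> ` S)) *\<^sub>R f (\<tau> ` S) =
        (p ^ card S * (1 - p) ^ card (B - S)) *\<^sub>R f (\<tau> ` S)" by simp
  qed simp
  finally show ?thesis .
qed

text \<open>Conditioning on the state of \<open>x\<close>, which \<open>insert x S\<close> and \<open>S - {x}\<close> do not depend on; all three means are still over \<open>Pow B\<close>.\<close>
lemma bexp_site:
  assumes "finite B" "x \<in> B"
  shows "bexp p B f = p *\<^sub>R bexp p B (\<lambda>S. f (insert x S)) + (1 - p) *\<^sub>R bexp p B (\<lambda>S. f (S - {x}))"
proof -
  define A where "A = B - {x}"
  have A: "B = insert x A" "x \<notin> A" "finite A" "A \<subseteq> B" using assms by (auto simp: A_def)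
  have "bexp p B (\<lambda>S. f (insert x S)) = bexp p A (\<lambda>S. f (insert x S))"
    using assms A by (intro bexp_superset) (auto intro!: arg_cong[where f=f])
  moreover have "bexp p B (\<lambda>S. f (S - {x})) = bexp p A f"
  proof -
    have "bexp p B (\<lambda>S. f (S - {x})) = bexp p A (\<lambda>S. f (S - {x}))"
      using assms A by (intro bexp_superset) (auto intro!: arg_cong[where f=f])
    also have "\<dots> = bexp p A f" using A by (intro bexp_cong) (auto intro!: arg_cong[where f=f])
    finally show ?thesis .
  qed
  ultimately show ?thesis using A by (simp add: bexp_insert)
qed

lemma bexp_open_site:
  fixes f :: "'v set \<Rightarrow> real"
  assumes "finite B" "x \<in> B"
  shows "bexp p B (\<lambda>S. if x \<in> S then f (S - {x}) else 0) = p * bexp p B (\<lambda>S. f (S - {x}))"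
    and "bexp p B (\<lambda>S. if x \<in> S then 0 else f (S - {x})) = (1 - p) * bexp p B (\<lambda>S. f (S - {x}))"
  by (subst bexp_site[OF assms]; simp add: bexp_const assms)+

definition bvar :: "real \<Rightarrow> 'v set \<Rightarrow> ('v set \<Rightarrow> real) \<Rightarrow> real" where
  "bvar p B f = bexp p B (\<lambda>S. (f S - bexp p B f)\<^sup>2)"

lemma bvar_eq: "finite B \<Longrightarrow> bvar p B f = bexp p B (\<lambda>S. (f S)\<^sup>2) - (bexp p B f)\<^sup>2"
  by (simp add: bvar_def power2_diff bexp_add bexp_diff bexp_cmult bexp_const bexp_cmult_right)
    (simp add: power2_eq_square)

lemma bvar_nonneg: "0 \<le> p \<Longrightarrow> p \<le> 1 \<Longrightarrow> 0 \<le> bvar p B f"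
  unfolding bvar_def by (rule bexp_nonneg) auto

lemma bexp_power2_le:
  fixes f :: "'v set \<Rightarrow> real"
  assumes "finite B" "0 \<le> p" "p \<le> 1"
  shows "(bexp p B f)\<^sup>2 \<le> bexp p B (\<lambda>S. (f S)\<^sup>2)"
  using bvar_nonneg[of p B f] bvar_eq[of B p f] assms by simp

lemma bexp_abs_le_sqrt_bvar:
  assumes "finite B" "0 \<le> p" "p \<le> 1"
  shows "bexp p B (\<lambda>S. \<bar>f S - bexp p B f\<bar>) \<le> sqrt (bvar p B f)"
  using bexp_power2_le[OF assms, of "\<lambda>S. \<bar>f S - bexp p B f\<bar>"]
  by (intro real_le_rsqrt) (simp add: bvar_def)

definition flip_diff :: "'v \<Rightarrow> ('v set \<Rightarrow> real) \<Rightarrow> 'v set \<Rightarrow> real" where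
  "flip_diff x f S = f (insert x S) - f (S - {x})"

text \<open>Adding one site to \<open>B\<close> splits the variance into the part due to that site and the variance of the
  conditional mean \<open>g\<close>. Flipping another site changes \<open>g\<close> by an average of changes of \<open>f\<close>, so by convexity
  its squared effects are no larger than those of \<open>f\<close>, and the induction closes.\<close>
theorem efron_stein:
  assumes "finite B" "0 \<le> p" "p \<le> 1"
  shows "bvar p B f \<le> p * (1 - p) * (\<Sum>x\<in>B. bexp p B (\<lambda>S. (flip_diff x f S)\<^sup>2))"
  using assms(1)
proof (induction B arbitrary: f rule: finite_induct)
  case empty
  then show ?case by (simp add: bvar_def)
next
  case (insert x B)
  define g where "g S = p * f (insert x S) + (1 - p) * f S" for S
  let ?E = "bexp p B"
  have ins: "insert x S - {x} = S" "S - {x} = S" if "S \<subseteq> B" for S using insert that by auto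
  have "bvar p (insert x B) f = p * (1 - p) * ?E (\<lambda>S. (f (insert x S) - f S)\<^sup>2) + bvar p B g"
  proof -
    have 1: "?E g = p * ?E (\<lambda>S. f (insert x S)) + (1 - p) * ?E f"
      by (simp add: g_def[abs_def] bexp_add bexp_cmult)
    have 2: "p * (1 - p) * ?E (\<lambda>S. (f (insert x S) - f S)\<^sup>2) + ?E (\<lambda>S. (g S)\<^sup>2)
        = p * ?E (\<lambda>S. (f (insert x S))\<^sup>2) + (1 - p) * ?E (\<lambda>S. (f S)\<^sup>2)"
      unfolding g_def bexp_cmult[symmetric] bexp_add[symmetric]
      by (rule bexp_cong) (simp add: power2_eq_square algebra_simps)
    show ?thesis
      using insert 1 2 by (simp add: bvar_eq bexp_insert)
  qed
  also have "bvar p B g \<le> p * (1 - p) * (\<Sum>y\<in>B. ?E (\<lambda>S. (flip_diff y g S)\<^sup>2))"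
    by (rule insert.IH)
  also have "(\<Sum>y\<in>B. ?E (\<lambda>S. (flip_diff y g S)\<^sup>2)) \<le> (\<Sum>y\<in>B. bexp p (insert x B) (\<lambda>S. (flip_diff y f S)\<^sup>2))"
  proof (rule sum_mono)
    fix y assume "y \<in> B"
    then have xy: "x \<noteq> y" using insert by auto
    have "?E (\<lambda>S. (flip_diff y g S)\<^sup>2) \<le>
       ?E (\<lambda>S. p * (flip_diff y f (insert x S))\<^sup>2 + (1 - p) * (flip_diff y f S)\<^sup>2)"
    proof (rule bexp_mono)
      fix S
      define a b where "a = flip_diff y f (insert x S)" and "b = flip_diff y f S"
      have "flip_diff y g S = p * a + (1 - p) * b"
        using xy by (simp add: flip_diff_def g_def a_def b_def insert_commute insert_Diff_if algebra_simps)
      moreover have "p * a\<^sup>2 + (1 - p) * b\<^sup>2 - (p * a + (1 - p) * b)\<^sup>2 = p * (1 - p) * (a - b)\<^sup>2"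
        by (simp add: power2_eq_square algebra_simps)
      moreover have "0 \<le> p * (1 - p) * (a - b)\<^sup>2" using assms by simp
      ultimately show "(flip_diff y g S)\<^sup>2 \<le> p * a\<^sup>2 + (1 - p) * b\<^sup>2" by simp
    qed (use assms in auto)
    then show "?E (\<lambda>S. (flip_diff y g S)\<^sup>2) \<le> bexp p (insert x B) (\<lambda>S. (flip_diff y f S)\<^sup>2)"
      using insert by (simp add: bexp_insert bexp_add bexp_cmult)
  qed
  also have "?E (\<lambda>S. (f (insert x S) - f S)\<^sup>2) = bexp p (insert x B) (\<lambda>S. (flip_diff x f S)\<^sup>2)"
  proof -
    have "bexp p (insert x B) (\<lambda>S. (flip_diff x f S)\<^sup>2) =
        p * ?E (\<lambda>S. (f (insert x S) - f S)\<^sup>2) + (1 - p) * ?E (\<lambda>S. (f (insert x S) - f S)\<^sup>2)"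
      using insert ins
      by (simp add: bexp_insert flip_diff_def cong: bexp_cong)
    then show ?thesis by (simp add: algebra_simps)
  qed
  finally show ?case using assms insert
    by (simp add: distrib_left mult_left_mono)
qed

section \<open>Open clusters in a graph of bounded degree\<close>
locale site_graph =
  fixes adj :: "'v \<Rightarrow> 'v \<Rightarrow> bool" and D :: nat
  assumes adj_sym: "adj x y \<Longrightarrow> adj y x"
    and adj_irrefl: "\<not> adj x x"
    and finite_nbrs: "finite {y. adj x y}"
    and card_nbrs: "card {y. adj x y} \<le> D"
    and D_pos: "1 \<le> D"
begin

definition edges :: "'v set \<Rightarrow> 'v rel" where
  "edges S = {(x, y). x \<in> S \<and> y \<in> S \<and> adj x y}"

definition cluster :: "'v set \<Rightarrow> 'v \<Rightarrow> 'v set" where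
  "cluster S x = {y. (x, y) \<in> (edges S)\<^sup>*}"

definition clusters :: "'v set \<Rightarrow> 'v set set" where
  "clusters S = cluster S ` S"

definition touches :: "'v \<Rightarrow> 'v set \<Rightarrow> bool" where
  "touches x C \<longleftrightarrow> (\<exists>c\<in>C. adj x c)"

lemma cluster_refl [simp]: "x \<in> cluster S x"
  by (simp add: cluster_def)

lemma cluster_step:
  assumes "y \<in> cluster S x" "y \<in> S" "z \<in> S" "adj y z"
  shows "z \<in> cluster S x"
proof -
  have "(y, z) \<in> edges S" using assms by (simp add: edges_def)
  then show ?thesis using assms(1) unfolding cluster_def by (auto intro: rtrancl_into_rtrancl)
qed

lemma cluster_subset:
  assumes "x \<in> S"
  shows "cluster S x \<subseteq> S"
proof
  fix y assume "y \<in> cluster S x"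
  then have "(x, y) \<in> (edges S)\<^sup>*" by (simp add: cluster_def)
  then show "y \<in> S" using assms by (induction rule: rtrancl_induct) (auto simp: edges_def)
qed

lemma cluster_mono: "S \<subseteq> T \<Longrightarrow> cluster S x \<subseteq> cluster T x"
proof -
  assume "S \<subseteq> T"
  then have "edges S \<subseteq> edges T" by (auto simp: edges_def)
  then have "(edges S)\<^sup>* \<subseteq> (edges T)\<^sup>*" by (rule rtrancl_mono)
  then show ?thesis by (auto simp: cluster_def)
qed

lemma sym_edges: "sym ((edges S)\<^sup>*)"
  by (intro sym_rtrancl symI) (auto simp: edges_def adj_sym)

lemma cluster_eq: "y \<in> cluster S x \<Longrightarrow> cluster S y = cluster S x"
  unfolding cluster_def using sym_edges[of S]
  by (auto dest: symD intro: rtrancl_trans)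

lemma cluster_eqI:
  assumes "x \<in> A" and sub: "A \<subseteq> cluster S x"
    and closed: "\<And>a b. a \<in> A \<Longrightarrow> b \<in> S \<Longrightarrow> adj a b \<Longrightarrow> b \<in> A"
  shows "cluster S x = A"
proof
  show "cluster S x \<subseteq> A"
  proof
    fix y assume "y \<in> cluster S x"
    then have "(x, y) \<in> (edges S)\<^sup>*" by (simp add: cluster_def)
    then show "y \<in> A" using assms(1)
      by (induction rule: rtrancl_induct) (auto simp: edges_def intro: closed)
  qed
qed (rule sub)

lemma cluster_cluster: 
  assumes "x \<in> S"
  shows "cluster (cluster S x) x = cluster S x"
proof
  show "cluster (cluster S x) x \<subseteq> cluster S x"
    by (rule cluster_subset) simp
  show "cluster S x \<subseteq> cluster (cluster S x) x"
  proof
    fix y assume "y \<in> cluster S x"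
    then have "(x, y) \<in> (edges S)\<^sup>*" by (simp add: cluster_def)
    then show "y \<in> cluster (cluster S x) x"
    proof (induction rule: rtrancl_induct)
      case (step y z)
      have "y \<in> cluster S x" using step(1) by (simp add: cluster_def)
      moreover have "z \<in> cluster S x" using step(1,2) by (simp add: cluster_def)
      ultimately show ?case using step(2,3) cluster_step[of y "cluster S x" x z] by (auto simp: edges_def)
    qed simp
  qed
qed

lemma cluster_in_clusters: "x \<in> S \<Longrightarrow> cluster S x \<in> clusters S"
  by (simp add: clusters_def)

lemma clustersE:
  assumes "C \<in> clusters S" "y \<in> C"
  shows "y \<in> S" "C = cluster S y"
proof -
  obtain x where x: "x \<in> S" "C = cluster S x" using assms by (auto simp: clusters_def)
  then show "y \<in> S" using assms cluster_subset by blast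
  show "C = cluster S y" using x assms cluster_eq by blast
qed

lemma finite_clusters [simp]: "finite S \<Longrightarrow> finite (clusters S)"
  by (simp add: clusters_def)

lemma clusters_subset: "C \<in> clusters S \<Longrightarrow> C \<subseteq> S"
  using clustersE by blast

lemma clusters_nonempty: "C \<in> clusters S \<Longrightarrow> C \<noteq> {}"
  unfolding clusters_def using cluster_refl by blast

lemma clusters_disjoint: "C \<in> clusters S \<Longrightarrow> C' \<in> clusters S \<Longrightarrow> C \<noteq> C' \<Longrightarrow> C \<inter> C' = {}"
  using clustersE(2) by (metis disjoint_iff)

lemma Union_clusters: "\<Union>(clusters S) = S"
  using clusters_subset cluster_in_clusters cluster_refl by blast

lemma sum_sites_clusters:
  fixes f :: "'v \<Rightarrow> 'b::comm_monoid_add"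
  assumes "finite S"
  shows "(\<Sum>x\<in>S. f x) = (\<Sum>C\<in>clusters S. \<Sum>x\<in>C. f x)"
proof -
  have "(\<Sum>x\<in>\<Union>(clusters S). f x) = (\<Sum>C\<in>clusters S. \<Sum>x\<in>C. f x)"
    using assms clusters_subset clusters_disjoint
    by (subst sum.Union_disjoint) (auto intro: finite_subset)
  then show ?thesis by (simp add: Union_clusters)
qed

text \<open>Each cluster distributes its value evenly among its sites. This turns sums over the random family of
  clusters into sums over sites, both for estimates and for the decomposition into local terms.\<close>
lemma sum_clusters_per_site:
  fixes h :: "'v set \<Rightarrow> real"
  assumes "finite S"
  shows "(\<Sum>C\<in>clusters S. h C) = (\<Sum>x\<in>S. h (cluster S x) / card (cluster S x))"
proof -
  have "(\<Sum>x\<in>C. h (cluster S x) / card (cluster S x)) = h C" if C: "C \<in> clusters S" for C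
  proof -
    have "(\<Sum>x\<in>C. h (cluster S x) / card (cluster S x)) = (\<Sum>x\<in>C. h C / card C)"
      using clustersE(2)[OF C] by (intro sum.cong) auto
    moreover have "card C \<noteq> 0"
      using clusters_nonempty[OF C] clusters_subset[OF C] assms finite_subset by fastforce
    ultimately show ?thesis by simp
  qed
  then show ?thesis by (simp add: sum_sites_clusters[OF assms])
qed

text \<open>Opening \<open>x\<close> fuses \<open>x\<close> with the clusters that it touches and leaves all others as they were.\<close>
lemma clusters_insert:
  fixes S x
  defines "N \<equiv> {C \<in> clusters S. touches x C}"
  defines "U \<equiv> insert x (\<Union>N)"
  assumes "x \<notin> S"
  shows "clusters (insert x S) = insert U (clusters S - N)"
    and "cluster (insert x S) x = U"
proof -
  have NS: "C \<subseteq> S" if "C \<in> N" for C using that clusters_subset by (auto simp: N_def)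
  have mono: "cluster S y \<subseteq> cluster (insert x S) y" for y by (rule cluster_mono) auto
  have Uconn: "U \<subseteq> cluster (insert x S) x"
  proof
    fix y assume "y \<in> U"
    then consider "y = x" | C where "C \<in> N" "y \<in> C" by (auto simp: U_def)
    then show "y \<in> cluster (insert x S) x"
    proof cases
      case 2
      then obtain c where c: "c \<in> C" "adj x c" by (auto simp: N_def touches_def)
      have "C \<in> clusters S" using 2 by (simp add: N_def)
      note C = clustersE[OF this c(1)]
      have "c \<in> cluster (insert x S) x" using c C cluster_step[of x "insert x S" x c] by simp
      then have "cluster (insert x S) c = cluster (insert x S) x" by (rule cluster_eq)
      then show ?thesis using mono[of c] C 2 by auto
    qed simp
  qed
  have Ucl: "b \<in> U" if a: "a \<in> U" "b \<in> insert x S" "adj a b" for a b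
  proof -
    consider "b = x" | "b \<in> S" "a = x" | C where "b \<in> S" "C \<in> N" "a \<in> C"
      using a by (auto simp: U_def)
    then show ?thesis
    proof cases
      case 2
      then have "cluster S b \<in> N" using a by (auto simp: N_def clusters_def touches_def intro: cluster_refl)
      then have "b \<in> \<Union>N" using cluster_refl[of b S] by blast
      then show ?thesis by (simp add: U_def)
    next
      case 3
      then have "C \<in> clusters S" by (simp add: N_def)
      note clustersE[OF this \<open>a \<in> C\<close>]
      then have "b \<in> C" using a 3 cluster_step[of a S a b] by simp
      then show ?thesis using 3 by (auto simp: U_def)
    qed (simp add: U_def)
  qed
  show clx: "cluster (insert x S) x = U"
    using Uconn Ucl by (intro cluster_eqI) (auto simp: U_def)
  have other: "cluster (insert x S) y = cluster S y" if y: "y \<in> S" "cluster S y \<notin> N" for y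
  proof (rule cluster_eqI)
    fix a b assume ab: "a \<in> cluster S y" "b \<in> insert x S" "adj a b"
    have "b \<noteq> x"
    proof
      assume "b = x"
      then have "touches x (cluster S y)" using ab adj_sym by (auto simp: touches_def)
      then show False using y by (auto simp: N_def clusters_def)
    qed
    then show "b \<in> cluster S y" using ab y cluster_subset[of y S] cluster_step[of a S y b] by auto
  qed (use mono in auto)
  have touched: "cluster (insert x S) y = U" if "y \<in> U" for y
    using cluster_eq[of y "insert x S" x] clx that by auto
  show "clusters (insert x S) = insert U (clusters S - N)"
  proof (intro equalityI subsetI)
    fix C assume "C \<in> clusters (insert x S)"
    then obtain y where y: "y \<in> insert x S" "C = cluster (insert x S) y" by (auto simp: clusters_def)
    show "C \<in> insert U (clusters S - N)"
    proof (cases "y \<in> U")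
      case False
      then have "y \<in> S" "cluster S y \<notin> N" using y cluster_refl[of y S] by (auto simp: U_def)
      then show ?thesis using other y by (auto simp: clusters_def)
    qed (use touched y in simp)
  next
    fix C assume C: "C \<in> insert U (clusters S - N)"
    show "C \<in> clusters (insert x S)"
    proof (cases "C = U")
      case True
      then show ?thesis using clx cluster_in_clusters[of x "insert x S"] by simp
    next
      case False
      then obtain y where "y \<in> S" "C = cluster S y" "C \<notin> N" using C by (auto simp: clusters_def)
      then show ?thesis using other[of y] cluster_in_clusters[of y "insert x S"] by simp
    qed
  qed
qed

definition csum :: "(nat \<Rightarrow> real) \<Rightarrow> 'v set \<Rightarrow> real" where
  "csum w S = (\<Sum>C\<in>clusters S. w (card C))"

lemma card_touching:
  assumes "finite S"
  shows "card {C \<in> clusters S. touches x C} \<le> D"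
proof -
  have "{C \<in> clusters S. touches x C} \<subseteq> cluster S ` {y. adj x y}"
    using clustersE(2) by (fastforce simp: touches_def)
  then have "card {C \<in> clusters S. touches x C} \<le> card {y. adj x y}"
    using finite_nbrs by (meson card_image_le card_mono finite_imageI le_trans)
  then show ?thesis using card_nbrs[of x] by simp
qed

lemma card_cluster_insert:
  assumes "finite S" "x \<notin> S"
  shows "card (cluster (insert x S) x) = Suc (\<Sum>C\<in>{C \<in> clusters S. touches x C}. card C)"
proof -
  let ?N = "{C \<in> clusters S. touches x C}"
  have "x \<notin> \<Union>?N" using assms clusters_subset by auto
  moreover have "finite (\<Union>?N)" using assms clusters_subset by (metis (no_types, lifting) Union_clusters Union_mono finite_subset mem_Collect_eq subsetI)
  moreover have "card (\<Union>?N) = (\<Sum>C\<in>?N. card C)"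
  proof (rule card_Union_disjoint)
    show "pairwise disjnt ?N"
      unfolding pairwise_def disjnt_def by (metis (no_types, lifting) clusters_disjoint mem_Collect_eq)
    show "finite C" if "C \<in> ?N" for C
      using that clusters_subset assms(1) finite_subset by (metis (no_types, lifting) mem_Collect_eq)
  qed
  ultimately show ?thesis using assms by (simp add: clusters_insert(2))
qed

lemma csum_insert:
  assumes "finite S" "x \<notin> S"
  shows "csum w (insert x S) - csum w S =
    w (card (cluster (insert x S) x)) - (\<Sum>C\<in>{C \<in> clusters S. touches x C}. w (card C))"
proof -
  let ?N = "{C \<in> clusters S. touches x C}"
  let ?U = "insert x (\<Union>?N)"
  have "?U \<notin> clusters S" using assms clusters_subset by blast
  then have "csum w (insert x S) = w (card ?U) + (\<Sum>C\<in>clusters S - ?N. w (card C))"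
    using assms by (simp add: csum_def clusters_insert(1))
  moreover have "csum w S = (\<Sum>C\<in>clusters S - ?N. w (card C)) + (\<Sum>C\<in>?N. w (card C))"
    unfolding csum_def using assms by (intro sum.subset_diff) auto
  ultimately show ?thesis using assms by (simp add: clusters_insert(2))
qed

definition bd :: "'v set \<Rightarrow> 'v set \<Rightarrow> 'v set" where
  "bd B A = {y \<in> B - A. touches y A}"

lemma bd_subset: "bd B A \<subseteq> B" by (auto simp: bd_def)

text \<open>The cluster of \<open>v\<close> is \<open>A\<close> exactly when \<open>A\<close> is open and its boundary in \<open>B\<close> is closed; the remaining sites
  are free. Hence this event has probability \<open>p\<^bsup>|A|\<^esup> q\<^bsup>|\<partial>A|\<^esup>\<close>.\<close>
lemma cluster_fibre:
  assumes A: "A \<subseteq> B" "v \<in> A" "cluster A v = A"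
  shows "{S. S \<subseteq> B \<and> v \<in> S \<and> cluster S v = A} = (\<lambda>T. A \<union> T) ` Pow (B - A - bd B A)"
proof (intro equalityI subsetI)
  fix S assume "S \<in> {S. S \<subseteq> B \<and> v \<in> S \<and> cluster S v = A}"
  then have S: "S \<subseteq> B" "v \<in> S" "cluster S v = A" by auto
  have AS: "A \<subseteq> S" using cluster_subset[OF S(2)] S(3) by simp
  have "S \<inter> bd B A = {}"
  proof (rule ccontr)
    assume "S \<inter> bd B A \<noteq> {}"
    then obtain y a where y: "y \<in> S" "y \<notin> A" "a \<in> A" "adj y a" by (auto simp: bd_def touches_def)
    then have "y \<in> cluster S v" using AS S cluster_step[of a S v y] adj_sym by auto
    then show False using y S by simp
  qed
  then have "S - A \<in> Pow (B - A - bd B A)" using S by auto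
  moreover have "S = A \<union> (S - A)" using AS by auto
  ultimately show "S \<in> (\<lambda>T. A \<union> T) ` Pow (B - A - bd B A)" by blast
next
  fix S assume "S \<in> (\<lambda>T. A \<union> T) ` Pow (B - A - bd B A)"
  then obtain T where T: "T \<subseteq> B - A - bd B A" "S = A \<union> T" by auto
  have "cluster S v = A"
  proof (rule cluster_eqI)
    show "A \<subseteq> cluster S v" using cluster_mono[of A S v] A(3) T by simp
    fix a b assume ab: "a \<in> A" "b \<in> S" "adj a b"
    show "b \<in> A"
    proof (rule ccontr)
      assume "b \<notin> A"
      then have "b \<in> T" using ab T by simp
      then have "b \<in> bd B A" using ab T \<open>b \<notin> A\<close> adj_sym by (auto simp: bd_def touches_def)
      then show False using \<open>b \<in> T\<close> T by auto
    qed
  qed (rule A)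
  then show "S \<in> {S. S \<subseteq> B \<and> v \<in> S \<and> cluster S v = A}" using A T by auto
qed

lemma bexp_cluster:
  fixes F :: "'v set \<Rightarrow> real"
  assumes "finite B"
  shows "bexp p B (\<lambda>S. if v \<in> S then F (cluster S v) else 0) =
    (\<Sum>A\<in>{A. A \<subseteq> B \<and> v \<in> A \<and> cluster A v = A}. p ^ card A * (1 - p) ^ card (bd B A) * F A)"
proof -
  let ?W = "\<lambda>B S. p ^ card S * (1 - p) ^ card (B - S)"
  let ?A = "{A. A \<subseteq> B \<and> v \<in> A \<and> cluster A v = A}"
  have finA: "finite ?A" using assms by (auto intro: finite_subset[of _ "Pow B"])
  have "bexp p B (\<lambda>S. if v \<in> S then F (cluster S v) else 0) =
      (\<Sum>S\<in>{S. S \<subseteq> B \<and> v \<in> S}. ?W B S * F (cluster S v))"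
    unfolding bexp_def using assms
    by (intro sum.mono_neutral_cong_right) (auto)
  also have "\<dots> = (\<Sum>A\<in>?A. \<Sum>S\<in>{S \<in> {S. S \<subseteq> B \<and> v \<in> S}. cluster S v = A}. ?W B S * F (cluster S v))"
  proof -
    let ?X = "{S. S \<subseteq> B \<and> v \<in> S}"
    have "finite ?X" using assms by (auto intro: finite_subset[of _ "Pow B"])
    moreover have "(\<lambda>S. cluster S v) ` ?X \<subseteq> ?A"
    proof
      fix A assume "A \<in> (\<lambda>S. cluster S v) ` ?X"
      then obtain S where S: "S \<subseteq> B" "v \<in> S" "A = cluster S v" by auto
      then show "A \<in> ?A" using cluster_subset[OF S(2)] cluster_cluster[OF S(2)] by auto
    qed
    ultimately show ?thesis
      using sum.group[of ?X ?A "\<lambda>S. cluster S v" "\<lambda>S. ?W B S * F (cluster S v)"] finA by simp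
  qed
  also have "\<dots> = (\<Sum>A\<in>?A. p ^ card A * (1 - p) ^ card (bd B A) * F A)"
  proof (rule sum.cong)
    fix A assume "A \<in> ?A"
    then have A: "A \<subseteq> B" "v \<in> A" "cluster A v = A" by auto
    let ?R = "B - A - bd B A"
    have fin: "finite A" "finite ?R" "finite (bd B A)"
      using finite_subset[OF A(1) assms] finite_subset[OF bd_subset assms] assms by auto
    have "(\<Sum>S\<in>{S \<in> {S. S \<subseteq> B \<and> v \<in> S}. cluster S v = A}. ?W B S * F (cluster S v)) =
        (\<Sum>S\<in>(\<lambda>T. A \<union> T) ` Pow ?R. ?W B S * F A)"
    proof (rule sum.cong)
      show "{S \<in> {S. S \<subseteq> B \<and> v \<in> S}. cluster S v = A} = (\<lambda>T. A \<union> T) ` Pow ?R"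
        using cluster_fibre[OF A] by simp
      fix S assume "S \<in> (\<lambda>T. A \<union> T) ` Pow ?R"
      then have "S \<in> {S. S \<subseteq> B \<and> v \<in> S \<and> cluster S v = A}" using cluster_fibre[OF A] by simp
      then show "?W B S * F (cluster S v) = ?W B S * F A" by simp
    qed
    also have "\<dots> = (\<Sum>T\<in>Pow ?R. ?W B (A \<union> T) * F A)"
    proof -
      have "inj_on (\<lambda>T. A \<union> T) (Pow ?R)" by (auto simp: inj_on_def)
      from sum.reindex[OF this, of "\<lambda>S. ?W B S * F A"] show ?thesis by (simp add: o_def)
    qed
    also have "\<dots> = (\<Sum>T\<in>Pow ?R. p ^ card A * (1 - p) ^ card (bd B A) * F A * ?W ?R T)"
    proof (rule sum.cong)
      fix T assume "T \<in> Pow ?R"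
      then have T: "T \<subseteq> ?R" by simp
      have "card (A \<union> T) = card A + card T"
        using T fin finite_subset[OF T] by (intro card_Un_disjoint) auto
      moreover have "B - (A \<union> T) = bd B A \<union> (?R - T)" using T A by (auto simp: bd_def)
      then have "card (B - (A \<union> T)) = card (bd B A) + card (?R - T)"
        using T fin by (simp, subst card_Un_disjoint) auto
      ultimately show "?W B (A \<union> T) * F A = p ^ card A * (1 - p) ^ card (bd B A) * F A * ?W ?R T"
        by (simp add: power_add)
    qed simp
    also have "\<dots> = p ^ card A * (1 - p) ^ card (bd B A) * F A * bexp p ?R (\<lambda>_. 1)"
      by (simp add: bexp_def sum_distrib_left)
    finally show "(\<Sum>S\<in>{S \<in> {S. S \<subseteq> B \<and> v \<in> S}. cluster S v = A}. ?W B S * F (cluster S v)) =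
        p ^ card A * (1 - p) ^ card (bd B A) * F A" using fin by (simp add: bexp_const)
  qed simp
  finally show ?thesis .
qed

end

section \<open>Large clusters carry little variance\<close>
lemma sum_power2_le_card:
  fixes f :: "'i \<Rightarrow> real"
  shows "(\<Sum>i\<in>I. f i)\<^sup>2 \<le> card I * (\<Sum>i\<in>I. (f i)\<^sup>2)"
  using Cauchy_Schwarz_ineq_sum[of "\<lambda>_. 1" f I] by simp

context site_graph
begin

definition bias :: "real \<Rightarrow> 'v set \<Rightarrow> 'v set \<Rightarrow> real" where
  "bias p B C = p * card (bd B C) - (1 - p) * card C"

text \<open>The law of a cluster for parameter \<open>p\<close> is compared with the law for \<open>p' = p (1 - q s)\<close>, for which
  \<open>1 - p' = q (1 + p s)\<close>. The likelihood ratio of the two is \<open>(1 - q s)\<^bsup>|A|\<^esup> (1 + p s)\<^bsup>|\<partial>A|\<^esup>\<close>, which is at least the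
  exponential in the statement up to the quadratic correction, and its mean is at most 1.\<close>
lemma bias_exp_moment:
  assumes p: "0 < p" "p < 1" and s: "0 < s" "s \<le> 1 / 2" and "finite B"
  shows "bexp p B (\<lambda>S. if v \<in> S then
     exp (s * bias p B (cluster S v) - 2 * s\<^sup>2 * (card (cluster S v) + card (bd B (cluster S v)))) else 0) \<le> 1"
proof -
  define q where "q = 1 - p"
  define p' where "p' = p * (1 - q * s)"
  have q: "0 < q" "q < 1" "p + q = 1" using p by (auto simp: q_def)
  have qs1: "q * s < 1" using mult_strict_mono[of q 1 s 1] q s by auto
  have qs: "0 \<le> q * s" "q * s \<le> s" "0 \<le> p * s" "p * s \<le> s"
    using p q s mult_right_mono[of q 1 s] mult_right_mono[of p 1 s] by auto
  have p'1: "1 - p' = q * (1 + p * s)" 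
    by (simp add: p'_def q_def algebra_simps)
  have p': "0 \<le> p'" "p' \<le> 1"
  proof -
    show "0 \<le> p'" unfolding p'_def using p qs1 by (intro mult_nonneg_nonneg) auto
    have "0 \<le> q * (1 + p * s)" using q qs by (intro mult_nonneg_nonneg) auto
    then show "p' \<le> 1" using p'1 by linarith
  qed
  have e1: "exp (- (s * q) - 2 * s\<^sup>2) \<le> 1 - q * s"
  proof -
    have "- (q * s) - 2 * (q * s)\<^sup>2 \<le> ln (1 - q * s)"
    proof (rule ln_one_minus_pos_lower_bound)
      show "q * s \<le> 1 / 2" using qs(2) s(2) by linarith
    qed (rule qs(1))
    moreover have "(q * s)\<^sup>2 \<le> s\<^sup>2" using qs by (intro power_mono) auto
    ultimately have "- (s * q) - 2 * s\<^sup>2 \<le> ln (1 - q * s)" by (simp add: mult.commute)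
    then show ?thesis using qs1 by (subst ln_ge_iff[symmetric]) auto
  qed
  have e2: "exp (s * p - 2 * s\<^sup>2) \<le> 1 + p * s"
  proof -
    have "p * s - (p * s)\<^sup>2 \<le> ln (1 + p * s)"
    proof (rule ln_one_plus_pos_lower_bound)
      show "p * s \<le> 1" using qs(4) s(2) by linarith
    qed (rule qs(3))
    moreover have "(p * s)\<^sup>2 \<le> s\<^sup>2" using qs by (intro power_mono) auto
    ultimately have "s * p - 2 * s\<^sup>2 \<le> ln (1 + p * s)"
      using zero_le_power2[of s] by (subst mult.commute) linarith
    then show ?thesis using qs s by (subst ln_ge_iff[symmetric]) auto
  qed
  define F where "F A = exp (s * bias p B A - 2 * s\<^sup>2 * (card A + card (bd B A)))" for A
  let ?A = "{A. A \<subseteq> B \<and> v \<in> A \<and> cluster A v = A}"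
  have "bexp p B (\<lambda>S. if v \<in> S then F (cluster S v) else 0) =
      (\<Sum>A\<in>?A. p ^ card A * q ^ card (bd B A) * F A)"
    using bexp_cluster[OF \<open>finite B\<close>, of p v F] by (simp add: q_def)
  also have "\<dots> \<le> (\<Sum>A\<in>?A. p' ^ card A * (1 - p') ^ card (bd B A) * 1)"
  proof (rule sum_mono)
    fix A
    let ?a = "card A" and ?b = "card (bd B A)"
    have "F A = exp (?a * (- (s * q) - 2 * s\<^sup>2) + ?b * (s * p - 2 * s\<^sup>2))"
      unfolding F_def bias_def q_def by (rule arg_cong[where f = exp]) (simp add: algebra_simps)
    also have "\<dots> = exp (- (s * q) - 2 * s\<^sup>2) ^ ?a * exp (s * p - 2 * s\<^sup>2) ^ ?b"
      by (simp add: exp_add exp_of_nat_mult)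
    also have "\<dots> \<le> (1 - q * s) ^ ?a * (1 + p * s) ^ ?b"
      using e1 e2 qs(3) qs1 by (intro mult_mono power_mono zero_le_power mult_nonneg_nonneg) auto
    finally have "p ^ ?a * q ^ ?b * F A \<le> p ^ ?a * q ^ ?b * ((1 - q * s) ^ ?a * (1 + p * s) ^ ?b)"
      using p q by (intro mult_left_mono) auto
    also have "\<dots> = p' ^ ?a * (1 - p') ^ ?b * 1"
      unfolding p'1 by (simp add: p'_def power_mult_distrib)
    finally show "p ^ ?a * q ^ ?b * F A \<le> p' ^ ?a * (1 - p') ^ ?b * 1" .
  qed
  also have "\<dots> = bexp p' B (\<lambda>S. if v \<in> S then 1 else 0)"
    using bexp_cluster[OF \<open>finite B\<close>, of p' v "\<lambda>_. 1"] by simp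
  also have "\<dots> \<le> bexp p' B (\<lambda>S. 1)" using p' by (intro bexp_mono) auto
  also have "\<dots> = 1" using \<open>finite B\<close> by (rule bexp_const)
  finally show ?thesis unfolding F_def .
qed

text \<open>Double counting of the pairs of a cluster and a closed site touching it.\<close>
lemma sum_bd_clusters:
  fixes w :: "'v set \<Rightarrow> real"
  assumes "finite B" "S \<subseteq> B"
  shows "(\<Sum>C\<in>clusters S. w C * card (bd B C)) =
    (\<Sum>y\<in>B - S. \<Sum>C\<in>{C \<in> clusters S. touches y C}. w C)"
proof -
  have fin: "finite S" "finite (B - S)" using assms finite_subset by auto
  have "(\<Sum>C\<in>clusters S. w C * card (bd B C)) =
     (\<Sum>C\<in>clusters S. \<Sum>y\<in>B - S. if touches y C then w C else 0)"
  proof (rule sum.cong)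
    fix C assume C: "C \<in> clusters S"
    have "bd B C = {y \<in> B - S. touches y C}"
    proof (intro equalityI subsetI)
      fix y assume y: "y \<in> bd B C"
      then obtain c where c: "c \<in> C" "adj y c" "y \<notin> C" "y \<in> B" by (auto simp: bd_def touches_def)
      note cC = clustersE[OF C c(1)]
      have "y \<notin> S"
      proof
        assume "y \<in> S"
        then have "y \<in> cluster S c" using c cC cluster_step[of c S c y] adj_sym by simp
        then show False using c cC by simp
      qed
      then show "y \<in> {y \<in> B - S. touches y C}" using c by (auto simp: touches_def)
    next
      fix y assume "y \<in> {y \<in> B - S. touches y C}"
      then show "y \<in> bd B C" using clusters_subset[OF C] by (auto simp: bd_def)
    qed
    then show "w C * card (bd B C) = (\<Sum>y\<in>B - S. if touches y C then w C else 0)"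
      using fin by (simp add: sum.If_cases Int_def mult.commute)
  qed simp
  also have "\<dots> = (\<Sum>y\<in>B - S. \<Sum>C\<in>clusters S. if touches y C then w C else 0)"
    by (rule sum.swap)
  also have "\<dots> = (\<Sum>y\<in>B - S. \<Sum>C\<in>{C \<in> clusters S. touches y C}. w C)"
    using fin by (intro sum.cong refl sum.inter_filter[symmetric]) simp
  finally show ?thesis .
qed

text \<open>From \<open>y \<le> exp y\<close>, the bias of each cluster is at most \<open>2 s (|C| + |\<partial>C|)\<close> plus an error of mean at
  most \<open>1 / s\<close> by the exponential moment bound. The first terms add up to order \<open>s |B|\<close>. Each error is shared
  among more than \<open>K\<close> sites, so the errors add up to \<open>|B| / (s K)\<close>. The choice \<open>s = 1 / (2 sqrt K)\<close> balances
  the two.\<close>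
lemma large_cluster_bias:
  assumes p: "0 < p" "p < 1" and "finite B" and K: "1 \<le> K"
  shows "bexp p B (\<lambda>S. \<Sum>C\<in>clusters S. (if K < card C then 1 else 0) * bias p B C)
     \<le> (D + 3) * card B / sqrt K"
proof -
  define s where "s = 1 / (2 * sqrt K)"
  have s: "0 < s" "s \<le> 1 / 2" using K by (auto simp: s_def)
  have s4: "s * s * K = 1 / 4" using K by (simp add: s_def field_simps)
  let ?c = "\<lambda>C. real (card C) + card (bd B C)"
  define X where "X C = exp (s * bias p B C - 2 * s\<^sup>2 * (card C + card (bd B C)))" for C
  have Xpos: "0 < X C" for C by (simp add: X_def)
  have le: "bias p B C \<le> 2 * s * ?c C + X C / s" for C
  proof -
    have "s * bias p B C - 2 * s\<^sup>2 * ?c C \<le> X C"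
    proof -
      have "y \<le> exp y" for y :: real using exp_ge_add_one_self[of y] by linarith
      from this[of "s * bias p B C - 2 * s\<^sup>2 * ?c C"] show ?thesis by (simp add: X_def)
    qed
    then have "s * bias p B C \<le> s * (2 * s * ?c C + X C / s)"
      using s by (simp add: algebra_simps power2_eq_square)
    then show ?thesis using s by (simp only: mult_le_cancel_left_pos)
  qed
  have pw: "(\<Sum>C\<in>clusters S. (if K < card C then 1 else 0) * bias p B C) \<le>
     2 * s * ((D + 1) * card B) + (1 / (s * K)) * (\<Sum>v\<in>B. if v \<in> S then X (cluster S v) else 0)"
    if S: "S \<subseteq> B" for S
  proof -
    have fin: "finite S" using S assms finite_subset by auto
    have "(\<Sum>C\<in>clusters S. (if K < card C then 1 else 0) * bias p B C) \<le>
      (\<Sum>C\<in>clusters S. 2 * s * ?c C + (if K < card C then X C else 0) / s)"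
    proof (rule sum_mono)
      fix C
      have "0 \<le> 2 * s * ?c C" using s by simp
      then show "(if K < card C then 1 else 0) * bias p B C \<le>
          2 * s * ?c C + (if K < card C then X C else 0) / s" using le[of C] by simp
    qed
    also have "\<dots> = 2 * s * (\<Sum>C\<in>clusters S. ?c C) + (\<Sum>C\<in>clusters S. if K < card C then X C else 0) / s"
    proof -
      have "(\<Sum>C\<in>A. k * f C + g C / s) = k * sum f A + sum g A / s" for A k and f g :: "'v set \<Rightarrow> real"
        by (simp add: sum.distrib sum_distrib_left sum_divide_distrib)
      then show ?thesis .
    qed
    finally have split: "(\<Sum>C\<in>clusters S. (if K < card C then 1 else 0) * bias p B C) \<le> \<dots>" .
    have sites: "(\<Sum>C\<in>clusters S. ?c C) \<le> (D + 1) * card B"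
    proof -
      have "(\<Sum>C\<in>clusters S. real (card C)) = card S"
        using sum_sites_clusters[OF fin, of "\<lambda>_. 1::real"] by simp
      moreover have "card S \<le> card B" using S assms card_mono by auto
      moreover have "(\<Sum>C\<in>clusters S. real (card (bd B C))) \<le> D * card B"
      proof -
        have "(\<Sum>C\<in>clusters S. real (card (bd B C))) = (\<Sum>y\<in>B - S. real (card {C \<in> clusters S. touches y C}))"
          using sum_bd_clusters[OF assms(3) S, of "\<lambda>_. 1"] by simp
        also have "\<dots> \<le> (\<Sum>y\<in>B - S. real D)"
          using card_touching[OF fin] by (intro sum_mono) auto
        also have "\<dots> \<le> D * card B" using assms card_mono[of B "B - S"] 
          by (simp add: mult.commute mult_left_mono)
        finally show ?thesis .
      qed
      ultimately show ?thesis by (simp add: sum.distrib algebra_simps)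
    qed
    have "(\<Sum>C\<in>clusters S. if K < card C then X C else 0) \<le> (\<Sum>v\<in>S. X (cluster S v) / K)"
      unfolding sum_clusters_per_site[OF fin]
    proof (rule sum_mono)
      fix v
      show "(if K < card (cluster S v) then X (cluster S v) else 0) / real (card (cluster S v)) \<le> X (cluster S v) / K"
        using K Xpos[of "cluster S v"] by (auto intro!: divide_left_mono)
    qed
    also have "(\<Sum>v\<in>S. X (cluster S v) / K) = (\<Sum>v\<in>B. if v \<in> S then X (cluster S v) else 0) / K"
      using S assms by (simp add: sum.If_cases Int_absorb1 sum_divide_distrib)
    finally have "(\<Sum>C\<in>clusters S. if K < card C then X C else 0) / s \<le>
        (\<Sum>v\<in>B. if v \<in> S then X (cluster S v) else 0) / K / s"
      using s by (intro divide_right_mono) auto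
    moreover have "2 * s * (\<Sum>C\<in>clusters S. ?c C) \<le> 2 * s * ((D + 1) * card B)"
      using s sites by (intro mult_left_mono) auto
    ultimately show ?thesis using split by (simp add: mult.commute)
  qed
  have "bexp p B (\<lambda>S. \<Sum>C\<in>clusters S. (if K < card C then 1 else 0) * bias p B C) \<le>
     bexp p B (\<lambda>S. 2 * s * ((D + 1) * card B) + (1 / (s * K)) * (\<Sum>v\<in>B. if v \<in> S then X (cluster S v) else 0))"
    using pw p by (intro bexp_mono) auto
  also have "\<dots> = 2 * s * ((D + 1) * card B) +
      (1 / (s * K)) * (\<Sum>v\<in>B. bexp p B (\<lambda>S. if v \<in> S then X (cluster S v) else 0))"
    by (simp only: bexp_add bexp_cmult bexp_sum bexp_const[OF assms(3)])
  also have "\<dots> \<le> 2 * s * ((D + 1) * card B) + (1 / (s * K)) * (\<Sum>v\<in>B. 1)"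
  proof (intro add_left_mono mult_left_mono sum_mono)
    show "bexp p B (\<lambda>S. if v \<in> S then X (cluster S v) else 0) \<le> 1" for v
      unfolding X_def by (rule bias_exp_moment[OF p s assms(3)])
    show "0 \<le> 1 / (s * K)" using s by simp
  qed
  also have "\<dots> = (D + 3) * card B / sqrt K"
  proof -
    define r where "r = sqrt K"
    have r: "0 < r" "real K = r * r" using K by (auto simp: r_def)
    have sr: "s = 1 / (2 * r)" by (simp add: s_def r_def)
    then have "2 * s = 1 / r" by simp
    moreover have "1 / (s * K) = 2 / r"
      unfolding r(2) sr using r(1) by (simp add: field_simps)
    ultimately have "2 * s * ((D + 1) * card B) + (1 / (s * K)) * (\<Sum>v\<in>B. 1) =
        1 / r * ((D + 1) * card B) + 2 / r * card B" by simp
    also have "\<dots> = (D + 3) * card B / r" using r(1) by (simp add: field_simps)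
    finally show ?thesis by (simp add: r_def)
  qed
  finally show ?thesis .
qed

text \<open>Both sides count, with weights, the closed sites touching a cluster against the open sites. The number of
  clusters touching \<open>x\<close> and the cluster that \<open>x\<close> would have do not depend on the state of \<open>x\<close>, so
  conditioning on all other sites yields the factor \<open>p (1 - p)\<close>. This is Russo's formula for the
  derivative of the mean in \<open>p\<close>, evaluated in two ways.\<close>
lemma russo_csum:
  assumes "finite B"
  shows "bexp p B (\<lambda>S. \<Sum>C\<in>clusters S. w (card C) * bias p B C) =
    - (p * (1 - p) * (\<Sum>x\<in>B. bexp p B (flip_diff x (csum w))))"
proof -
  define q where "q = 1 - p"
  define L where "L x S = w (card (cluster (insert x S) x))" for x S
  define N where "N x S = (\<Sum>C\<in>{C \<in> clusters S. touches x C}. w (card C))" for x S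
  have pw: "(\<Sum>C\<in>clusters S. w (card C) * bias p B C) =
     (\<Sum>x\<in>B. p * (if x \<in> S then 0 else N x (S - {x})) - q * (if x \<in> S then L x (S - {x}) else 0))"
    if S: "S \<subseteq> B" for S
  proof -
    have fin: "finite S" using S assms finite_subset by auto
    have "(\<Sum>C\<in>clusters S. w (card C) * card C) = (\<Sum>x\<in>S. w (card (cluster S x)))"
    proof -
      have "(\<Sum>x\<in>S. w (card (cluster S x))) = (\<Sum>C\<in>clusters S. \<Sum>x\<in>C. w (card (cluster S x)))"
        using sum_sites_clusters[OF fin] .
      also have "\<dots> = (\<Sum>C\<in>clusters S. \<Sum>x\<in>C. w (card C))"
        using clustersE(2) by (intro sum.cong refl) metis
      finally show ?thesis by (simp add: mult.commute)
    qed
    also have "\<dots> = (\<Sum>x\<in>B. if x \<in> S then L x (S - {x}) else 0)"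
      using S assms by (simp add: sum.If_cases Int_absorb1 L_def insert_absorb)
    finally have 1: "(\<Sum>C\<in>clusters S. w (card C) * card C) = (\<Sum>x\<in>B. if x \<in> S then L x (S - {x}) else 0)" .
    have "(\<Sum>C\<in>clusters S. w (card C) * card (bd B C)) = (\<Sum>x\<in>B - S. N x S)"
      using sum_bd_clusters[OF assms S] by (simp add: N_def)
    also have "\<dots> = (\<Sum>x\<in>B. if x \<in> S then 0 else N x (S - {x}))"
      using assms by (intro sum.mono_neutral_cong_left) auto
    finally have 2: "(\<Sum>C\<in>clusters S. w (card C) * card (bd B C)) = (\<Sum>x\<in>B. if x \<in> S then 0 else N x (S - {x}))" .
    have "(\<Sum>C\<in>clusters S. w (card C) * bias p B C) =
       p * (\<Sum>C\<in>clusters S. w (card C) * card (bd B C)) - q * (\<Sum>C\<in>clusters S. w (card C) * card C)"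
      by (simp add: bias_def q_def algebra_simps sum_subtractf sum.distrib sum_distrib_left)
    then show ?thesis unfolding 1 2 by (simp add: sum_subtractf sum_distrib_left)
  qed
  have fd: "bexp p B (flip_diff x (csum w)) = bexp p B (\<lambda>S. L x (S - {x})) - bexp p B (\<lambda>S. N x (S - {x}))"
    for x
  proof -
    have "flip_diff x (csum w) S = L x (S - {x}) - N x (S - {x})" if "S \<subseteq> B" for S
      using csum_insert[of "S - {x}" x w] that assms finite_subset[of S B]
      by (simp add: flip_diff_def L_def N_def)
    then show ?thesis by (simp add: bexp_diff cong: bexp_cong)
  qed
  have "bexp p B (\<lambda>S. \<Sum>C\<in>clusters S. w (card C) * bias p B C) =
     (\<Sum>x\<in>B. p * bexp p B (\<lambda>S. if x \<in> S then 0 else N x (S - {x})) - q * bexp p B (\<lambda>S. if x \<in> S then L x (S - {x}) else 0))"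
    using pw by (simp add: bexp_sum bexp_diff bexp_cmult cong: bexp_cong)
  also have "\<dots> = (\<Sum>x\<in>B. - (p * (1 - p) * bexp p B (flip_diff x (csum w))))"
  proof (rule sum.cong)
    fix x assume x: "x \<in> B"
    show "p * bexp p B (\<lambda>S. if x \<in> S then 0 else N x (S - {x})) - q * bexp p B (\<lambda>S. if x \<in> S then L x (S - {x}) else 0)
      = - (p * (1 - p) * bexp p B (flip_diff x (csum w)))"
      unfolding bexp_open_site(1)[OF assms x, of p "L x"] bexp_open_site(2)[OF assms x, of p "N x"] fd q_def
      by (simp add: algebra_simps)
  qed simp
  finally show ?thesis by (simp add: sum_negf sum_distrib_left)
qed

definition num_large :: "nat \<Rightarrow> 'v set \<Rightarrow> real" where
  "num_large K = csum (\<lambda>k. if K < k then 1 else 0)"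

text \<open>Let \<open>N\<close> be the number of large clusters touching \<open>x\<close>. If \<open>N \<ge> 1\<close>, the effect is \<open>d = - (N - 1)\<close> and
  \<open>d\<^sup>2 \<le> - D d\<close> because \<open>N \<le> D\<close>. If \<open>N = 0\<close>, the effect is the indicator that a large cluster is created,
  and then its size lies between \<open>K\<close> and \<open>D K + 1\<close>.\<close>
lemma flip_diff_num_large:
  assumes "finite S"
  shows "(flip_diff x (num_large K) S)\<^sup>2 \<le> - (D * flip_diff x (num_large K) S) +
    (real D + 1) * (if K < card (cluster (insert x S) x) \<and> card (cluster (insert x S) x) \<le> D * K + 1 then 1 else 0)"
proof -
  define S' where "S' = S - {x}"
  have S': "finite S'" "x \<notin> S'" "insert x S' = insert x S" using assms by (auto simp: S'_def)
  let ?T = "{C \<in> clusters S'. touches x C}"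
  let ?k = "card (cluster (insert x S) x)"
  define N where "N = card {C \<in> ?T. K < card C}"
  have finT: "finite ?T" using S' by simp
  have ND: "N \<le> D"
  proof -
    have "N \<le> card ?T" unfolding N_def using finT by (intro card_mono) auto
    then show ?thesis using card_touching[OF S'(1), of x] by simp
  qed
  have k: "?k = Suc (\<Sum>C\<in>?T. card C)" using card_cluster_insert[OF S'(1,2)] S'(3) by simp
  have "(\<Sum>C\<in>?T. if K < card C then 1 else 0) = real N"
    using finT by (simp add: N_def sum.If_cases Int_def)
  then have fd: "flip_diff x (num_large K) S = (if K < ?k then 1 else 0) - real N"
    using csum_insert[OF S'(1,2), of "\<lambda>k. if K < k then 1 else 0"] S'(3)
    by (simp add: flip_diff_def num_large_def S'_def)
  show ?thesis
  proof (cases "N = 0")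
    case True
    moreover have "finite {C \<in> ?T. K < card C}" by (rule finite_subset[OF _ finT]) auto
    ultimately have "{C \<in> ?T. K < card C} = {}" by (simp add: N_def)
    then have small: "card C \<le> K" if "C \<in> ?T" for C
      using that by (metis (mono_tags, lifting) empty_iff mem_Collect_eq not_le)
    have "(\<Sum>C\<in>?T. card C) \<le> card ?T * K" using small sum_bounded_above[of ?T card K] by simp
    also have "\<dots> \<le> D * K" using card_touching[OF S'(1), of x] by simp
    finally have "?k \<le> D * K + 1" using k by simp
    then show ?thesis using True fd by simp
  next
    case False
    then obtain C where C: "C \<in> ?T" "K < card C" by (auto simp: N_def card_gt_0_iff)
    have "card C \<le> (\<Sum>C\<in>?T. card C)" using C finT by (intro member_le_sum) auto
    then have fd': "flip_diff x (num_large K) S = - (real N - 1)" using fd C k by simp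
    have "(real N - 1) * (real N - 1) \<le> D * (real N - 1)"
      using False ND by (intro mult_right_mono) auto
    moreover have "(flip_diff x (num_large K) S)\<^sup>2 = (real N - 1) * (real N - 1)"
      unfolding fd' by (simp add: power2_eq_square algebra_simps)
    ultimately have "(flip_diff x (num_large K) S)\<^sup>2 \<le> - (D * flip_diff x (num_large K) S)"
      by (simp only: fd' mult_minus_right minus_minus)
    then show ?thesis by (rule order_trans) simp
  qed
qed

lemma bvar_num_large:
  assumes p: "0 < p" "p < 1" and B: "finite B" and K: "1 \<le> K"
  shows "bvar p B (num_large K) \<le> D * (D + 3) * card B / sqrt K + (D + 1) *
    (\<Sum>x\<in>B. bexp p B (\<lambda>S. if K < card (cluster (insert x S) x) \<and> card (cluster (insert x S) x) \<le> D * K + 1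
       then 1 else 0))"
proof -
  let ?q = "1 - p"
  define I where "I x S = (if K < card (cluster (insert x S) x) \<and> card (cluster (insert x S) x) \<le> D * K + 1
       then 1 else 0 :: real)" for x S
  let ?d = "\<lambda>x. bexp p B (flip_diff x (num_large K))"
  have "bvar p B (num_large K) \<le> p * ?q * (\<Sum>x\<in>B. bexp p B (\<lambda>S. (flip_diff x (num_large K) S)\<^sup>2))"
    using p B by (intro efron_stein) auto
  also have "\<dots> \<le> p * ?q * (\<Sum>x\<in>B. - (D * ?d x) + (D + 1) * bexp p B (I x))"
  proof -
    have "bexp p B (\<lambda>S. (flip_diff x (num_large K) S)\<^sup>2) \<le> - (D * ?d x) + (D + 1) * bexp p B (I x)" for x
    proof -
      have "bexp p B (\<lambda>S. (flip_diff x (num_large K) S)\<^sup>2) \<le>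
        bexp p B (\<lambda>S. - (D * flip_diff x (num_large K) S) + (D + 1) * I x S)"
      proof (rule bexp_mono)
        fix S assume "S \<subseteq> B"
        then have "finite S" using B finite_subset by auto
        then show "(flip_diff x (num_large K) S)\<^sup>2 \<le> - (D * flip_diff x (num_large K) S) + (D + 1) * I x S"
          using flip_diff_num_large[of S x K] unfolding I_def by (auto split: if_splits)
      qed (use p in auto)
      then show ?thesis by (simp only: bexp_add bexp_minus bexp_cmult)
    qed
    then show ?thesis using p by (intro mult_left_mono sum_mono) auto
  qed
  also have "\<dots> = D * (- (p * ?q * (\<Sum>x\<in>B. ?d x))) + p * ?q * ((D + 1) * (\<Sum>x\<in>B. bexp p B (I x)))"
    unfolding sum.distrib sum_negf sum_distrib_left[symmetric] by (simp add: algebra_simps)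
  also have "- (p * ?q * (\<Sum>x\<in>B. ?d x)) =
      bexp p B (\<lambda>S. \<Sum>C\<in>clusters S. (if K < card C then 1 else 0) * bias p B C)"
    unfolding num_large_def by (rule russo_csum[OF B, symmetric])
  also have "\<dots> \<le> (D + 3) * card B / sqrt K"
    by (rule large_cluster_bias[OF p B K])
  also have "p * ?q * ((D + 1) * (\<Sum>x\<in>B. bexp p B (I x))) \<le> 1 * ((D + 1) * (\<Sum>x\<in>B. bexp p B (I x)))"
  proof (rule mult_right_mono)
    show "p * ?q \<le> 1" using p mult_mono[of p 1 ?q 1] by simp
    show "0 \<le> (D + 1) * (\<Sum>x\<in>B. bexp p B (I x))"
      using p by (intro mult_nonneg_nonneg sum_nonneg bexp_nonneg) (auto simp: I_def)
  qed
  finally show ?thesis using D_pos unfolding I_def by (simp add: mult_left_mono mult.assoc)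
qed

text \<open>The even exponent makes \<open>sqrt (scale j)\<close> a power of \<open>D + 1\<close>, so that the bounds \<open>1 / sqrt (scale j)\<close> have a
  finite sum. The growth is fast enough for the size windows of newly created clusters to be disjoint.\<close>
definition scale :: "nat \<Rightarrow> nat" where
  "scale j = (D + 1) ^ (2 * j)"

lemma scale_pos: "1 \<le> scale j" by (simp add: scale_def)

lemma scale_Suc: "D * scale j + 1 \<le> scale (Suc j)"
proof -
  have "D * scale j + 1 \<le> (D + 1) * scale j" using scale_pos[of j] by simp
  also have "\<dots> \<le> (D + 1) * ((D + 1) * scale j)" by simp
  finally show ?thesis by (simp add: scale_def algebra_simps)
qed

lemma scale_intervals_disjoint:
  "(\<Sum>j<J. if scale j < k \<and> k \<le> D * scale j + 1 then 1 else 0 :: real) \<le> (if scale J < k then 0 else 1)"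
proof (induction J)
  case (Suc J)
  have "scale J \<le> D * scale J + 1" using D_pos by (simp add: le_SucI)
  then have "scale J \<le> scale (Suc J)" using scale_Suc[of J] by linarith
  then show ?case using Suc scale_Suc[of J] by (auto split: if_splits)
qed simp

text \<open>The weight rises from 0 to 1 on a logarithmic scale of cluster sizes. A single threshold would not do: the
  creations of clusters just above one given threshold may be frequent, whereas
  the sum of their probabilities over the scales is at most 1 for each site.\<close>
definition tail_weight :: "nat \<Rightarrow> nat \<Rightarrow> real" where
  "tail_weight J k = (\<Sum>j<J. if scale j < k then 1 else 0) / J"

lemma csum_tail_weight: "csum (tail_weight J) S = (\<Sum>j<J. num_large (scale j) S) / J"
  unfolding csum_def tail_weight_def num_large_def
  by (subst sum.swap) (simp add: sum_divide_distrib)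

definition var_const :: real where "var_const = 2 * (real D + 3)\<^sup>2"

text \<open>The variance of an average of \<open>J\<close> variables is at most \<open>1 / J\<close> times the sum of their variances, and that
  sum is of order \<open>|B|\<close> uniformly in \<open>J\<close>.\<close>
theorem bvar_tail:
  assumes p: "0 < p" "p < 1" and B: "finite B" and J: "1 \<le> J"
  shows "bvar p B (csum (tail_weight J)) \<le> var_const * card B / J"
proof -
  let ?f = "\<lambda>j. num_large (scale j)"
  let ?m = "\<lambda>j. bexp p B (?f j)"
  define I where "I x j S = (if scale j < card (cluster (insert x S) x) \<and> card (cluster (insert x S) x) \<le> D * scale j + 1
       then 1 else 0 :: real)" for x j S
  have mean: "bexp p B (csum (tail_weight J)) = (\<Sum>j<J. ?m j) / J"
    by (simp add: csum_tail_weight[abs_def] bexp_sum bexp_cmult_right divide_inverse)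
  have "bvar p B (csum (tail_weight J)) \<le> bexp p B (\<lambda>S. (\<Sum>j<J. (?f j S - ?m j)\<^sup>2) * (1 / J))"
    unfolding bvar_def mean
  proof (rule bexp_mono)
    fix S
    have "csum (tail_weight J) S - (\<Sum>j<J. ?m j) / J = (\<Sum>j<J. ?f j S - ?m j) / J"
      by (simp add: csum_tail_weight sum_subtractf diff_divide_distrib)
    then have "(csum (tail_weight J) S - (\<Sum>j<J. ?m j) / J)\<^sup>2 = (\<Sum>j<J. ?f j S - ?m j)\<^sup>2 / J\<^sup>2"
      by (simp add: power_divide)
    also have "\<dots> \<le> (J * (\<Sum>j<J. (?f j S - ?m j)\<^sup>2)) / J\<^sup>2"
      using sum_power2_le_card[of "\<lambda>j. ?f j S - ?m j" "{..<J}"] by (intro divide_right_mono) auto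
    also have "\<dots> = (\<Sum>j<J. (?f j S - ?m j)\<^sup>2) * (1 / J)"
    proof -
      have "J * a / (real J)\<^sup>2 = a * (1 / J)" for a :: real using J by (simp add: power2_eq_square)
      then show ?thesis by simp
    qed
    finally show "(csum (tail_weight J) S - (\<Sum>j<J. ?m j) / J)\<^sup>2 \<le> (\<Sum>j<J. (?f j S - ?m j)\<^sup>2) * (1 / J)" .
  qed (use p in auto)
  also have "\<dots> = (\<Sum>j<J. bvar p B (?f j)) * (1 / J)"
    unfolding bexp_cmult_right bexp_sum bvar_def ..
  finally have 1: "bvar p B (csum (tail_weight J)) \<le> (\<Sum>j<J. bvar p B (?f j)) * (1 / J)" .
  have "bvar p B (?f j) \<le> D * (D + 3) * card B * (1 / (D + 1)) ^ j + (D + 1) * (\<Sum>x\<in>B. bexp p B (I x j))" for j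
  proof -
    have "real (scale j) = (real (D + 1) ^ j)\<^sup>2"
      by (simp add: scale_def power_even_eq)
    then have "sqrt (scale j) = (D + 1) ^ j" by simp
    then show ?thesis
      using bvar_num_large[OF p B scale_pos[of j]] unfolding I_def by (simp add: power_divide)
  qed
  then have "(\<Sum>j<J. bvar p B (?f j)) \<le>
     (\<Sum>j<J. D * (D + 3) * card B * (1 / (D + 1)) ^ j + (D + 1) * (\<Sum>x\<in>B. bexp p B (I x j)))"
    by (intro sum_mono)
  also have "\<dots> = D * (D + 3) * card B * (\<Sum>j<J. (1 / (D + 1)) ^ j) + (D + 1) * (\<Sum>x\<in>B. bexp p B (\<lambda>S. \<Sum>j<J. I x j S))"
    unfolding sum.distrib sum_distrib_left[symmetric] bexp_sum
    by (simp only: sum.swap[of "\<lambda>j x. bexp p B (I x j)" B "{..<J}"])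
  finally have 2: "(\<Sum>j<J. bvar p B (?f j)) \<le> \<dots>" .
  have 3: "(\<Sum>j<J. (1 / (real (D + 1))) ^ j) \<le> 2"
  proof -
    have "(\<Sum>j<J. (1 / (real (D + 1))) ^ j) \<le> (\<Sum>j<J. (1 / 2) ^ j)"
      using D_pos by (intro sum_mono power_mono) (auto simp: field_simps)
    also have "\<dots> \<le> 2" by (simp add: sum_gp_strict)
    finally show ?thesis .
  qed
  have 4: "(\<Sum>x\<in>B. bexp p B (\<lambda>S. \<Sum>j<J. I x j S)) \<le> real (card B)"
  proof -
    have "(\<Sum>j<J. I x j S) \<le> 1" for x S
      using scale_intervals_disjoint[where J = J and k = "card (cluster (insert x S) x)"]
      unfolding I_def by (auto split: if_splits)
    then have "bexp p B (\<lambda>S. \<Sum>j<J. I x j S) \<le> bexp p B (\<lambda>S. 1)" for x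
      using p by (intro bexp_mono) auto
    then have "bexp p B (\<lambda>S. \<Sum>j<J. I x j S) \<le> 1" for x using B by (simp add: bexp_const)
    then have "(\<Sum>x\<in>B. bexp p B (\<lambda>S. \<Sum>j<J. I x j S)) \<le> (\<Sum>x\<in>B. 1)" by (rule sum_mono)
    then show ?thesis by simp
  qed
  have "D * (D + 3) * card B * (\<Sum>j<J. (1 / (D + 1)) ^ j) + (D + 1) * (\<Sum>x\<in>B. bexp p B (\<lambda>S. \<Sum>j<J. I x j S))
     \<le> real (D * (D + 3) * card B) * 2 + real (D + 1) * real (card B)"
    using 3 4 by (intro add_mono mult_left_mono) auto
  also have "\<dots> \<le> var_const * card B"
  proof -
    have "real (D * (D + 3)) * 2 + real (D + 1) \<le> var_const"
      by (simp add: var_const_def power2_eq_square algebra_simps)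
    from mult_right_mono[OF this, of "real (card B)"] show ?thesis by (simp add: algebra_simps)
  qed
  finally have "(\<Sum>j<J. bvar p B (?f j)) \<le> var_const * card B" using 2 by linarith
  from mult_right_mono[OF this, of "1 / J"] 1 show ?thesis by simp
qed

end

section \<open>Gaussian approximation for sums with a finite range of dependence\<close>
lemma norm_increment_le:
  fixes f :: "real \<Rightarrow> 'b::real_normed_vector"
  assumes f: "\<And>u. \<bar>u\<bar> \<le> \<bar>t\<bar> \<Longrightarrow> (f has_vector_derivative f' u) (at u)"
    and K: "\<And>u. \<bar>u\<bar> \<le> \<bar>t\<bar> \<Longrightarrow> norm (f' u) \<le> K"
  shows "norm (f t - f 0) \<le> K * \<bar>t\<bar>"
proof -
  let ?S = "{- \<bar>t\<bar>..\<bar>t\<bar>}"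
  have "norm (f t - f 0) \<le> K * norm (t - 0)"
  proof (rule differentiable_bound[where S = ?S and f' = "\<lambda>u h. h *\<^sub>R f' u"])
    fix u assume "u \<in> ?S"
    then have u: "\<bar>u\<bar> \<le> \<bar>t\<bar>" by auto
    show "(f has_derivative (\<lambda>h. h *\<^sub>R f' u)) (at u within ?S)"
      using f[OF u] by (auto simp: has_vector_derivative_def intro: has_derivative_at_withinI)
    show "onorm (\<lambda>h. h *\<^sub>R f' u) \<le> K"
      using K[OF u] by (intro onorm_le) (simp add: mult.commute[of K] mult_left_mono)
  qed auto
  then show ?thesis by simp
qed

lemma iexp_linear_approx: "norm (1 + \<i> * of_real u - iexp u) \<le> u\<^sup>2 / 2"
  using iexp_approx1[of u 1] by (simp add: norm_minus_commute power2_eq_square eval_nat_numeral)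

text \<open>\<open>X x\<close> is determined by the sites in \<open>A x\<close>, so \<open>X x\<close> and \<open>X y\<close> are independent when \<open>A x\<close> and \<open>A y\<close> are
  disjoint; \<open>M\<close> bounds the number of exceptions.\<close>
locale local_field =
  fixes p :: real and B :: "'v set" and X :: "'v \<Rightarrow> 'v set \<Rightarrow> real" and A :: "'v \<Rightarrow> 'v set" and M :: nat
  assumes p: "0 \<le> p" "p \<le> 1" and B: "finite B" "B \<noteq> {}"
    and X_bound: "\<And>x S. x \<in> B \<Longrightarrow> S \<subseteq> B \<Longrightarrow> \<bar>X x S\<bar> \<le> 1"
    and X_mean: "\<And>x. x \<in> B \<Longrightarrow> bexp p B (X x) = 0"
    and X_local: "\<And>x S. x \<in> B \<Longrightarrow> S \<subseteq> B \<Longrightarrow> X x S = X x (S \<inter> A x)"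
    and card_overlap: "\<And>x. x \<in> B \<Longrightarrow> card {y \<in> B. A x \<inter> A y \<noteq> {}} \<le> M"
begin

text \<open>\<open>W\<close> is the normalised sum, \<open>v\<close> its variance, and \<open>T\<close> the random variable of mean \<open>v\<close> that appears when
  each \<open>X x\<close> is decoupled from the terms that it depends on.\<close>
definition nb :: "'v \<Rightarrow> 'v set" where "nb x = {y \<in> B. A x \<inter> A y \<noteq> {}}"
definition Z :: "'v \<Rightarrow> 'v set \<Rightarrow> real" where "Z x S = (\<Sum>y\<in>nb x. X y S)"
definition r :: real where "r = sqrt (card B)"
definition W :: "'v set \<Rightarrow> real" where "W S = (\<Sum>x\<in>B. X x S) / r"
definition v :: real where "v = bexp p B (\<lambda>S. (W S)\<^sup>2)"
definition T :: "'v set \<Rightarrow> real" where "T S = (\<Sum>x\<in>B. X x S * Z x S) / card B"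

lemma r: "0 < r" "r * r = card B"
  using B by (auto simp: r_def card_gt_0_iff)

lemma finite_nb [simp]: "finite (nb x)" and nb_subset: "nb x \<subseteq> B"
  using B by (auto simp: nb_def)

lemma nb_sym: "x \<in> B \<Longrightarrow> y \<in> nb x \<Longrightarrow> x \<in> nb y"
  by (auto simp: nb_def)

lemma Z_bound: "x \<in> B \<Longrightarrow> S \<subseteq> B \<Longrightarrow> \<bar>Z x S\<bar> \<le> M"
proof -
  assume x: "x \<in> B" "S \<subseteq> B"
  have "\<bar>Z x S\<bar> \<le> (\<Sum>y\<in>nb x. 1)"
    unfolding Z_def using X_bound[OF subsetD[OF nb_subset] x(2)]
    by (intro sum_abs[THEN order_trans] sum_mono)
  also have "\<dots> \<le> M" using card_overlap[OF x(1)] by (simp add: nb_def)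
  finally show ?thesis .
qed

lemma uncorrelated:
  assumes "x \<in> B" "y \<in> B" "y \<notin> nb x"
  shows "bexp p B (\<lambda>S. X x S * X y S) = 0"
proof -
  have "A x \<inter> A y = {}" using assms by (auto simp: nb_def)
  then have "bexp p B (\<lambda>S. X x S * X y S) = bexp p B (X x) * bexp p B (X y)"
    using assms B X_local by (intro bexp_indep) auto
  then show ?thesis using X_mean assms by simp
qed

lemma v_eq: "v = (\<Sum>x\<in>B. \<Sum>y\<in>nb x. bexp p B (\<lambda>S. X x S * X y S)) * (1 / card B)"
proof -
  have 1: "(W S)\<^sup>2 = (\<Sum>x\<in>B. \<Sum>y\<in>B. X x S * X y S) * (1 / card B)" for S
  proof -
    have "(W S)\<^sup>2 = ((\<Sum>x\<in>B. X x S) * (\<Sum>y\<in>B. X y S)) / (r * r)"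
      by (simp add: W_def power2_eq_square)
    then show ?thesis unfolding r sum_product by simp
  qed
  have "v = (\<Sum>x\<in>B. \<Sum>y\<in>B. bexp p B (\<lambda>S. X x S * X y S)) * (1 / card B)"
    unfolding v_def 1 bexp_cmult_right bexp_sum ..
  also have "(\<Sum>x\<in>B. \<Sum>y\<in>B. bexp p B (\<lambda>S. X x S * X y S)) = (\<Sum>x\<in>B. \<Sum>y\<in>nb x. bexp p B (\<lambda>S. X x S * X y S))"
    using uncorrelated nb_subset B by (intro sum.cong refl sum.mono_neutral_right) auto
  finally show ?thesis .
qed

lemma mean_T: "bexp p B T = v"
proof -
  have "T = (\<lambda>S. (\<Sum>x\<in>B. \<Sum>y\<in>nb x. X x S * X y S) * (1 / card B))"
    by (simp add: fun_eq_iff T_def Z_def sum_distrib_left)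
  then show ?thesis by (simp only: v_eq bexp_cmult_right bexp_sum)
qed

text \<open>A site \<open>z\<close> lies in at most \<open>M\<close> of the sets \<open>A y\<close>, and a summand of \<open>T\<close> that involves one of these \<open>y\<close> has an
  index in \<open>nb y\<close>. So at most \<open>M\<^sup>2\<close> summands of the numerator change, each by at most \<open>2 M\<close>.\<close>
lemma flip_diff_T:
  assumes z: "z \<in> B" and S: "S \<subseteq> B"
  shows "\<bar>flip_diff z T S\<bar> \<le> 2 * M ^ 3 / card B"
proof -
  define I where "I = {x \<in> B. z \<in> A x}"
  define U where "U = (\<Union>y\<in>I. nb y)"
  define f where "f x S = X x S * Z x S" for x S
  have card_U: "card U \<le> M * M"
  proof -
    have "card I \<le> M"
    proof (cases "I = {}")
      case False
      then obtain x where x: "x \<in> I" by auto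
      then have "I \<subseteq> {y \<in> B. A x \<inter> A y \<noteq> {}}" by (auto simp: I_def)
      then have "card I \<le> card {y \<in> B. A x \<inter> A y \<noteq> {}}" using B by (intro card_mono) auto
      then show ?thesis using card_overlap[of x] x by (simp add: I_def)
    qed simp
    have "card U \<le> (\<Sum>y\<in>I. card (nb y))"
      unfolding U_def using B by (intro card_UN_le) (auto simp: I_def)
    also have "\<dots> \<le> (\<Sum>y\<in>I. M)"
      using card_overlap by (intro sum_mono) (auto simp: I_def nb_def)
    also have "\<dots> \<le> M * M" using \<open>card I \<le> M\<close> by simp
    finally show ?thesis .
  qed
  have sub: "insert z S \<subseteq> B" "S - {z} \<subseteq> B" using z S by auto
  have Xeq: "X x (insert z S) = X x (S - {z})" if x: "x \<in> B" "x \<notin> I" for x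
  proof -
    have "insert z S \<inter> A x = (S - {z}) \<inter> A x" using x by (auto simp: I_def)
    then show ?thesis using X_local[OF x(1) sub(1)] X_local[OF x(1) sub(2)] by simp
  qed
  have feq: "f x (insert z S) = f x (S - {z})" if x: "x \<in> B" "x \<notin> U" for x
  proof -
    have "x \<notin> I" using x by (auto simp: U_def I_def nb_def)
    moreover have "nb x \<inter> I = {}" using x nb_sym by (auto simp: U_def)
    then have "Z x (insert z S) = Z x (S - {z})"
      unfolding Z_def using Xeq nb_subset by (intro sum.cong) auto
    ultimately show ?thesis using Xeq[OF x(1)] by (simp add: f_def)
  qed
  have fb: "\<bar>f x S\<bar> \<le> M" if "x \<in> B" "S \<subseteq> B" for x S
    using mult_mono[OF X_bound[OF that] Z_bound[OF that]] by (simp add: f_def abs_mult)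
  have finU: "finite U" "U \<subseteq> B" using B by (auto simp: U_def I_def nb_def)
  have "\<bar>(\<Sum>x\<in>B. f x (insert z S)) - (\<Sum>x\<in>B. f x (S - {z}))\<bar> = \<bar>\<Sum>x\<in>U. f x (insert z S) - f x (S - {z})\<bar>"
    unfolding sum_subtractf[symmetric] using feq finU B
    by (intro arg_cong[where f = abs] sum.mono_neutral_right) auto
  also have "\<dots> \<le> (\<Sum>x\<in>U. 2 * real M)"
  proof (rule order_trans[OF sum_abs], rule sum_mono)
    fix x assume "x \<in> U"
    then have "x \<in> B" using finU by auto
    then show "\<bar>f x (insert z S) - f x (S - {z})\<bar> \<le> 2 * real M"
      using fb[of x "insert z S"] fb[of x "S - {z}"] sub by linarith
  qed
  also have "\<dots> \<le> (M * M) * (2 * real M)"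
    using card_U by (simp add: mult_right_mono flip: of_nat_mult)
  finally have "\<bar>(\<Sum>x\<in>B. f x (insert z S)) - (\<Sum>x\<in>B. f x (S - {z}))\<bar> \<le> 2 * M ^ 3"
    by (simp add: power3_eq_cube)
  moreover have "flip_diff z T S = ((\<Sum>x\<in>B. f x (insert z S)) - (\<Sum>x\<in>B. f x (S - {z}))) / card B"
    by (simp add: flip_diff_def T_def f_def diff_divide_distrib)
  ultimately show ?thesis by (simp add: divide_right_mono)
qed

lemma T_concentrated: "bexp p B (\<lambda>S. \<bar>T S - v\<bar>) \<le> 2 * M ^ 3 / r"
proof -
  let ?c = "2 * real M ^ 3 / card B"
  have n: "0 < real (card B)" using B by (simp add: card_gt_0_iff)
  have "bvar p B T \<le> p * (1 - p) * (\<Sum>z\<in>B. bexp p B (\<lambda>S. (flip_diff z T S)\<^sup>2))"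
    using p B by (intro efron_stein) auto
  also have "\<dots> \<le> 1 * (\<Sum>z\<in>B. ?c\<^sup>2)"
  proof (intro mult_mono sum_mono)
    show "p * (1 - p) \<le> 1" using p mult_mono[of p 1 "1 - p" 1] by simp
    fix z assume z: "z \<in> B"
    have "bexp p B (\<lambda>S. (flip_diff z T S)\<^sup>2) \<le> bexp p B (\<lambda>S. ?c\<^sup>2)"
      using flip_diff_T[OF z] p by (intro bexp_mono) (auto intro!: abs_le_square_iff[THEN iffD1])
    then show "bexp p B (\<lambda>S. (flip_diff z T S)\<^sup>2) \<le> ?c\<^sup>2" using B by (simp add: bexp_const)
  qed (use p in \<open>auto intro!: sum_nonneg bexp_nonneg\<close>)
  also have "\<dots> = (2 * real M ^ 3 / r)\<^sup>2"
    using r n by (simp add: power_divide power2_eq_square field_simps)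
  finally have "sqrt (bvar p B T) \<le> 2 * real M ^ 3 / r"
    using r(1) by (intro real_le_lsqrt) auto
  then show ?thesis
    using bexp_abs_le_sqrt_bvar[of B p T] B p by (simp add: mean_T)
qed

definition cf :: "real \<Rightarrow> complex" where "cf t = bexp p B (\<lambda>S. iexp (t * W S))"

text \<open>Removing the terms \<open>Z x\<close> from \<open>W\<close> gives a sum \<open>W'\<close> independent of \<open>X x\<close>, so \<open>X x exp (i t W')\<close> has mean 0.
  Writing \<open>exp (i t W') = exp (i t W) exp (- i t Z x / r)\<close> and expanding the last factor to first order
  expresses the mean of \<open>X x exp (i t W)\<close> through a term in which only \<open>X x Z x\<close> is added.\<close>
lemma decouple_site:
  fixes t :: real
  assumes x: "x \<in> B"
  shows "norm (bexp p B (\<lambda>S. of_real (X x S) * iexp (t * W S)) -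
     \<i> * of_real (t / r) * bexp p B (\<lambda>S. of_real (X x S * Z x S) * iexp (t * W S))) \<le> t\<^sup>2 * M\<^sup>2 / (2 * card B)"
proof -
  define G where "G S = iexp (t * (W S - Z x S / r))" for S
  \<comment> \<open>the error of the first order expansion\<close>
  define E where "E S = 1 + \<i> * of_real (- t * (Z x S / r)) - iexp (- t * (Z x S / r))" for S
  have WZ: "W S - Z x S / r = (\<Sum>y\<in>B - nb x. X y S) / r" for S
    using sum.subset_diff[of "nb x" B "\<lambda>y. X y S"] B nb_subset
    by (simp add: W_def Z_def flip: diff_divide_distrib)
  have G_local: "G S = G (S \<inter> - A x)" if "S \<subseteq> B" for S
  proof -
    have "X y S = X y (S \<inter> - A x)" if y: "y \<in> B - nb x" for y
    proof -
      have "(S \<inter> - A x) \<inter> A y = S \<inter> A y" using y by (auto simp: nb_def)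
      moreover have "S \<inter> - A x \<subseteq> B" using \<open>S \<subseteq> B\<close> by auto
      ultimately show ?thesis using X_local[of y S] X_local[of y "S \<inter> - A x"] y \<open>S \<subseteq> B\<close> by simp
    qed
    then show ?thesis unfolding G_def WZ by simp
  qed
  have "bexp p B (\<lambda>S. complex_of_real (X x S) * G S) = bexp p B (\<lambda>S. complex_of_real (X x S)) * bexp p B G"
  proof (rule bexp_indep[where A = "A x" and A' = "- A x"])
    show "complex_of_real (X x S) = complex_of_real (X x (S \<inter> A x))" if "S \<subseteq> B" for S
      using X_local[OF x that] by simp
  qed (use B G_local in auto)
  then have indep: "bexp p B (\<lambda>S. complex_of_real (X x S) * G S) = 0"
    using X_mean[OF x] by (simp add: bexp_of_real)
  have decomp: "of_real (X x S) * iexp (t * W S) - \<i> * of_real (t / r) * (of_real (X x S * Z x S) * iexp (t * W S))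
      = of_real (X x S) * iexp (t * W S) * E S + of_real (X x S) * G S" for S
  proof -
    have "G S = iexp (t * W S) * iexp (- t * (Z x S / r))"
      unfolding G_def exp_add[symmetric] by (rule arg_cong[where f = exp]) (simp add: algebra_simps)
    then show ?thesis by (simp add: E_def algebra_simps)
  qed
  have "bexp p B (\<lambda>S. of_real (X x S) * iexp (t * W S)) -
     \<i> * of_real (t / r) * bexp p B (\<lambda>S. of_real (X x S * Z x S) * iexp (t * W S)) =
     bexp p B (\<lambda>S. of_real (X x S) * iexp (t * W S) * E S)"
    unfolding bexp_cmult[symmetric] bexp_diff[symmetric] decomp by (simp add: bexp_add indep)
  also have "norm \<dots> \<le> t\<^sup>2 * M\<^sup>2 / (2 * card B)"
  proof (rule norm_bexp_le_const)
    fix S assume S: "S \<subseteq> B"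
    have "norm (E S) \<le> (- t * (Z x S / r))\<^sup>2 / 2"
      unfolding E_def by (rule iexp_linear_approx)
    also have "\<dots> = t\<^sup>2 * (Z x S)\<^sup>2 / (2 * card B)"
      using r by (simp add: power_mult_distrib power_divide power2_eq_square mult_ac)
    also have "\<dots> \<le> t\<^sup>2 * (real M)\<^sup>2 / (2 * card B)"
      using Z_bound[OF x S] by (intro divide_right_mono mult_left_mono abs_le_square_iff[THEN iffD1]) auto
    finally have "norm (E S) \<le> t\<^sup>2 * (real M)\<^sup>2 / (2 * card B)" .
    moreover have "\<bar>X x S\<bar> * norm (E S) \<le> 1 * norm (E S)"
      using X_bound[OF x S] by (intro mult_right_mono) auto
    ultimately show "norm (of_real (X x S) * iexp (t * W S) * E S) \<le> t\<^sup>2 * M\<^sup>2 / (2 * card B)"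
      by (simp add: norm_mult)
  qed (use p B in auto)
  finally show ?thesis .
qed

definition cf' :: "real \<Rightarrow> complex" where "cf' t = \<i> * bexp p B (\<lambda>S. of_real (W S) * iexp (t * W S))"

lemma cf_deriv: "(cf has_vector_derivative cf' t) (at t)"
proof -
  have "((\<lambda>t. iexp (t * w)) has_vector_derivative \<i> * (of_real w * iexp (t * w))) (at t)" for w
  proof -
    have "((\<lambda>t. t * w) has_vector_derivative w) (at t)"
      by (auto intro!: derivative_eq_intros)
    from vector_diff_chain_at[OF this has_vector_derivative_iexp]
    show ?thesis by (simp add: o_def scaleR_conv_of_real mult.left_commute mult.assoc)
  qed
  then show ?thesis
    unfolding cf_def[abs_def] cf'_def bexp_cmult[symmetric] unfolding bexp_def
    by (intro has_vector_derivative_sum bounded_linear.has_vector_derivative[OF bounded_linear_scaleR_right])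
qed

text \<open>Summing the decoupled terms replaces \<open>\<phi>'\<close> by \<open>- t\<close> times the mean of \<open>T exp (i t W)\<close>, and \<open>T\<close> may be
  replaced by its mean \<open>v\<close> because it is concentrated.\<close>
lemma cf_ode:
  fixes t :: real
  shows "norm (cf' t + of_real (t * v) * cf t) \<le> (2 * M ^ 3 * \<bar>t\<bar> + M\<^sup>2 * t\<^sup>2) / r"
proof -
  define a where "a x = bexp p B (\<lambda>S. complex_of_real (X x S) * iexp (t * W S))" for x
  define b where "b x = bexp p B (\<lambda>S. complex_of_real (X x S * Z x S) * iexp (t * W S))" for x
  have cf'_eq: "cf' t = \<i> * of_real (1 / r) * (\<Sum>x\<in>B. a x)"
  proof -
    have "of_real (W S) * iexp (t * W S) = of_real (1 / r) * (\<Sum>x\<in>B. complex_of_real (X x S) * iexp (t * W S))" for S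
      by (simp add: W_def sum_distrib_right sum_divide_distrib)
    then show ?thesis unfolding cf'_def a_def by (simp only: bexp_cmult bexp_sum mult.assoc)
  qed
  have T_eq: "bexp p B (\<lambda>S. complex_of_real (T S) * iexp (t * W S)) = of_real (1 / card B) * (\<Sum>x\<in>B. b x)"
  proof -
    have "complex_of_real (T S) * iexp (t * W S) =
      of_real (1 / card B) * (\<Sum>x\<in>B. complex_of_real (X x S * Z x S) * iexp (t * W S))" for S
      by (simp add: T_def sum_distrib_right sum_divide_distrib)
    then show ?thesis unfolding b_def by (simp only: bexp_cmult bexp_sum)
  qed
  have rr: "of_real (1 / card B) = complex_of_real (1 / r) * of_real (1 / r)"
    unfolding r(2)[symmetric] by simp
  have "cf' t + of_real (t * v) * cf t =
     \<i> * of_real (1 / r) * (\<Sum>x\<in>B. a x - \<i> * of_real (t / r) * b x)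
      - of_real t * bexp p B (\<lambda>S. of_real (T S - v) * iexp (t * W S))"
  proof -
    have "bexp p B (\<lambda>S. of_real (T S - v) * iexp (t * W S)) = of_real (1 / card B) * (\<Sum>x\<in>B. b x) - of_real v * cf t"
      unfolding T_eq[symmetric] cf_def bexp_cmult[symmetric] bexp_diff[symmetric] by (simp add: algebra_simps)
    moreover have "(\<Sum>x\<in>B. a x - \<i> * of_real (t / r) * b x) = (\<Sum>x\<in>B. a x) - \<i> * of_real (t / r) * (\<Sum>x\<in>B. b x)"
      by (simp add: sum_subtractf sum_distrib_left)
    moreover have "of_real (t / r) = complex_of_real t * of_real (1 / r)" by simp
    moreover have "\<i> * R * P + s * w * c = \<i> * R * (P - \<i> * (s * R) * Q) - s * (R * R * Q - w * c)"
      for R P Q s w c :: complex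
      by (simp add: algebra_simps)
    ultimately show ?thesis unfolding cf'_eq rr of_real_mult by (simp only:)
  qed
  also have "norm \<dots> \<le> M\<^sup>2 * t\<^sup>2 / r + \<bar>t\<bar> * (2 * M ^ 3 / r)"
  proof (rule norm_triangle_le_diff, rule add_mono)
    have "norm (\<Sum>x\<in>B. a x - \<i> * of_real (t / r) * b x) \<le> (\<Sum>x\<in>B. t\<^sup>2 * M\<^sup>2 / (2 * card B))"
      unfolding a_def b_def by (rule sum_norm_le[OF decouple_site])
    also have "\<dots> \<le> t\<^sup>2 * M\<^sup>2" using B by (simp add: field_simps)
    finally show "norm (\<i> * of_real (1 / r) * (\<Sum>x\<in>B. a x - \<i> * of_real (t / r) * b x)) \<le> M\<^sup>2 * t\<^sup>2 / r"
      using r(1) by (simp add: norm_mult norm_divide field_simps)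
    have "norm (bexp p B (\<lambda>S. of_real (T S - v) * iexp (t * W S))) \<le>
        bexp p B (\<lambda>S. norm (of_real (T S - v) * iexp (t * W S)))"
      using p by (rule norm_bexp_le)
    also have "\<dots> = bexp p B (\<lambda>S. \<bar>T S - v\<bar>)" by (simp add: norm_mult flip: of_real_diff)
    also have "\<dots> \<le> 2 * M ^ 3 / r" by (rule T_concentrated)
    finally show "norm (of_real t * bexp p B (\<lambda>S. of_real (T S - v) * iexp (t * W S))) \<le> \<bar>t\<bar> * (2 * M ^ 3 / r)"
      unfolding norm_mult norm_of_real by (rule mult_left_mono) simp
  qed
  also have "\<dots> = (2 * M ^ 3 * \<bar>t\<bar> + M\<^sup>2 * t\<^sup>2) / r"
    by (simp add: add_divide_distrib algebra_simps)
  finally show ?thesis .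
qed

text \<open>\<open>exp (v t\<^sup>2 / 2)\<close> is an integrating factor for \<open>\<phi>' = - v t \<phi>\<close>. Multiplying back, the factors
  \<open>exp (v u\<^sup>2 / 2)\<close> with \<open>|u| \<le> |t|\<close> cancel against \<open>exp (- v t\<^sup>2 / 2)\<close>, so the bound does not involve \<open>v\<close>.\<close>
theorem cf_gaussian:
  fixes t :: real
  shows "norm (cf t - of_real (exp (- (v * t\<^sup>2 / 2)))) \<le> (2 * M ^ 3 * \<bar>t\<bar> + M\<^sup>2 * t\<^sup>2) / r * \<bar>t\<bar>"
proof -
  define e where "e u = exp (v * u\<^sup>2 / 2)" for u
  define \<psi> where "\<psi> u = of_real (e u) * cf u" for u
  define \<psi>' where "\<psi>' u = of_real (e u) * (cf' u + of_real (u * v) * cf u)" for u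
  let ?K = "(2 * M ^ 3 * \<bar>t\<bar> + M\<^sup>2 * t\<^sup>2) / r"
  have v: "0 \<le> v" unfolding v_def using p by (intro bexp_nonneg) auto
  have "norm (\<psi> t - \<psi> 0) \<le> (e t * ?K) * \<bar>t\<bar>"
  proof (rule norm_increment_le)
    fix u :: real assume u: "\<bar>u\<bar> \<le> \<bar>t\<bar>"
    have "(e has_real_derivative e u * (u * v)) (at u)"
      unfolding e_def
      by (auto intro!: derivative_eq_intros)
    from has_vector_derivative_of_real[OF this] 
    have "((\<lambda>u. complex_of_real (e u)) has_vector_derivative of_real (e u * (u * v))) (at u)" .
    from has_vector_derivative_mult[OF this cf_deriv[of u]]
    show "(\<psi> has_vector_derivative \<psi>' u) (at u)"
      unfolding \<psi>_def[abs_def] \<psi>'_def by (simp add: algebra_simps)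
    have u2: "u\<^sup>2 \<le> t\<^sup>2" using u by (rule abs_le_square_iff[THEN iffD1])
    have "norm (cf' u + of_real (u * v) * cf u) \<le> (2 * M ^ 3 * \<bar>u\<bar> + M\<^sup>2 * u\<^sup>2) / r"
      by (rule cf_ode)
    also have "\<dots> \<le> ?K"
      using u u2 r(1) by (intro divide_right_mono add_mono mult_left_mono) auto
    finally have "norm (cf' u + of_real (u * v) * cf u) \<le> ?K" .
    moreover have "e u \<le> e t" unfolding e_def using v u2 by (simp add: mult_left_mono)
    ultimately show "norm (\<psi>' u) \<le> e t * ?K"
      unfolding \<psi>'_def norm_mult by (intro mult_mono) (auto simp: e_def)
  qed
  moreover have "\<psi> 0 = 1" using B by (simp add: \<psi>_def e_def cf_def bexp_const)
  ultimately have h: "norm (\<psi> t - 1) \<le> (e t * ?K) * \<bar>t\<bar>" by simp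
  have et: "0 < e t" by (simp add: e_def)
  have "cf t - of_real (exp (- (v * t\<^sup>2 / 2))) = (\<psi> t - 1) / of_real (e t)"
    by (simp add: \<psi>_def e_def exp_minus field_simps)
  then have "norm (cf t - of_real (exp (- (v * t\<^sup>2 / 2)))) = norm (\<psi> t - 1) / e t"
    using et by (simp add: norm_divide)
  also have "\<dots> \<le> (e t * ?K) * \<bar>t\<bar> / e t"
    using et by (intro divide_right_mono[OF h]) simp
  also have "\<dots> = ?K * \<bar>t\<bar>" using et by simp
  finally show ?thesis .
qed

end

section \<open>Cluster sums with weights vanishing on large clusters\<close>

context site_graph
begin

primrec gball :: "'v \<Rightarrow> nat \<Rightarrow> 'v set" where
  "gball x 0 = {x}"
| "gball x (Suc k) = gball x k \<union> {z. \<exists>y\<in>gball x k. adj y z}"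

lemma gball_self: "x \<in> gball x k"
  by (induction k) auto

lemma gball_trans: "y \<in> gball x j \<Longrightarrow> z \<in> gball y k \<Longrightarrow> z \<in> gball x (j + k)"
  by (induction k arbitrary: z) auto

lemma gball_mono: "j \<le> k \<Longrightarrow> gball x j \<subseteq> gball x k"
  using gball_trans[of x x j _ "k - j"] gball_self gball_trans[of _ x j _ "k - j"] by fastforce

lemma gball_sym: "y \<in> gball x k \<Longrightarrow> x \<in> gball y k"
proof (induction k arbitrary: y)
  case (Suc k)
  show ?case
  proof (cases "y \<in> gball x k")
    case True
    then show ?thesis using Suc by auto
  next
    case False
    then obtain z where z: "z \<in> gball x k" "adj z y" using Suc.prems by auto
    then have "z \<in> gball y 1" using adj_sym by auto
    from gball_trans[OF this Suc.IH[OF z(1)]] show ?thesis by simp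
  qed
qed simp

lemma finite_gball [simp]: "finite (gball x k)" and card_gball: "card (gball x k) \<le> (D + 1) ^ k"
proof -
  have "finite (gball x k) \<and> card (gball x k) \<le> (D + 1) ^ k"
  proof (induction k)
    case (Suc k)
    have eq: "{z. \<exists>y\<in>gball x k. adj y z} = (\<Union>y\<in>gball x k. {z. adj y z})" by auto
    have "card (\<Union>y\<in>gball x k. {z. adj y z}) \<le> (\<Sum>y\<in>gball x k. card {z. adj y z})"
      using Suc by (intro card_UN_le) auto
    also have "\<dots> \<le> card (gball x k) * D"
      using card_nbrs sum_bounded_above[of "gball x k" "\<lambda>y. card {z. adj y z}" D] by simp
    finally have "card (gball x (Suc k)) \<le> card (gball x k) + card (gball x k) * D"
      unfolding gball.simps eq by (rule order_trans[OF card_Un_le add_left_mono])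
    also have "\<dots> = card (gball x k) * (D + 1)" by simp
    also have "\<dots> \<le> (D + 1) ^ k * (D + 1)" using Suc by (intro mult_right_mono) auto
    finally show ?case using Suc finite_nbrs eq by (auto simp: mult.commute)
  qed simp
  then show "finite (gball x k)" "card (gball x k) \<le> (D + 1) ^ k" by auto
qed

definition outer_bd :: "'v set \<Rightarrow> 'v set" where
  "outer_bd B = {z. z \<notin> B \<and> (\<exists>y\<in>B. adj z y)}"

lemma finite_outer_bd: "finite B \<Longrightarrow> finite (outer_bd B)"
proof -
  assume "finite B"
  then have "finite (\<Union>y\<in>B. {z. adj y z})" using finite_nbrs by auto
  then show ?thesis by (rule rev_finite_subset) (auto simp: outer_bd_def intro: adj_sym)
qed

text \<open>A path of length at most \<open>k\<close> that leaves \<open>B\<close> does so through the outer boundary, so every such site is within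
  distance \<open>k\<close> of a boundary site.\<close>
lemma card_near_boundary:
  assumes "finite B"
  shows "card {x \<in> B. \<not> gball x k \<subseteq> B} \<le> (D + 1) ^ k * card (outer_bd B)"
proof -
  have near: "\<exists>z\<in>outer_bd B. z \<in> gball x k" if "x \<in> B" "\<not> gball x k \<subseteq> B" for x
    using that
  proof (induction k)
    case (Suc k)
    show ?case
    proof (cases "gball x k \<subseteq> B")
      case True
      then obtain y z where "y \<in> gball x k" "adj y z" "z \<notin> B" "y \<in> B" using Suc.prems by auto
      then have "z \<in> outer_bd B" "z \<in> gball x (Suc k)" using adj_sym by (auto simp: outer_bd_def)
      then show ?thesis by blast
    next
      case False
      then show ?thesis using Suc by auto
    qed
  qed simp
  have "{x \<in> B. \<not> gball x k \<subseteq> B} \<subseteq> (\<Union>z\<in>outer_bd B. gball z k)"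
    using near gball_sym by blast
  then have "card {x \<in> B. \<not> gball x k \<subseteq> B} \<le> card (\<Union>z\<in>outer_bd B. gball z k)"
    using finite_outer_bd[OF assms] by (intro card_mono) auto
  also have "\<dots> \<le> (\<Sum>z\<in>outer_bd B. card (gball z k))"
    using finite_outer_bd[OF assms] by (intro card_UN_le)
  also have "\<dots> \<le> (\<Sum>z\<in>outer_bd B. (D + 1) ^ k)" by (intro sum_mono card_gball)
  finally show ?thesis by (simp add: mult.commute)
qed

lemma overlapping_gballs: "{y. gball x k \<inter> gball y k \<noteq> {}} \<subseteq> gball x (2 * k)"
proof
  fix y assume "y \<in> {y. gball x k \<inter> gball y k \<noteq> {}}"
  then obtain z where "z \<in> gball x k" "z \<in> gball y k" by auto
  then show "y \<in> gball x (2 * k)" using gball_trans[of z x k y k] gball_sym by (simp add: mult_2)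
qed

text \<open>A cluster that is not exhausted at distance \<open>k\<close> has a further site at distance \<open>k + 1\<close>.\<close>
lemma cluster_growth:
  assumes "finite S" "x \<in> S"
  shows "cluster S x \<subseteq> gball x k \<or> Suc k \<le> card (cluster S x \<inter> gball x k)"
proof (induction k)
  case 0
  then show ?case by auto
next
  case (Suc k)
  let ?C = "cluster S x"
  show ?case
  proof (cases "?C \<subseteq> gball x k")
    case True
    then show ?thesis using gball_mono[of k "Suc k" x] by auto
  next
    case False
    then have grow: "Suc k \<le> card (?C \<inter> gball x k)" using Suc by simp
    have "\<exists>a b. a \<in> ?C \<inter> gball x k \<and> b \<in> S \<and> adj a b \<and> b \<notin> ?C \<inter> gball x k"
    proof (rule ccontr)
      assume "\<not> ?thesis"
      then have "?C = ?C \<inter> gball x k"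
        using gball_self[of x k] by (intro cluster_eqI) auto
      then show False using False by auto
    qed
    then obtain a b where ab: "a \<in> ?C" "a \<in> gball x k" "b \<in> S" "adj a b" "b \<notin> ?C \<inter> gball x k" by auto
    have "b \<in> ?C" using ab cluster_subset[OF assms(2)] cluster_step[of a S x b] by auto
    moreover have "b \<in> gball x (Suc k)" using ab by auto
    ultimately have "insert b (?C \<inter> gball x k) \<subseteq> ?C \<inter> gball x (Suc k)" by auto
    then have "card (insert b (?C \<inter> gball x k)) \<le> card (?C \<inter> gball x (Suc k))"
      by (intro card_mono finite_Int disjI2 finite_gball)
    then show ?thesis using grow ab by simp
  qed
qed

text \<open>A cluster of at most \<open>m\<close> sites lies within distance \<open>m\<close> of \<open>x\<close>; one more step is needed to see that its
  boundary is closed.\<close>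
lemma cluster_local:
  assumes S: "finite S" "x \<in> S" and le: "card (cluster S x) \<le> m"
    and eq: "S \<inter> gball x (Suc m) = S' \<inter> gball x (Suc m)"
  shows "cluster S' x = cluster S x"
proof -
  let ?C = "cluster S x"
  have "finite ?C" using S cluster_subset finite_subset by metis
  then have "card (?C \<inter> gball x m) \<le> m" using le by (meson card_mono inf_le1 le_trans)
  then have C: "?C \<subseteq> gball x m" using cluster_growth[OF S, of m] by linarith
  then have CS': "?C \<subseteq> S'" using cluster_subset[OF S(2)] gball_mono[of m "Suc m" x] eq by auto
  show ?thesis
  proof (rule cluster_eqI)
    show "?C \<subseteq> cluster S' x"
      using cluster_mono[OF CS', of x] cluster_cluster[OF S(2)] by simp
    fix a b assume ab: "a \<in> ?C" "b \<in> S'" "adj a b"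
    then have "b \<in> gball x (Suc m)" using C by auto
    then have "b \<in> S" using ab eq by auto
    then show "b \<in> ?C" using ab cluster_subset[OF S(2)] cluster_step[of a S x b] by auto
  qed simp
qed

declare gball.simps(2) [simp del]

text \<open>The contribution of \<open>x\<close> to \<open>csum w\<close> when the weight of each cluster is shared equally by its sites.\<close>
definition site_share :: "(nat \<Rightarrow> real) \<Rightarrow> 'v \<Rightarrow> 'v set \<Rightarrow> real" where
  "site_share w x S = (if x \<in> S then w (card (cluster S x)) / card (cluster S x) else 0)"

lemma csum_site_share:
  assumes "finite B" "S \<subseteq> B"
  shows "csum w S = (\<Sum>x\<in>B. site_share w x S)"
proof -
  have "finite S" using assms finite_subset by auto
  then have "csum w S = (\<Sum>x\<in>S. w (card (cluster S x)) / card (cluster S x))"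
    unfolding csum_def by (rule sum_clusters_per_site)
  also have "\<dots> = (\<Sum>x\<in>B. site_share w x S)"
    unfolding site_share_def using assms by (intro sum.mono_neutral_cong_left) auto
  finally show ?thesis .
qed

lemma site_share_local:
  assumes w: "\<And>k. m < k \<Longrightarrow> w k = 0" and S: "finite S"
  shows "site_share w x S = site_share w x (S \<inter> gball x (Suc m))"
proof -
  let ?S' = "S \<inter> gball x (Suc m)"
  have fin: "finite ?S'" using S by simp
  show ?thesis
  proof (cases "x \<in> S")
    case True
    then have x': "x \<in> ?S'" using gball_self by simp
    consider "card (cluster S x) \<le> m" | "card (cluster ?S' x) \<le> m"
      | "m < card (cluster S x)" "m < card (cluster ?S' x)" by linarith
    then have "cluster ?S' x = cluster S x \<or> (w (card (cluster S x)) = 0 \<and> w (card (cluster ?S' x)) = 0)"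
    proof cases
      case 1
      then show ?thesis using cluster_local[OF S True 1, of ?S'] by auto
    next
      case 2
      then show ?thesis using cluster_local[OF fin x' 2, of S] by auto
    qed (use w in auto)
    then show ?thesis using True x' by (auto simp: site_share_def)
  qed (simp add: site_share_def)
qed

lemma site_share_bounds:
  assumes w: "\<And>k. 0 \<le> w k \<and> w k \<le> 1" and "finite S"
  shows "0 \<le> site_share w x S" "site_share w x S \<le> 1"
proof -
  have "w k / real k \<le> 1" for k
  proof (cases "k = 0")
    case False
    have "w k \<le> 1" using w by simp
    also have "1 \<le> real k" using False by simp
    finally show ?thesis using False by simp
  qed simp
  then show "site_share w x S \<le> 1" by (simp add: site_share_def)
  show "0 \<le> site_share w x S" using w by (simp add: site_share_def)
qed

lemma local_field_site_share:
  fixes w :: "nat \<Rightarrow> real"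
  assumes p: "0 < p" "p < 1" and B: "finite B" "B \<noteq> {}"
    and w: "\<And>k. 0 \<le> w k \<and> w k \<le> 1" and m: "\<And>k. m < k \<Longrightarrow> w k = 0"
  shows "local_field p B (\<lambda>x S. site_share w x S - bexp p B (site_share w x)) (\<lambda>x. gball x (Suc m))
     ((D + 1) ^ (2 * Suc m))"
proof (unfold_locales)
  show "0 \<le> p" "p \<le> 1" "finite B" "B \<noteq> {}" using p B by auto
  fix x assume x: "x \<in> B"
  have fin: "finite S" if "S \<subseteq> B" for S using that B finite_subset by auto
  have "0 \<le> bexp p B (site_share w x)"
    using site_share_bounds[OF w fin] p by (intro bexp_nonneg) auto
  moreover have "bexp p B (site_share w x) \<le> bexp p B (\<lambda>_. 1)"
    using site_share_bounds[OF w fin] p by (intro bexp_mono) auto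
  ultimately have e: "0 \<le> bexp p B (site_share w x)" "bexp p B (site_share w x) \<le> 1"
    using B by (auto simp: bexp_const)
  show "\<bar>site_share w x S - bexp p B (site_share w x)\<bar> \<le> 1" if "S \<subseteq> B" for S
    using site_share_bounds[where w = w and x = x, OF w fin[OF that]] e by linarith
  show "bexp p B (\<lambda>S. site_share w x S - bexp p B (site_share w x)) = 0"
    using B by (simp add: bexp_diff bexp_const)
  show "site_share w x S - bexp p B (site_share w x) =
      site_share w x (S \<inter> gball x (Suc m)) - bexp p B (site_share w x)" if "S \<subseteq> B" for S
    using site_share_local[OF m fin[OF that], where x = x] by simp
  have "card {y \<in> B. gball x (Suc m) \<inter> gball y (Suc m) \<noteq> {}} \<le> card (gball x (2 * Suc m))"
    using overlapping_gballs[of x "Suc m"] by (intro card_mono) auto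
  also have "\<dots> \<le> (D + 1) ^ (2 * Suc m)" by (rule card_gball)
  finally show "card {y \<in> B. gball x (Suc m) \<inter> gball y (Suc m) \<noteq> {}} \<le> (D + 1) ^ (2 * Suc m)" .
qed

lemma centred_csum:
  assumes "finite B" "S \<subseteq> B"
  shows "(\<Sum>x\<in>B. site_share w x S - bexp p B (site_share w x)) = csum w S - bexp p B (csum w)"
proof -
  have "bexp p B (csum w) = bexp p B (\<lambda>S. \<Sum>x\<in>B. site_share w x S)"
    using csum_site_share[OF assms(1)] by (intro bexp_cong) auto
  then show ?thesis using csum_site_share[OF assms] by (simp add: sum_subtractf bexp_sum)
qed

definition std_csum :: "real \<Rightarrow> 'v set \<Rightarrow> (nat \<Rightarrow> real) \<Rightarrow> 'v set \<Rightarrow> real" where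
  "std_csum p B w S = (csum w S - bexp p B (csum w)) / sqrt (card B)"

text \<open>The constant depends on \<open>D\<close>, \<open>m\<close> and \<open>t\<close> only, so the bound is uniform over all finite sets.\<close>
lemma cf_csum_gaussian:
  fixes w :: "nat \<Rightarrow> real" and t :: real
  assumes p: "0 < p" "p < 1"
    and w: "\<And>k. 0 \<le> w k \<and> w k \<le> 1" and m: "\<And>k. m < k \<Longrightarrow> w k = 0"
  shows "\<exists>c\<ge>0. \<forall>B. finite B \<longrightarrow> B \<noteq> {} \<longrightarrow>
    norm (bexp p B (\<lambda>S. iexp (t * std_csum p B w S)) - of_real (exp (- (bvar p B (csum w) / card B * t\<^sup>2 / 2))))
      \<le> c / sqrt (card B)"
proof (intro exI conjI allI impI)
  let ?M = "(D + 1) ^ (2 * Suc m)"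
  show "0 \<le> (2 * real (?M ^ 3) * \<bar>t\<bar> + real (?M\<^sup>2) * t\<^sup>2) * \<bar>t\<bar>" by simp
  fix B :: "'v set" assume B: "finite B" "B \<noteq> {}"
  interpret L: local_field p B "\<lambda>x S. site_share w x S - bexp p B (site_share w x)" "\<lambda>x. gball x (Suc m)" ?M
    by (rule local_field_site_share[OF p B w m])
  have W: "L.W S = std_csum p B w S" if "S \<subseteq> B" for S
    using centred_csum[OF B(1) that] by (simp add: L.W_def L.r_def std_csum_def)
  have "L.v = bexp p B (\<lambda>S. (csum w S - bexp p B (csum w))\<^sup>2 * (1 / card B))"
    unfolding L.v_def using W by (intro bexp_cong) (simp add: std_csum_def power_divide)
  then have v: "L.v = bvar p B (csum w) / card B" by (simp only: bexp_cmult_right bvar_def) simp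
  have cf: "L.cf t = bexp p B (\<lambda>S. iexp (t * std_csum p B w S))"
    unfolding L.cf_def using W by (intro bexp_cong) simp
  show "norm (bexp p B (\<lambda>S. iexp (t * std_csum p B w S)) - of_real (exp (- (bvar p B (csum w) / card B * t\<^sup>2 / 2))))
      \<le> (2 * real (?M ^ 3) * \<bar>t\<bar> + real (?M\<^sup>2) * t\<^sup>2) * \<bar>t\<bar> / sqrt (card B)"
    using L.cf_gaussian[of t] unfolding cf v L.r_def by (simp add: mult.commute)
qed

end

section \<open>Variance per site in a transitive graph\<close>
locale transitive_site_graph = site_graph adj D
  for adj :: "'v \<Rightarrow> 'v \<Rightarrow> bool" and D +
  assumes transitive: "\<And>x y. \<exists>\<tau>. bij \<tau> \<and> (\<forall>a b. adj (\<tau> a) (\<tau> b) \<longleftrightarrow> adj a b) \<and> \<tau> x = y"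
begin

lemma gball_auto:
  assumes \<tau>: "bij \<tau>" "\<And>a b. adj (\<tau> a) (\<tau> b) \<longleftrightarrow> adj a b"
  shows "gball (\<tau> x) k = \<tau> ` gball x k"
proof (induction k)
  case (Suc k)
  have "{z. \<exists>y\<in>gball x k. adj (\<tau> y) z} = \<tau> ` {z. \<exists>y\<in>gball x k. adj y z}"
  proof (intro equalityI subsetI)
    fix z assume "z \<in> {z. \<exists>y\<in>gball x k. adj (\<tau> y) z}"
    moreover obtain u where "z = \<tau> u" using \<tau>(1) by (metis bij_pointE)
    ultimately show "z \<in> \<tau> ` {z. \<exists>y\<in>gball x k. adj y z}" using \<tau>(2) by auto
  qed (use \<tau>(2) in auto)
  then show ?case by (simp add: Suc image_Un gball.simps(2))
qed simp

lemma cluster_auto: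
  assumes \<tau>: "bij \<tau>" "\<And>a b. adj (\<tau> a) (\<tau> b) \<longleftrightarrow> adj a b" and x: "x \<in> S"
  shows "cluster (\<tau> ` S) (\<tau> x) = \<tau> ` cluster S x"
proof (rule cluster_eqI)
  show "\<tau> ` cluster S x \<subseteq> cluster (\<tau> ` S) (\<tau> x)"
  proof
    fix z assume "z \<in> \<tau> ` cluster S x"
    then obtain y where z: "z = \<tau> y" and y: "(x, y) \<in> (edges S)\<^sup>*" by (auto simp: cluster_def)
    from y have "\<tau> y \<in> cluster (\<tau> ` S) (\<tau> x)"
    proof (induction rule: rtrancl_induct)
      case (step y u)
      then show ?case using cluster_step[of "\<tau> y" "\<tau> ` S" "\<tau> x" "\<tau> u"] \<tau>(2) by (auto simp: edges_def)
    qed simp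
    then show "z \<in> cluster (\<tau> ` S) (\<tau> x)" using z by simp
  qed
  fix a b assume ab: "a \<in> \<tau> ` cluster S x" "b \<in> \<tau> ` S" "adj a b"
  then obtain a' b' where ab': "a = \<tau> a'" "b = \<tau> b'" "a' \<in> cluster S x" "b' \<in> S" by auto
  then have "adj a' b'" using ab \<tau>(2) by simp
  then have "b' \<in> cluster S x" using ab' x cluster_subset[OF x] cluster_step[of a' S x b'] by auto
  then show "b \<in> \<tau> ` cluster S x" using ab' by simp
qed simp

lemma site_share_auto:
  assumes \<tau>: "bij \<tau>" "\<And>a b. adj (\<tau> a) (\<tau> b) \<longleftrightarrow> adj a b"
  shows "site_share w (\<tau> x) (\<tau> ` S) = site_share w x S"
proof -
  have inj: "inj \<tau>" using \<tau>(1) by (rule bij_is_inj)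
  then have "\<tau> x \<in> \<tau> ` S \<longleftrightarrow> x \<in> S" by (auto dest: injD)
  moreover have "card (\<tau> ` cluster S x) = card (cluster S x)"
    using inj by (intro card_image) (auto intro: inj_on_subset)
  ultimately show ?thesis using cluster_auto[OF \<tau>, of x S] by (simp add: site_share_def)
qed

text \<open>The sum of the covariances of the share of \<open>x\<close> with all other shares, for a set \<open>B\<close> containing the ball of
  radius \<open>3 k\<close>, when shares depend on sites within distance \<open>k\<close> only: partners of \<open>x\<close> lie within distance \<open>2 k\<close> and look at sites within distance \<open>k\<close> of themselves.\<close>
definition local_cov :: "real \<Rightarrow> (nat \<Rightarrow> real) \<Rightarrow> nat \<Rightarrow> 'v \<Rightarrow> real" where
  "local_cov p w k x = (\<Sum>y\<in>{y. gball x k \<inter> gball y k \<noteq> {}}.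
     bexp p (gball x (3 * k)) (\<lambda>S. site_share w x S * site_share w y S) -
     bexp p (gball x (3 * k)) (site_share w x) * bexp p (gball x (3 * k)) (site_share w y))"

lemma local_cov_const: "local_cov p w k x = local_cov p w k y"
proof -
  obtain \<tau> where \<tau>: "bij \<tau>" "\<And>a b. adj (\<tau> a) (\<tau> b) \<longleftrightarrow> adj a b" and y: "\<tau> x = y"
    using transitive by metis
  have inj: "inj \<tau>" using \<tau>(1) by (rule bij_is_inj)
  let ?N = "\<lambda>x. {y. gball x k \<inter> gball y k \<noteq> {}}"
  have N: "?N (\<tau> x) = \<tau> ` ?N x"
  proof -
    have "u \<in> ?N (\<tau> x) \<longleftrightarrow> u \<in> \<tau> ` ?N x" for u
    proof -
      obtain u' where u': "u = \<tau> u'" using \<tau>(1) by (metis bij_pointE)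
      have "gball (\<tau> x) k \<inter> gball (\<tau> u') k = \<tau> ` (gball x k \<inter> gball u' k)"
        using gball_auto[OF \<tau>] inj by (simp add: image_Int)
      then show ?thesis using u' inj by (auto dest: injD)
    qed
    then show ?thesis by blast
  qed
  have e: "bexp p (gball (\<tau> x) (3 * k)) f = bexp p (gball x (3 * k)) (\<lambda>S. f (\<tau> ` S))" for f :: "'v set \<Rightarrow> real"
    unfolding gball_auto[OF \<tau>] using inj by (intro bexp_image) (auto intro: inj_on_subset)
  have injN: "inj_on \<tau> (?N x)" using inj by (rule inj_on_subset) simp
  show ?thesis
    unfolding y[symmetric] local_cov_def N sum.reindex[OF injN] o_def e site_share_auto[OF \<tau>] ..
qed

text \<open>Sites whose ball of radius \<open>3 (m + 1)\<close> lies in \<open>B\<close> contribute \<open>\<kappa>\<close> to the variance. The other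
  sites are at most a constant times as many as boundary sites, and each contributes a bounded amount.\<close>
lemma bvar_csum_density:
  fixes w :: "nat \<Rightarrow> real"
  assumes p: "0 < p" "p < 1"
    and w: "\<And>k. 0 \<le> w k \<and> w k \<le> 1" and m: "\<And>k. m < k \<Longrightarrow> w k = 0"
  shows "\<exists>\<kappa> c. \<forall>B. finite B \<longrightarrow> B \<noteq> {} \<longrightarrow>
    \<bar>bvar p B (csum w) / card B - \<kappa>\<bar> \<le> c * (card (outer_bd B) / card B)"
proof -
  let ?k = "Suc m"
  let ?M = "(D + 1) ^ (2 * ?k)"
  define \<kappa> where "\<kappa> = local_cov p w ?k undefined"
  have \<kappa>: "local_cov p w ?k x = \<kappa>" for x unfolding \<kappa>_def by (rule local_cov_const)
  define c where "c = (real ?M + \<bar>\<kappa>\<bar>) * real ((D + 1) ^ (3 * ?k))"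
  show ?thesis
  proof (rule exI[of _ \<kappa>], rule exI[of _ c], intro allI impI)
    fix B :: "'v set" assume B: "finite B" "B \<noteq> {}"
    let ?X = "\<lambda>x S. site_share w x S - bexp p B (site_share w x)"
    interpret L: local_field p B ?X "\<lambda>x. gball x ?k" ?M
      by (rule local_field_site_share[OF p B w m])
    define I where "I x = (\<Sum>y\<in>L.nb x. bexp p B (\<lambda>S. ?X x S * ?X y S))" for x
    have n: "0 < real (card B)" using B by (simp add: card_gt_0_iff)
    have "bvar p B (csum w) / card B = L.v"
    proof -
      have "L.v = bexp p B (\<lambda>S. (csum w S - bexp p B (csum w))\<^sup>2 * (1 / card B))"
        unfolding L.v_def using centred_csum[OF B(1)]
        by (intro bexp_cong) (simp add: L.W_def L.r_def power_divide)
      then show ?thesis by (simp only: bexp_cmult_right bvar_def) simp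
    qed
    also have "\<dots> = (\<Sum>x\<in>B. I x) / card B" by (simp add: L.v_eq I_def)
    finally have v: "bvar p B (csum w) / card B = (\<Sum>x\<in>B. I x) / card B" .
    let ?bad = "{x \<in> B. \<not> gball x (3 * ?k) \<subseteq> B}"
    have good: "I x = \<kappa>" if x: "x \<in> B" and sub: "gball x (3 * ?k) \<subseteq> B" for x
    proof -
      let ?Q = "gball x (3 * ?k)"
      let ?N = "{y. gball x ?k \<inter> gball y ?k \<noteq> {}}"
      have N: "y \<in> gball x (2 * ?k)" if "y \<in> ?N" for y using that overlapping_gballs by blast
      have NB: "L.nb x = ?N"
      proof -
        have "y \<in> B" if "y \<in> ?N" for y
        proof -
          have "2 * ?k \<le> 3 * ?k" by simp
          from subsetD[OF gball_mono[OF this] N[OF that]] sub show ?thesis by (rule rev_subsetD)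
        qed
        then show ?thesis by (auto simp: L.nb_def)
      qed
      have sub_y: "gball y ?k \<subseteq> ?Q" if "y \<in> ?N" for y
      proof
        fix z assume "z \<in> gball y ?k"
        from gball_trans[OF N[OF that] this] show "z \<in> ?Q" by (simp only: mult_Suc numeral_3_eq_3 mult_2 add.assoc mult_0 add_0_right numeral_2_eq_2)
      qed
      have self: "x \<in> ?N" using gball_self by auto
      have loc: "site_share w y S = site_share w y (S \<inter> ?Q)" if "y \<in> ?N" "S \<subseteq> B" for y S
      proof -
        have fin: "finite S" using that B finite_subset by auto
        have "site_share w y S = site_share w y (S \<inter> gball y ?k)"
          by (rule site_share_local[OF m fin])
        also have "S \<inter> gball y ?k = (S \<inter> ?Q) \<inter> gball y ?k" using sub_y[OF that(1)] by auto
        also have "site_share w y \<dots> = site_share w y (S \<inter> ?Q)"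
          using fin by (intro site_share_local[OF m, symmetric]) auto
        finally show ?thesis .
      qed
      have "bexp p B (\<lambda>S. ?X x S * ?X y S) = bexp p ?Q (\<lambda>S. site_share w x S * site_share w y S) -
          bexp p ?Q (site_share w x) * bexp p ?Q (site_share w y)" if y: "y \<in> ?N" for y
      proof -
        have "bexp p B (\<lambda>S. ?X x S * ?X y S) = bexp p B (\<lambda>S. site_share w x S * site_share w y S) -
           bexp p B (site_share w x) * bexp p B (site_share w y)"
          using B by (simp add: algebra_simps bexp_diff bexp_add bexp_cmult bexp_cmult_right bexp_const)
        moreover have "bexp p B (\<lambda>S. site_share w x S * site_share w y S) = bexp p ?Q (\<lambda>S. site_share w x S * site_share w y S)"
          using loc[OF self] loc[OF y] by (intro bexp_superset B sub) metis
        moreover have "bexp p B (site_share w z) = bexp p ?Q (site_share w z)" if "z \<in> ?N" for z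
          using loc[OF that] by (intro bexp_superset B sub) 
        ultimately show ?thesis using self y by simp
      qed
      then have "I x = local_cov p w ?k x" unfolding I_def NB local_cov_def by (intro sum.cong refl) 
      then show ?thesis by (simp add: \<kappa>)
    qed
    have bound: "\<bar>I x\<bar> \<le> ?M" if x: "x \<in> B" for x
    proof -
      have "\<bar>bexp p B (\<lambda>S. ?X x S * ?X y S)\<bar> \<le> 1" if y: "y \<in> L.nb x" for y
      proof -
        have "y \<in> B" using y L.nb_subset by auto
        then have "norm (bexp p B (\<lambda>S. ?X x S * ?X y S)) \<le> 1"
          using p B L.X_bound[OF x] L.X_bound[of y]
          by (intro norm_bexp_le_const) (auto simp: abs_mult intro!: mult_le_one)
        then show ?thesis by simp
      qed
      then have "\<bar>I x\<bar> \<le> (\<Sum>y\<in>L.nb x. 1)"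
        unfolding I_def by (intro sum_abs[THEN order_trans] sum_mono)
      also have "\<dots> = real (card (L.nb x))" by simp
      also have "\<dots> \<le> real ?M"
        using L.card_overlap[OF x] unfolding L.nb_def by (simp only: of_nat_le_iff)
      finally show ?thesis .
    qed
    have "\<bar>(\<Sum>x\<in>B. I x) - \<kappa> * card B\<bar> = \<bar>\<Sum>x\<in>B. I x - \<kappa>\<bar>" by (simp add: sum_subtractf mult.commute)
    also have "(\<Sum>x\<in>B. I x - \<kappa>) = (\<Sum>x\<in>?bad. I x - \<kappa>)"
      using good B by (intro sum.mono_neutral_right) auto
    also have "\<bar>\<Sum>x\<in>?bad. I x - \<kappa>\<bar> \<le> (\<Sum>x\<in>?bad. real ?M + \<bar>\<kappa>\<bar>)"
    proof (rule order_trans[OF sum_abs], rule sum_mono)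
      fix x assume "x \<in> ?bad"
      then show "\<bar>I x - \<kappa>\<bar> \<le> real ?M + \<bar>\<kappa>\<bar>" using bound[of x] by auto
    qed
    also have "\<dots> = (real ?M + \<bar>\<kappa>\<bar>) * card ?bad" by (simp add: mult.commute)
    also have "\<dots> \<le> (real ?M + \<bar>\<kappa>\<bar>) * real ((D + 1) ^ (3 * ?k) * card (outer_bd B))"
      using card_near_boundary[OF B(1), of "3 * ?k"] by (intro mult_left_mono) (auto simp only: of_nat_le_iff of_nat_0_le_iff add_nonneg_nonneg abs_ge_zero)
    also have "\<dots> = c * card (outer_bd B)" by (simp only: c_def of_nat_mult mult.assoc)
    finally have "\<bar>(\<Sum>x\<in>B. I x) - \<kappa> * card B\<bar> / card B \<le> c * card (outer_bd B) / card B"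
      using n by (intro divide_right_mono) auto
    moreover have "(\<Sum>x\<in>B. I x) / card B - \<kappa> = ((\<Sum>x\<in>B. I x) - \<kappa> * card B) / card B"
      using n by (simp add: diff_divide_distrib)
    then have "\<bar>(\<Sum>x\<in>B. I x) - \<kappa> * card B\<bar> / card B = \<bar>(\<Sum>x\<in>B. I x) / card B - \<kappa>\<bar>"
      by simp
    ultimately show "\<bar>bvar p B (csum w) / card B - \<kappa>\<bar> \<le> c * (card (outer_bd B) / card B)"
      unfolding v by simp
  qed
qed

end

section \<open>Removing the truncation\<close>
lemma norm_iexp_diff: "norm (iexp a - iexp b) \<le> \<bar>a - b\<bar>"
proof -
  have "iexp a = iexp b * iexp (a - b)"
    unfolding exp_add[symmetric] by (rule arg_cong[where f = exp]) (simp add: algebra_simps)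
  then have "iexp a - iexp b = iexp b * (iexp (a - b) - 1)" by (simp add: right_diff_distrib)
  moreover have "norm (iexp (a - b) - 1) \<le> \<bar>a - b\<bar>" using iexp_approx1[of "a - b" 0] by simp
  ultimately show ?thesis by (simp add: norm_mult)
qed

context site_graph
begin

lemma scale_mono: "j \<le> J \<Longrightarrow> scale j \<le> scale J"
  unfolding scale_def by (intro power_increasing) auto

lemma tail_weight_bounds: "0 \<le> tail_weight J k" "tail_weight J k \<le> 1"
proof -
  have "(\<Sum>j<J. if scale j < k then 1 else 0 :: real) \<le> (\<Sum>j<J. 1)" by (intro sum_mono) auto
  then show "tail_weight J k \<le> 1" by (cases "J = 0") (auto simp: tail_weight_def divide_le_eq_1)
  show "0 \<le> tail_weight J k" unfolding tail_weight_def by (intro divide_nonneg_nonneg sum_nonneg) auto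
qed

lemma tail_weight_large:
  assumes "1 \<le> J" "scale J < k"
  shows "tail_weight J k = 1"
proof -
  have "scale j < k" if "j < J" for j using scale_mono[of j J] that assms by auto
  then show ?thesis using assms by (simp add: tail_weight_def)
qed

definition num :: "'v set \<Rightarrow> real" where "num = csum (\<lambda>_. 1)"

lemma num_eq: "num S = card (clusters S)" by (simp add: num_def csum_def)

lemma csum_head: "csum (\<lambda>k. 1 - tail_weight J k) S = num S - csum (tail_weight J) S"
  by (simp add: csum_def num_def sum_subtractf)

lemma bvar_num:
  assumes p: "0 < p" "p < 1" and B: "finite B"
  shows "bvar p B num \<le> (real D)\<^sup>2 * card B"
proof -
  have "\<bar>flip_diff x num S\<bar> \<le> real D" if "S \<subseteq> B" for x S
  proof -
    have "finite S" using that B finite_subset by auto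
    then have "flip_diff x num S = 1 - real (card {C \<in> clusters (S - {x}). touches x C})"
      using csum_insert[of "S - {x}" x "\<lambda>_. 1"] by (simp add: flip_diff_def num_def)
    then show ?thesis using card_touching[of "S - {x}" x] D_pos \<open>finite S\<close> by simp
  qed
  then have "bexp p B (\<lambda>S. (flip_diff x num S)\<^sup>2) \<le> bexp p B (\<lambda>S. (real D)\<^sup>2)" for x
    using p by (intro bexp_mono) (auto intro!: abs_le_square_iff[THEN iffD1])
  then have *: "bexp p B (\<lambda>S. (flip_diff x num S)\<^sup>2) \<le> (real D)\<^sup>2" for x
    using B by (simp add: bexp_const)
  have "bvar p B num \<le> p * (1 - p) * (\<Sum>x\<in>B. bexp p B (\<lambda>S. (flip_diff x num S)\<^sup>2))"
    using p B by (intro efron_stein) auto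
  also have "\<dots> \<le> 1 * (\<Sum>x\<in>B. (real D)\<^sup>2)"
  proof (intro mult_mono sum_mono *)
    show "p * (1 - p) \<le> 1" using p mult_mono[of p 1 "1 - p" 1] by simp
  qed (use p in \<open>auto intro!: sum_nonneg bexp_nonneg\<close>)
  finally show ?thesis by (simp add: mult.commute)
qed

text \<open>With \<open>a\<close> and \<open>b\<close> the centred count and the centred tail part, \<open>(a - b)\<^sup>2 - a\<^sup>2\<close> is bounded by a small
  multiple of \<open>a\<^sup>2\<close> plus a large multiple of \<open>b\<^sup>2\<close>; the factor \<open>sqrt J\<close> balances the variances of order
  \<open>|B|\<close> and \<open>|B| / J\<close>.\<close>
lemma bvar_truncation:
  assumes p: "0 < p" "p < 1" and B: "finite B" and J: "1 \<le> J"
  shows "\<bar>bvar p B (csum (\<lambda>k. 1 - tail_weight J k)) - bvar p B num\<bar>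
     \<le> ((real D)\<^sup>2 + 2 * var_const) / sqrt J * card B"
proof -
  define r where "r = sqrt J"
  have r: "1 \<le> r" "real J = r * r" using J by (auto simp: r_def)
  define a where "a S = num S - bexp p B num" for S
  define b where "b S = csum (tail_weight J) S - bexp p B (csum (tail_weight J))" for S
  have g: "bvar p B (csum (\<lambda>k. 1 - tail_weight J k)) = bexp p B (\<lambda>S. (a S - b S)\<^sup>2)"
    unfolding bvar_def csum_head[abs_def] a_def b_def by (simp add: bexp_diff algebra_simps)
  have f: "bvar p B num = bexp p B (\<lambda>S. (a S)\<^sup>2)" by (simp add: bvar_def a_def)
  have h: "bvar p B (csum (tail_weight J)) = bexp p B (\<lambda>S. (b S)\<^sup>2)" by (simp add: bvar_def b_def)
  have pw: "\<bar>(x - y)\<^sup>2 - x\<^sup>2\<bar> \<le> (1 / r) * x\<^sup>2 + (2 * r) * y\<^sup>2" for x y :: real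
  proof -
    have "0 \<le> (x - r * y)\<^sup>2 / r" "0 \<le> (x + r * y)\<^sup>2 / r" using r by auto
    then have "2 * x * y \<le> (1 / r) * x\<^sup>2 + r * y\<^sup>2" "- (2 * x * y) \<le> (1 / r) * x\<^sup>2 + r * y\<^sup>2"
      using r(1) by (auto simp: power2_eq_square field_simps)
    moreover have "1 * y\<^sup>2 \<le> r * y\<^sup>2" using r by (intro mult_right_mono) auto
    moreover have "(x - y)\<^sup>2 - x\<^sup>2 = y\<^sup>2 - 2 * x * y" by (simp add: power2_eq_square algebra_simps)
    moreover have "0 \<le> y\<^sup>2" by simp
    ultimately show ?thesis unfolding abs_le_iff by linarith
  qed
  have "\<bar>bvar p B (csum (\<lambda>k. 1 - tail_weight J k)) - bvar p B num\<bar> = \<bar>bexp p B (\<lambda>S. (a S - b S)\<^sup>2 - (a S)\<^sup>2)\<bar>"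
    by (simp add: f g bexp_diff)
  also have "\<dots> \<le> bexp p B (\<lambda>S. \<bar>(a S - b S)\<^sup>2 - (a S)\<^sup>2\<bar>)"
    using norm_bexp_le[of p B "\<lambda>S. (a S - b S)\<^sup>2 - (a S)\<^sup>2"] p by simp
  also have "\<dots> \<le> bexp p B (\<lambda>S. (1 / r) * (a S)\<^sup>2 + (2 * r) * (b S)\<^sup>2)"
    using p pw by (intro bexp_mono) auto
  also have "\<dots> = (1 / r) * bvar p B num + (2 * r) * bvar p B (csum (tail_weight J))"
    unfolding f h by (simp only: bexp_add bexp_cmult)
  also have "\<dots> \<le> (1 / r) * ((real D)\<^sup>2 * card B) + (2 * r) * (var_const * card B / J)"
    using bvar_num[OF p B] bvar_tail[OF p B J] r(1) by (intro add_mono mult_left_mono) auto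
  also have "\<dots> = ((real D)\<^sup>2 + 2 * var_const) / r * card B"
    unfolding r(2) using r(1) by (simp add: field_simps)
  finally show ?thesis by (simp add: r_def)
qed

lemma cf_truncation:
  fixes t :: real
  assumes p: "0 < p" "p < 1" and B: "finite B" "B \<noteq> {}" and J: "1 \<le> J"
  shows "norm (bexp p B (\<lambda>S. iexp (t * std_csum p B (\<lambda>_. 1) S)) -
     bexp p B (\<lambda>S. iexp (t * std_csum p B (\<lambda>k. 1 - tail_weight J k) S))) \<le> \<bar>t\<bar> * sqrt (var_const / J)"
proof -
  define r where "r = sqrt (card B)"
  have r: "0 < r" "real (card B) = r * r" using B by (auto simp: r_def card_gt_0_iff)
  let ?h = "csum (tail_weight J)"
  have std: "t * std_csum p B (\<lambda>_. 1) S - t * std_csum p B (\<lambda>k. 1 - tail_weight J k) S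
      = t / r * (?h S - bexp p B ?h)" for S
  proof -
    have "t * (a / r) - t * (b / r) = t / r * (a - b)" for a b :: real
      by (simp add: right_diff_distrib diff_divide_distrib)
    then show ?thesis
      unfolding std_csum_def csum_head[abs_def] num_def[symmetric] r_def[symmetric] by (simp add: bexp_diff)
  qed
  have "norm (bexp p B (\<lambda>S. iexp (t * std_csum p B (\<lambda>_. 1) S)) -
     bexp p B (\<lambda>S. iexp (t * std_csum p B (\<lambda>k. 1 - tail_weight J k) S))) \<le>
     bexp p B (\<lambda>S. norm (iexp (t * std_csum p B (\<lambda>_. 1) S) - iexp (t * std_csum p B (\<lambda>k. 1 - tail_weight J k) S)))"
    unfolding bexp_diff[symmetric] using p by (intro norm_bexp_le) auto
  also have "\<dots> \<le> bexp p B (\<lambda>S. (\<bar>t\<bar> / r) * \<bar>?h S - bexp p B ?h\<bar>)"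
  proof (rule bexp_mono)
    fix S
    show "norm (iexp (t * std_csum p B (\<lambda>_. 1) S) - iexp (t * std_csum p B (\<lambda>k. 1 - tail_weight J k) S))
       \<le> (\<bar>t\<bar> / r) * \<bar>?h S - bexp p B ?h\<bar>"
      using norm_iexp_diff[of "t * std_csum p B (\<lambda>_. 1) S" "t * std_csum p B (\<lambda>k. 1 - tail_weight J k) S"]
      unfolding std using r(1) by (simp add: abs_mult)
  qed (use p in auto)
  also have "\<dots> = (\<bar>t\<bar> / r) * bexp p B (\<lambda>S. \<bar>?h S - bexp p B ?h\<bar>)" by (rule bexp_cmult)
  also have "\<dots> \<le> (\<bar>t\<bar> / r) * sqrt (var_const * card B / J)"
  proof (rule mult_left_mono)
    have "bexp p B (\<lambda>S. \<bar>?h S - bexp p B ?h\<bar>) \<le> sqrt (bvar p B ?h)"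
      using p B by (intro bexp_abs_le_sqrt_bvar) auto
    also have "\<dots> \<le> sqrt (var_const * card B / J)" using bvar_tail[OF p B(1) J] by simp
    finally show "bexp p B (\<lambda>S. \<bar>?h S - bexp p B ?h\<bar>) \<le> sqrt (var_const * card B / J)" .
  qed (use r in auto)
  also have "sqrt (var_const * card B / J) = r * sqrt (var_const / J)"
    unfolding r_def real_sqrt_mult[symmetric] by (simp add: mult.commute)
  finally show ?thesis using r(1) by simp
qed

definition folner :: "(nat \<Rightarrow> 'v set) \<Rightarrow> bool" where
  "folner B \<longleftrightarrow> (\<forall>n. finite (B n) \<and> B n \<noteq> {}) \<and> (\<lambda>n. card (outer_bd (B n)) / card (B n)) \<longlonglongrightarrow> 0"

end

lemma inverse_sqrt_small:
  fixes a :: real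
  assumes "0 < e"
  shows "\<exists>J\<ge>1. a / sqrt (real J) < e"
proof -
  have "((\<lambda>J. a / sqrt (real J)) \<longlongrightarrow> 0) sequentially"
    by (intro real_tendsto_divide_at_top[OF tendsto_const] filterlim_compose[OF sqrt_at_top] filterlim_real_sequentially)
  then have "eventually (\<lambda>J. a / sqrt (real J) < e) sequentially" using assms by (rule order_tendstoD)
  then have "eventually (\<lambda>J. 1 \<le> J \<and> a / sqrt (real J) < e) sequentially"
    using eventually_ge_at_top[of 1] by eventually_elim auto
  then show ?thesis by (auto dest: eventually_happens'[rotated])
qed

context transitive_site_graph
begin

lemma bvar_num_density:
  fixes J :: nat
  assumes p: "0 < p" "p < 1" and J: "1 \<le> J"
  shows "\<exists>\<kappa> c. \<forall>B. finite B \<longrightarrow> B \<noteq> {} \<longrightarrow> \<bar>bvar p B num / card B - \<kappa>\<bar> \<le>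
     ((real D)\<^sup>2 + 2 * var_const) / sqrt J + c * (card (outer_bd B) / card B)"
proof -
  have "\<exists>\<kappa> c. \<forall>B. finite B \<longrightarrow> B \<noteq> {} \<longrightarrow>
    \<bar>bvar p B (csum (\<lambda>k. 1 - tail_weight J k)) / card B - \<kappa>\<bar> \<le> c * (card (outer_bd B) / card B)"
    using tail_weight_bounds tail_weight_large[OF J]
    by (intro bvar_csum_density[OF p, where m = "scale J"]) auto
  then obtain \<kappa> c where *: "\<And>B. finite B \<Longrightarrow> B \<noteq> {} \<Longrightarrow>
    \<bar>bvar p B (csum (\<lambda>k. 1 - tail_weight J k)) / card B - \<kappa>\<bar> \<le> c * (card (outer_bd B) / card B)" by blast
  show ?thesis
  proof (rule exI[of _ \<kappa>], rule exI[of _ c], intro allI impI)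
    fix B :: "'v set" assume B: "finite B" "B \<noteq> {}"
    have n: "0 < real (card B)" using B by (simp add: card_gt_0_iff)
    have "\<bar>bvar p B (csum (\<lambda>k. 1 - tail_weight J k)) - bvar p B num\<bar> / card B
      \<le> ((real D)\<^sup>2 + 2 * var_const) / sqrt J"
      using bvar_truncation[OF p B(1) J] n by (simp add: pos_divide_le_eq)
    moreover have "\<bar>bvar p B (csum (\<lambda>k. 1 - tail_weight J k)) - bvar p B num\<bar> / card B
      = \<bar>bvar p B (csum (\<lambda>k. 1 - tail_weight J k)) / card B - bvar p B num / card B\<bar>"
      unfolding diff_divide_distrib[symmetric] abs_divide by simp
    ultimately show "\<bar>bvar p B num / card B - \<kappa>\<bar> \<le>
     ((real D)\<^sup>2 + 2 * var_const) / sqrt J + c * (card (outer_bd B) / card B)"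
      using *[OF B] by linarith
  qed
qed

text \<open>The same \<open>\<kappa>\<close> serves all sequences, which is why the limiting variance does not depend on the sequence.\<close>
lemma folner_variance_close:
  assumes p: "0 < p" "p < 1" and e: "0 < e"
  shows "\<exists>\<kappa>. \<forall>B. folner B \<longrightarrow> (\<forall>\<^sub>F n in sequentially. \<bar>bvar p (B n) num / card (B n) - \<kappa>\<bar> < e)"
proof -
  obtain J :: nat where J: "1 \<le> J" "((real D)\<^sup>2 + 2 * var_const) / sqrt J < e / 2"
    using inverse_sqrt_small[of "e / 2" "(real D)\<^sup>2 + 2 * var_const"] e by auto
  obtain \<kappa> c where *: "\<And>B. finite B \<Longrightarrow> B \<noteq> {} \<Longrightarrow> \<bar>bvar p B num / card B - \<kappa>\<bar> \<le>
     ((real D)\<^sup>2 + 2 * var_const) / sqrt J + c * (card (outer_bd B) / card B)"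
    using bvar_num_density[OF p J(1)] by blast
  show ?thesis
  proof (intro exI[of _ \<kappa>] allI impI)
    fix B assume B: "folner B"
    have "(\<lambda>n. c * (card (outer_bd (B n)) / card (B n))) \<longlonglongrightarrow> c * 0"
      using B unfolding folner_def by (intro tendsto_mult tendsto_const) auto
    then have "\<forall>\<^sub>F n in sequentially. c * (card (outer_bd (B n)) / card (B n)) < e / 2"
      using e by (intro order_tendstoD(2)) auto
    then show "\<forall>\<^sub>F n in sequentially. \<bar>bvar p (B n) num / card (B n) - \<kappa>\<bar> < e"
    proof eventually_elim
      case (elim n)
      have "finite (B n)" "B n \<noteq> {}" using B by (auto simp: folner_def)
      from *[OF this] elim J(2) show ?case by linarith
    qed
  qed
qed

theorem variance_limit:
  assumes p: "0 < p" "p < 1"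
  shows "\<exists>\<sigma>2. \<forall>B. folner B \<longrightarrow> (\<lambda>n. bvar p (B n) num / card (B n)) \<longlonglongrightarrow> \<sigma>2"
proof (cases "\<exists>B0. folner B0")
  case True
  then obtain B0 where B0: "folner B0" by blast
  let ?u = "\<lambda>B n. bvar p (B n) num / card (B n)"
  have "Cauchy (?u B0)"
  proof (rule metric_CauchyI)
    fix e :: real assume "0 < e"
    then obtain \<kappa> where "\<forall>\<^sub>F n in sequentially. \<bar>?u B0 n - \<kappa>\<bar> < e / 2"
      using folner_variance_close[OF p, of "e / 2"] B0 by auto
    then obtain N where N: "\<And>n. N \<le> n \<Longrightarrow> \<bar>?u B0 n - \<kappa>\<bar> < e / 2" by (auto simp: eventually_sequentially)
    show "\<exists>M. \<forall>m\<ge>M. \<forall>n\<ge>M. dist (?u B0 m) (?u B0 n) < e"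
    proof (intro exI[of _ N] allI impI)
      fix m n assume "N \<le> m" "N \<le> n"
      from N[OF this(1)] N[OF this(2)] show "dist (?u B0 m) (?u B0 n) < e"
        unfolding dist_real_def by linarith
    qed
  qed
  then obtain \<sigma>2 where \<sigma>2: "?u B0 \<longlonglongrightarrow> \<sigma>2" using Cauchy_convergent convergent_def by blast
  show ?thesis
  proof (intro exI[of _ \<sigma>2] allI impI)
    fix B assume B: "folner B"
    show "?u B \<longlonglongrightarrow> \<sigma>2"
    proof (rule tendstoI)
      fix e :: real assume e: "0 < e"
      then obtain \<kappa> where \<kappa>: "\<And>B. folner B \<Longrightarrow> \<forall>\<^sub>F n in sequentially. \<bar>?u B n - \<kappa>\<bar> < e / 2"
        using folner_variance_close[OF p, of "e / 2"] by auto
      have "\<forall>\<^sub>F n in sequentially. ?u B0 n \<in> {\<kappa> - e / 2..\<kappa> + e / 2}"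
        using \<kappa>[OF B0]
      proof eventually_elim
        case (elim n)
        then show ?case unfolding atLeastAtMost_iff by linarith
      qed
      then have "\<sigma>2 \<in> {\<kappa> - e / 2..\<kappa> + e / 2}"
        by (intro Lim_in_closed_set[OF _ _ _ \<sigma>2]) auto
      then have "\<kappa> - e / 2 \<le> \<sigma>2" "\<sigma>2 \<le> \<kappa> + e / 2" by auto
      then have "\<bar>\<sigma>2 - \<kappa>\<bar> \<le> e / 2" by linarith
      from \<kappa>[OF B] show "\<forall>\<^sub>F n in sequentially. dist (?u B n) \<sigma>2 < e"
      proof eventually_elim
        case (elim n)
        then show ?case using \<open>\<bar>\<sigma>2 - \<kappa>\<bar> \<le> e / 2\<close> unfolding dist_real_def by linarith
      qed
    qed
  qed
qed auto

text \<open>Three errors: replacing the count by its truncation at level \<open>J\<close>, the Gaussian approximation for the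
  truncation, and replacing the variance of the truncation by \<open>\<sigma>2\<close>. First \<open>J\<close> is chosen to make the errors due
  to truncation small uniformly in \<open>n\<close>, then \<open>n\<close> tends to infinity.\<close>
theorem cf_limit:
  fixes t :: real
  assumes p: "0 < p" "p < 1" and B: "folner B"
    and card: "filterlim (\<lambda>n. real (card (B n))) at_top sequentially"
    and \<sigma>2: "(\<lambda>n. bvar p (B n) num / card (B n)) \<longlonglongrightarrow> \<sigma>2"
  shows "(\<lambda>n. bexp p (B n) (\<lambda>S. iexp (t * std_csum p (B n) (\<lambda>_. 1) S))) \<longlonglongrightarrow> of_real (exp (- (\<sigma>2 * t\<^sup>2 / 2)))"
proof (rule tendstoI)
  fix e :: real assume e: "0 < e"
  let ?b = "\<bar>t\<bar> * sqrt var_const + ((real D)\<^sup>2 + 2 * var_const) * t\<^sup>2 / 2"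
  have Bn: "finite (B n)" "B n \<noteq> {}" for n using B by (auto simp: folner_def)
  have Bpos: "0 < real (card (B n))" for n using Bn[of n] by (simp add: card_gt_0_iff)
  obtain J :: nat where J: "1 \<le> J" "?b / sqrt J < e / 3" using inverse_sqrt_small[of "e / 3" ?b] e by auto
  let ?w = "\<lambda>k. 1 - tail_weight J k"
  have "\<exists>c\<ge>0. \<forall>B. finite B \<longrightarrow> B \<noteq> {} \<longrightarrow>
    norm (bexp p B (\<lambda>S. iexp (t * std_csum p B ?w S)) - of_real (exp (- (bvar p B (csum ?w) / card B * t\<^sup>2 / 2))))
      \<le> c / sqrt (card B)"
    using tail_weight_bounds tail_weight_large[OF J(1)]
    by (intro cf_csum_gaussian[OF p, where m = "scale J"]) auto
  then obtain c where c: "\<And>B. finite B \<Longrightarrow> B \<noteq> {} \<Longrightarrow>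
    norm (bexp p B (\<lambda>S. iexp (t * std_csum p B ?w S)) - of_real (exp (- (bvar p B (csum ?w) / card B * t\<^sup>2 / 2))))
      \<le> c / sqrt (card B)" by blast
  have "(\<lambda>n. c / sqrt (card (B n))) \<longlonglongrightarrow> 0"
    by (intro real_tendsto_divide_at_top[OF tendsto_const] filterlim_compose[OF sqrt_at_top card])
  then have ev1: "\<forall>\<^sub>F n in sequentially. c / sqrt (card (B n)) < e / 3" using e by (intro order_tendstoD(2)) auto
  have "(\<lambda>n. \<bar>bvar p (B n) num / card (B n) - \<sigma>2\<bar> * t\<^sup>2 / 2) \<longlonglongrightarrow> \<bar>\<sigma>2 - \<sigma>2\<bar> * t\<^sup>2 / 2"
    using \<sigma>2 by (intro tendsto_intros) auto
  then have ev2: "\<forall>\<^sub>F n in sequentially. \<bar>bvar p (B n) num / card (B n) - \<sigma>2\<bar> * t\<^sup>2 / 2 < e / 3"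
    by (rule order_tendstoD(2)) (use e in simp)
  have \<sigma>2_nonneg: "0 \<le> \<sigma>2"
    using \<sigma>2 by (rule LIMSEQ_le_const) (use p in \<open>auto intro!: divide_nonneg_nonneg bvar_nonneg\<close>)
  have exp_lip: "\<bar>exp (- x) - exp (- y)\<bar> \<le> \<bar>x - y\<bar>" if "0 \<le> x" "0 \<le> y" for x y :: real
  proof -
    have *: "exp (- x) - exp (- y) \<le> y - x" if "0 \<le> x" "x \<le> y" for x y :: real
    proof -
      have "exp (- x) - exp (- y) = exp (- x) * (1 - exp (- (y - x)))" by (simp add: algebra_simps flip: exp_add)
      also have "\<dots> \<le> 1 * (y - x)"
      proof (rule mult_mono)
        show "1 - exp (- (y - x)) \<le> y - x" using exp_ge_add_one_self[of "- (y - x)"] by linarith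
      qed (use that in auto)
      finally show ?thesis by simp
    qed
    show ?thesis using *[of x y] *[of y x] that by (cases "x \<le> y") (auto simp: abs_if)
  qed
  from ev1 ev2 show "\<forall>\<^sub>F n in sequentially. dist (bexp p (B n) (\<lambda>S. iexp (t * std_csum p (B n) (\<lambda>_. 1) S)))
     (of_real (exp (- (\<sigma>2 * t\<^sup>2 / 2)))) < e"
  proof eventually_elim
    case (elim n)
    let ?n = "real (card (B n))"
    let ?F = "bexp p (B n) (\<lambda>S. iexp (t * std_csum p (B n) (\<lambda>_. 1) S))"
    let ?G = "bexp p (B n) (\<lambda>S. iexp (t * std_csum p (B n) ?w S))"
    let ?v = "bvar p (B n) (csum ?w) / ?n"
    have 1: "norm (?F - ?G) \<le> \<bar>t\<bar> * sqrt var_const / sqrt J"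
      using cf_truncation[OF p Bn[of n] J(1), of t] by (simp add: real_sqrt_divide)
    have 2: "norm (?G - of_real (exp (- (?v * t\<^sup>2 / 2)))) < e / 3" using c[OF Bn[of n]] elim(1) by linarith
    have "\<bar>?v - bvar p (B n) num / ?n\<bar> = \<bar>bvar p (B n) (csum ?w) - bvar p (B n) num\<bar> / ?n"
      using Bpos[of n] by (simp add: diff_divide_distrib[symmetric] abs_divide)
    also have "\<dots> \<le> ((real D)\<^sup>2 + 2 * var_const) / sqrt J"
      using bvar_truncation[OF p Bn(1)[of n] J(1)] Bpos[of n] by (simp add: pos_divide_le_eq)
    finally have v: "\<bar>?v - bvar p (B n) num / ?n\<bar> \<le> ((real D)\<^sup>2 + 2 * var_const) / sqrt J" .
    have "norm (of_real (exp (- (?v * t\<^sup>2 / 2))) - complex_of_real (exp (- (\<sigma>2 * t\<^sup>2 / 2))))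
      = \<bar>exp (- (?v * t\<^sup>2 / 2)) - exp (- (\<sigma>2 * t\<^sup>2 / 2))\<bar>" by (simp only: of_real_diff[symmetric] norm_of_real)
    also have "\<dots> \<le> \<bar>?v * t\<^sup>2 / 2 - \<sigma>2 * t\<^sup>2 / 2\<bar>"
      using \<sigma>2_nonneg bvar_nonneg[of p "B n" "csum ?w"] p Bpos[of n] by (intro exp_lip) auto
    also have "\<dots> = \<bar>?v - \<sigma>2\<bar> * (t\<^sup>2 / 2)"
    proof -
      have eq: "a * t\<^sup>2 / 2 - b * t\<^sup>2 / 2 = (a - b) * (t\<^sup>2 / 2)" for a b
        by (simp add: left_diff_distrib diff_divide_distrib)
      show ?thesis unfolding eq abs_mult by simp
    qed
    also have "\<dots> \<le> (((real D)\<^sup>2 + 2 * var_const) / sqrt J + \<bar>bvar p (B n) num / ?n - \<sigma>2\<bar>) * (t\<^sup>2 / 2)"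
      using v by (intro mult_right_mono) auto
    finally have 3: "norm (of_real (exp (- (?v * t\<^sup>2 / 2))) - complex_of_real (exp (- (\<sigma>2 * t\<^sup>2 / 2)))) \<le>
        ((real D)\<^sup>2 + 2 * var_const) / sqrt J * (t\<^sup>2 / 2) + \<bar>bvar p (B n) num / ?n - \<sigma>2\<bar> * t\<^sup>2 / 2"
      by (simp only: distrib_right times_divide_eq_right add_divide_distrib)
    have b: "\<bar>t\<bar> * sqrt var_const / sqrt J + ((real D)\<^sup>2 + 2 * var_const) / sqrt J * (t\<^sup>2 / 2) = ?b / sqrt J"
    proof -
      have "u * a / s + c / s * (x / 2) = (u * a + c * x / 2) / s" for u a c s x :: real
        by (simp add: add_divide_distrib)
      then show ?thesis .
    qed
    have "dist ?F (of_real (exp (- (\<sigma>2 * t\<^sup>2 / 2)))) \<le> norm (?F - ?G) + norm (?G - of_real (exp (- (?v * t\<^sup>2 / 2))))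
       + norm (of_real (exp (- (?v * t\<^sup>2 / 2))) - complex_of_real (exp (- (\<sigma>2 * t\<^sup>2 / 2))))"
      unfolding dist_norm by (rule order_trans[OF _ norm_triangle_ineq[THEN order_trans[OF _ add_right_mono[OF norm_triangle_ineq]]]]) simp
    then show ?case using 1 2 3 b J(2) elim(2) by linarith
  qed
qed

end

section \<open>Decay of the characteristic function\<close>
lemma one_minus_cos_ge:
  assumes "\<bar>t\<bar> \<le> pi"
  shows "t\<^sup>2 / 18 \<le> 1 - cos t"
proof -
  define u where "u = t / 2"
  have u: "\<bar>u\<bar> \<le> 2" using assms pi_less_4 by (simp add: u_def)
  have "\<bar>sin u - u\<bar> \<le> \<bar>u\<bar> ^ 3 / 6"
  proof -
    have "(\<Sum>m<3. sin_coeff m * u ^ m) = u" by (simp add: numeral_3_eq_3 sin_coeff_def)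
    moreover have "fact 3 = (6 :: real)" by (simp add: fact_numeral)
    ultimately show ?thesis using Maclaurin_sin_bound[of u 3] by simp
  qed
  moreover have "\<bar>u\<bar> ^ 3 \<le> \<bar>u\<bar> * 4"
    using mult_left_mono[OF power_mono[OF u, of 2], of "\<bar>u\<bar>"] by (simp add: power3_eq_cube power2_eq_square)
  ultimately have "\<bar>u\<bar> / 3 \<le> \<bar>sin u\<bar>" by linarith
  then have "(\<bar>u\<bar> / 3)\<^sup>2 \<le> \<bar>sin u\<bar>\<^sup>2" by (intro power_mono) auto
  moreover have "1 - cos t = 2 * (sin u)\<^sup>2" using cos_double_sin[of u] by (simp add: u_def)
  ultimately show ?thesis by (simp add: u_def power_divide)
qed

lemma bernoulli_cf_bound:
  assumes p: "0 < p" "p < 1" and t: "\<bar>t\<bar> \<le> pi"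
  shows "norm (of_real (1 - p) + of_real p * iexp t) \<le> 1 - p * (1 - p) * t\<^sup>2 / 18"
    and "p * (1 - p) * t\<^sup>2 / 18 \<le> 1"
proof -
  define y where "y = p * (1 - p) * (1 - cos t)"
  have pq: "0 \<le> p * (1 - p)" "p * (1 - p) \<le> 1 / 4"
  proof -
    have "0 \<le> (p - 1 / 2)\<^sup>2" by simp
    then show "p * (1 - p) \<le> 1 / 4" by (simp add: power2_eq_square algebra_simps)
  qed (use p in auto)
  have "y \<le> 1 / 4 * 2" unfolding y_def using pq cos_ge_minus_one[of t] by (intro mult_mono) auto
  then have y1: "y \<le> 1" by simp
  have "(norm (of_real (1 - p) + of_real p * iexp t))\<^sup>2 = (1 - p + p * cos t)\<^sup>2 + (p * sin t)\<^sup>2"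
    by (simp add: cmod_power2 Re_exp Im_exp)
  also have "\<dots> = (1 - p)\<^sup>2 + 2 * (p * (1 - p)) * cos t + p\<^sup>2 * ((sin t)\<^sup>2 + (cos t)\<^sup>2)"
    by (simp only: power2_eq_square) algebra
  also have "\<dots> = 1 - 2 * y" unfolding sin_cos_squared_add by (simp add: y_def power2_eq_square algebra_simps)
  also have "\<dots> \<le> (1 - y)\<^sup>2" by (simp add: power2_eq_square algebra_simps)
  finally have n: "norm (of_real (1 - p) + of_real p * iexp t) \<le> 1 - y"
    by (rule power2_le_imp_le) (use y1 in simp)
  have "p * (1 - p) * (t\<^sup>2 / 18) \<le> y"
    unfolding y_def by (rule mult_left_mono[OF one_minus_cos_ge[OF t] pq(1)])
  then have "p * (1 - p) * t\<^sup>2 / 18 \<le> y" by simp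
  then show "norm (of_real (1 - p) + of_real p * iexp t) \<le> 1 - p * (1 - p) * t\<^sup>2 / 18"
    "p * (1 - p) * t\<^sup>2 / 18 \<le> 1"
    using n y1 by linarith+
qed

lemma bexp_card_power:
  "finite B \<Longrightarrow> bexp p B (\<lambda>S. z ^ card S) = (of_real (1 - p) + of_real p * z) ^ card B"
proof (induction B rule: finite_induct)
  case (insert x B)
  have "bexp p B (\<lambda>S. z ^ card (insert x S)) = bexp p B (\<lambda>S. z * z ^ card S)"
  proof (rule bexp_cong)
    fix S assume "S \<subseteq> B"
    then have "finite S" "x \<notin> S" using insert.hyps finite_subset[of S B] by auto
    then show "z ^ card (insert x S) = z * z ^ card S" by simp
  qed
  then have "bexp p (insert x B) (\<lambda>S. z ^ card S) =
      of_real p * (z * bexp p B (\<lambda>S. z ^ card S)) + of_real (1 - p) * bexp p B (\<lambda>S. z ^ card S)"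
    unfolding bexp_insert[OF insert.hyps] by (simp only: bexp_cmult scaleR_conv_of_real)
  also have "\<dots> = (of_real (1 - p) + of_real p * z) * bexp p B (\<lambda>S. z ^ card S)"
    by (simp only: distrib_right mult.assoc add.commute)
  finally show ?case unfolding insert.IH using insert.hyps by (simp only: card_insert_disjoint power_Suc not_False_eq_True)
qed simp

lemma bexp_no_open:
  assumes "finite B"
  shows "bexp p B (\<lambda>S. if S \<inter> A = {} then 1 else 0 :: real) = (1 - p) ^ card (B \<inter> A)"
proof -
  have "bexp p B (\<lambda>S. if S \<inter> A = {} then 1 else 0 :: real) = bexp p (B \<inter> A) (\<lambda>S. if S \<inter> A = {} then 1 else 0)"
    using assms by (intro bexp_superset) (auto simp: Int_assoc)
  also have "\<dots> = (\<Sum>S\<in>Pow (B \<inter> A). if S = {} then (1 - p) ^ card (B \<inter> A) else 0)"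
    unfolding bexp_def by (intro sum.cong refl) auto
  also have "\<dots> = (1 - p) ^ card (B \<inter> A)" using assms by (simp add: sum.delta)
  finally show ?thesis .
qed

lemma bexp_prod:
  fixes f :: "'i \<Rightarrow> 'v set \<Rightarrow> real"
  assumes "finite X" "finite B"
    and loc: "\<And>x S. x \<in> X \<Longrightarrow> S \<subseteq> B \<Longrightarrow> f x S = f x (S \<inter> N x)"
    and disj: "\<And>x y. x \<in> X \<Longrightarrow> y \<in> X \<Longrightarrow> x \<noteq> y \<Longrightarrow> N x \<inter> N y = {}"
  shows "bexp p B (\<lambda>S. \<Prod>x\<in>X. f x S) = (\<Prod>x\<in>X. bexp p B (f x))"
  using assms(1) loc disj
proof (induction X rule: finite_induct)
  case empty
  then show ?case using assms(2) by (simp add: bexp_const)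
next
  case (insert x X)
  have "bexp p B (\<lambda>S. f x S * (\<Prod>y\<in>X. f y S)) = bexp p B (f x) * bexp p B (\<lambda>S. \<Prod>y\<in>X. f y S)"
  proof (rule bexp_indep[where A = "N x" and A' = "\<Union>y\<in>X. N y"])
    show "N x \<inter> (\<Union>y\<in>X. N y) = {}" using insert.hyps insert.prems(2)[of x] by auto
    show "f x S = f x (S \<inter> N x)" if "S \<subseteq> B" for S using insert.prems(1) that by simp
    show "(\<Prod>y\<in>X. f y S) = (\<Prod>y\<in>X. f y (S \<inter> (\<Union>y\<in>X. N y)))" if "S \<subseteq> B" for S
    proof (rule prod.cong)
      fix y assume y: "y \<in> X"
      have "S \<inter> (\<Union>y\<in>X. N y) \<inter> N y = S \<inter> N y" using y by auto
      moreover have "S \<inter> (\<Union>y\<in>X. N y) \<subseteq> B" using that by auto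
      ultimately show "f y S = f y (S \<inter> (\<Union>y\<in>X. N y))"
        using insert.prems(1)[of y S] insert.prems(1)[of y "S \<inter> (\<Union>y\<in>X. N y)"] y that by simp
    qed simp
  qed (rule assms(2))
  moreover have "bexp p B (\<lambda>S. \<Prod>y\<in>X. f y S) = (\<Prod>y\<in>X. bexp p B (f y))"
    using insert.prems by (intro insert.IH) auto
  ultimately show ?case using insert.hyps by simp
qed

context site_graph
begin

text \<open>Greedy choice: keeping a site excludes at most \<open>(D + 1)\<^sup>2\<close> sites, those within distance 2.\<close>
lemma separated_subset:
  assumes "finite B"
  shows "\<exists>X\<subseteq>B. (\<forall>x\<in>X. \<forall>y\<in>X. x \<noteq> y \<longrightarrow> y \<notin> gball x 2) \<and> card B \<le> (D + 1)\<^sup>2 * card X"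
  using assms
proof (induction B rule: finite_psubset_induct)
  case (psubset B)
  show ?case
  proof (cases "B = {}")
    case False
    then obtain x where x: "x \<in> B" by auto
    let ?B' = "B - gball x 2"
    have "?B' \<subset> B" using x gball_self[of x 2] by auto
    from psubset.IH[OF this] obtain X where X: "X \<subseteq> ?B'"
      "\<forall>x\<in>X. \<forall>y\<in>X. x \<noteq> y \<longrightarrow> y \<notin> gball x 2" "card ?B' \<le> (D + 1)\<^sup>2 * card X" by blast
    have fin: "finite X" using X(1) psubset(1) finite_subset by auto
    have "card B \<le> card ?B' + card (gball x 2)"
      using card_Un_le[of ?B' "gball x 2"] card_mono[of "?B' \<union> gball x 2" B] psubset(1) by auto
    also have "\<dots> \<le> (D + 1)\<^sup>2 * card X + (D + 1)\<^sup>2" using X(3) card_gball[of x 2] by linarith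
    also have "\<dots> = (D + 1)\<^sup>2 * card (insert x X)"
      using X(1) gball_self[of x 2] fin by (subst card_insert_disjoint) auto
    finally have "card B \<le> (D + 1)\<^sup>2 * card (insert x X)" .
    moreover have "\<forall>y\<in>insert x X. \<forall>z\<in>insert x X. y \<noteq> z \<longrightarrow> z \<notin> gball y 2"
      using X(1,2) gball_sym by blast
    moreover have "insert x X \<subseteq> B" using x X(1) by auto
    ultimately show ?thesis by blast
  qed auto
qed

lemma num_add_isolated:
  assumes "finite V" "finite S" "V \<inter> S = {}" "\<And>x y. x \<in> V \<Longrightarrow> y \<in> V \<union> S \<Longrightarrow> \<not> adj x y"
  shows "num (S \<union> V) = num S + card V"
  using assms
proof (induction V rule: finite_induct)
  case (insert x V)
  have "{C \<in> clusters (S \<union> V). touches x C} = {}"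
    using clusters_subset[of _ "S \<union> V"] insert.prems(3)[of x] by (fastforce simp: touches_def)
  then have "num (insert x (S \<union> V)) - num (S \<union> V) = 1"
    unfolding num_def using insert by (subst csum_insert) auto
  then show ?case using insert by simp
qed simp

text \<open>Sites of \<open>X\<close> have disjoint neighbourhoods outside \<open>X\<close>. Given the set \<open>U\<close> of open sites outside \<open>X\<close>, the sites
  of \<open>X\<close> without open neighbours form the set \<open>I U\<close>, and each of them contributes an independent Bernoulli
  variable, hence a factor of modulus at most \<open>1 - \<delta>\<close>. Averaging over \<open>U\<close> turns \<open>(1 - \<delta>)\<^bsup>|I U|\<^esup>\<close> into a
  product over \<open>X\<close>, because the neighbourhoods are disjoint.\<close>
theorem cf_decay:
  fixes t :: real
  assumes p: "0 < p" "p < 1" and B: "finite B" and t: "\<bar>t\<bar> \<le> pi"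
  shows "norm (bexp p B (\<lambda>S. iexp (t * num S))) \<le>
    exp (- (p * (1 - p) ^ (D + 1) / (18 * (real D + 1)\<^sup>2) * t\<^sup>2 * card B))"
proof -
  obtain X where X: "X \<subseteq> B" and sep: "\<And>x y. x \<in> X \<Longrightarrow> y \<in> X \<Longrightarrow> x \<noteq> y \<Longrightarrow> y \<notin> gball x 2"
    and card_X: "card B \<le> (D + 1)\<^sup>2 * card X"
    using separated_subset[OF B] by blast
  define Y where "Y = B - X"
  have fin: "finite X" "finite Y" and YX: "B = Y \<union> X" "Y \<inter> X = {}"
    using X B finite_subset by (auto simp: Y_def)
  define N where "N x = {y. adj x y}" for x
  have two: "z \<in> gball x 2" if "adj x y" "adj y z" for x y z
    using that by (auto simp: eval_nat_numeral gball.simps(2))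
  have one: "y \<in> gball x 2" if "adj x y" for x y
    using that by (auto simp: eval_nat_numeral gball.simps(2))
  have disjN: "N x \<inter> N y = {}" if "x \<in> X" "y \<in> X" "x \<noteq> y" for x y
    using sep[OF that] two[of x _ y] adj_sym by (auto simp: N_def)
  have nonadj: "\<not> adj x y" if "x \<in> X" "y \<in> X" for x y
    using sep[OF that] one[of x y] adj_irrefl by auto
  define I where "I U = {x \<in> X. U \<inter> N x = {}}" for U
  define \<delta> where "\<delta> = p * (1 - p) * t\<^sup>2 / 18"
  define z where "z = of_real (1 - p) + of_real p * iexp t"
  have \<delta>: "norm z \<le> 1 - \<delta>" "0 \<le> \<delta>" "\<delta> \<le> 1"
    using bernoulli_cf_bound[OF p t] p by (auto simp: z_def \<delta>_def)
  have inner: "norm (bexp p X (\<lambda>V. iexp (t * num (U \<union> V)))) \<le> (1 - \<delta>) ^ card (I U)" if U: "U \<subseteq> Y" for U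
  proof -
    have IX: "I U \<subseteq> X" "finite (I U)" "finite (X - I U)" "X = (X - I U) \<union> I U" using fin by (auto simp: I_def)
    have "bexp p X (\<lambda>V. iexp (t * num (U \<union> V))) =
      bexp p (X - I U) (\<lambda>V'. bexp p (I U) (\<lambda>V. iexp (t * num (U \<union> (V' \<union> V)))))"
      by (subst IX(4), rule bexp_union) (use IX(2,3) in auto)
    also have "norm \<dots> \<le> (1 - \<delta>) ^ card (I U)"
    proof (rule norm_bexp_le_const)
      fix V' assume V': "V' \<subseteq> X - I U"
      have "bexp p (I U) (\<lambda>V. iexp (t * num (U \<union> (V' \<union> V)))) =
        bexp p (I U) (\<lambda>V. iexp (t * num (U \<union> V')) * iexp t ^ card V)"
      proof (rule bexp_cong)
        fix V assume V: "V \<subseteq> I U"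
        have "num ((U \<union> V') \<union> V) = num (U \<union> V') + card V"
        proof (rule num_add_isolated)
          show "finite V" "finite (U \<union> V')" 
            using finite_subset[OF V IX(2)] finite_subset[OF U fin(2)] finite_subset[OF V' IX(3)] by auto
          show "V \<inter> (U \<union> V') = {}" using V V' U YX(2) IX(1) by blast
          fix x y assume "x \<in> V" "y \<in> V \<union> (U \<union> V')"
          then show "\<not> adj x y" using V V' nonadj[of x y] by (auto simp: I_def N_def)
        qed
        then have "iexp (t * num (U \<union> (V' \<union> V))) = exp (\<i> * of_real (t * num (U \<union> V')) + of_nat (card V) * (\<i> * of_real t))"
          unfolding Un_assoc[symmetric] by (intro arg_cong[where f = exp]) (simp add: algebra_simps)
        then show "iexp (t * num (U \<union> (V' \<union> V))) = iexp (t * num (U \<union> V')) * iexp t ^ card V"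
          by (simp only: exp_add exp_of_nat_mult)
      qed
      also have "\<dots> = iexp (t * num (U \<union> V')) * z ^ card (I U)"
        by (simp only: bexp_cmult bexp_card_power[OF IX(2)] z_def)
      also have "norm \<dots> = norm z ^ card (I U)" by (simp add: norm_mult norm_power)
      also have "\<dots> \<le> (1 - \<delta>) ^ card (I U)" using \<delta> by (intro power_mono) auto
      finally show "norm (bexp p (I U) (\<lambda>V. iexp (t * num (U \<union> (V' \<union> V))))) \<le> (1 - \<delta>) ^ card (I U)" .
    qed (use p IX(3) in auto)
    finally show ?thesis .
  qed
  have "norm (bexp p B (\<lambda>S. iexp (t * num S))) = norm (bexp p Y (\<lambda>U. bexp p X (\<lambda>V. iexp (t * num (U \<union> V)))))"
    unfolding YX(1) by (subst bexp_union) (use fin YX in auto)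
  also have "\<dots> \<le> bexp p Y (\<lambda>U. norm (bexp p X (\<lambda>V. iexp (t * num (U \<union> V)))))"
    using p by (intro norm_bexp_le) auto
  also have "\<dots> \<le> bexp p Y (\<lambda>U. \<Prod>x\<in>X. if U \<inter> N x = {} then 1 - \<delta> else 1)"
  proof (rule bexp_mono)
    fix U assume U: "U \<subseteq> Y"
    have "(\<Prod>x\<in>X. if U \<inter> N x = {} then 1 - \<delta> else 1) = (1 - \<delta>) ^ card (I U)"
      using fin by (simp add: prod.If_cases I_def Int_def)
    then show "norm (bexp p X (\<lambda>V. iexp (t * num (U \<union> V)))) \<le> (\<Prod>x\<in>X. if U \<inter> N x = {} then 1 - \<delta> else 1)"
      using inner[OF U] by simp
  qed (use p in auto)
  also have "\<dots> = (\<Prod>x\<in>X. bexp p Y (\<lambda>U. if U \<inter> N x = {} then 1 - \<delta> else 1))"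
    using fin disjN by (intro bexp_prod[where N = N]) (auto simp: Int_assoc)
  also have "\<dots> \<le> (\<Prod>x\<in>X. exp (- (\<delta> * (1 - p) ^ D)))"
  proof (rule prod_mono)
    fix x assume "x \<in> X"
    have "bexp p Y (\<lambda>U. if U \<inter> N x = {} then 1 - \<delta> else 1) = bexp p Y (\<lambda>U. 1 - \<delta> * (if U \<inter> N x = {} then 1 else 0))"
      by (intro bexp_cong) auto
    also have "\<dots> = 1 - \<delta> * (1 - p) ^ card (Y \<inter> N x)"
      using fin by (simp only: bexp_diff bexp_cmult bexp_no_open bexp_const)
    also have "\<dots> \<le> 1 - \<delta> * (1 - p) ^ D"
    proof -
      have "card (Y \<inter> N x) \<le> card (N x)" using finite_nbrs by (intro card_mono) (auto simp: N_def)
      then have "card (Y \<inter> N x) \<le> D" using card_nbrs[of x] by (simp add: N_def)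
      then have "(1 - p) ^ D \<le> (1 - p) ^ card (Y \<inter> N x)" using p by (intro power_decreasing) auto
      then show ?thesis using \<delta> by (simp add: mult_left_mono)
    qed
    also have "\<dots> \<le> exp (- (\<delta> * (1 - p) ^ D))" using exp_ge_add_one_self[of "- (\<delta> * (1 - p) ^ D)"] by simp
    finally have le: "bexp p Y (\<lambda>U. if U \<inter> N x = {} then 1 - \<delta> else 1) \<le> exp (- (\<delta> * (1 - p) ^ D))" .
    have "0 \<le> bexp p Y (\<lambda>U. if U \<inter> N x = {} then 1 - \<delta> else 1)"
      using p \<delta> by (intro bexp_nonneg) auto
    with le show "0 \<le> bexp p Y (\<lambda>U. if U \<inter> N x = {} then 1 - \<delta> else 1) \<and>
        bexp p Y (\<lambda>U. if U \<inter> N x = {} then 1 - \<delta> else 1) \<le> exp (- (\<delta> * (1 - p) ^ D))" by simp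
  qed
  also have "\<dots> = exp (- (\<delta> * (1 - p) ^ D) * card X)" by (simp add: exp_of_nat_mult[symmetric] mult.commute)
  also have "\<dots> \<le> exp (- (p * (1 - p) ^ (D + 1) / (18 * (real D + 1)\<^sup>2) * t\<^sup>2 * card B))"
  proof -
    let ?a = "p * (1 - p) ^ (D + 1) / 18 * t\<^sup>2"
    have "real (card B) \<le> real ((D + 1)\<^sup>2 * card X)" using card_X by (simp only: of_nat_le_iff)
    then have "card B / (real D + 1)\<^sup>2 \<le> card X" by (simp add: pos_divide_le_eq mult.commute add.commute)
    then have "?a * (card B / (real D + 1)\<^sup>2) \<le> ?a * card X" using p by (intro mult_left_mono) auto
    then show ?thesis by (simp add: \<delta>_def mult_ac)
  qed
  finally show ?thesis .
qed

end

context site_graph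
begin

lemma cf_std_decay:
  fixes u :: real
  assumes p: "0 < p" "p < 1" and B: "finite B" "B \<noteq> {}" and u: "\<bar>u\<bar> \<le> pi * sqrt (card B)"
  shows "norm (bexp p B (\<lambda>S. iexp (u * std_csum p B (\<lambda>_. 1) S))) \<le>
    exp (- (p * (1 - p) ^ (D + 1) / (18 * (real D + 1)\<^sup>2) * u\<^sup>2))"
proof -
  define r where "r = sqrt (card B)"
  have r: "0 < r" "r\<^sup>2 = card B" using B by (auto simp: r_def card_gt_0_iff)
  let ?m = "bexp p B num" and ?c = "p * (1 - p) ^ (D + 1) / (18 * (real D + 1)\<^sup>2)"
  have "iexp (u * std_csum p B (\<lambda>_. 1) S) = iexp (- (u / r * ?m)) * iexp (u / r * num S)" for S
  proof -
    have "u * std_csum p B (\<lambda>_. 1) S = - (u / r * ?m) + u / r * num S"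
      by (simp add: std_csum_def num_def r_def diff_divide_distrib right_diff_distrib)
    then show ?thesis unfolding exp_add[symmetric] distrib_left[symmetric] of_real_add[symmetric] by simp
  qed
  then have "norm (bexp p B (\<lambda>S. iexp (u * std_csum p B (\<lambda>_. 1) S))) = norm (bexp p B (\<lambda>S. iexp (u / r * num S)))"
    by (simp only: bexp_cmult norm_mult norm_exp_i_times mult_1_left)
  also have "\<dots> \<le> exp (- (?c * (u / r)\<^sup>2 * card B))"
  proof (rule cf_decay[OF p B(1)])
    show "\<bar>u / r\<bar> \<le> pi" using u r(1) by (simp add: r_def[symmetric] abs_divide pos_divide_le_eq)
  qed
  also have "?c * (u / r)\<^sup>2 * card B = ?c * u\<^sup>2" using r by (simp add: power_divide flip: r(2))
  finally show ?thesis .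
qed

end

context transitive_site_graph
begin

text \<open>The limit \<open>exp (- \<sigma>2 / 2)\<close> of the characteristic functions at 1 inherits a bound that is less than 1.\<close>
lemma variance_positive:
  assumes p: "0 < p" "p < 1" and B: "folner B"
    and card: "filterlim (\<lambda>n. real (card (B n))) at_top sequentially"
    and \<sigma>2: "(\<lambda>n. bvar p (B n) num / card (B n)) \<longlonglongrightarrow> \<sigma>2"
  shows "0 < \<sigma>2"
proof -
  let ?c = "p * (1 - p) ^ (D + 1) / (18 * (real D + 1)\<^sup>2)"
  have "(\<lambda>n. norm (bexp p (B n) (\<lambda>S. iexp (1 * std_csum p (B n) (\<lambda>_. 1) S)))) \<longlonglongrightarrow> norm (complex_of_real (exp (- (\<sigma>2 * 1\<^sup>2 / 2))))"
    by (intro tendsto_norm cf_limit[OF p B card \<sigma>2])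
  moreover have "norm (bexp p (B n) (\<lambda>S. iexp (1 * std_csum p (B n) (\<lambda>_. 1) S))) \<le> exp (- (?c * 1\<^sup>2))" for n
  proof (rule cf_std_decay[OF p])
    show Bn: "finite (B n)" "B n \<noteq> {}" using B by (auto simp: folner_def)
    have "1 \<le> sqrt (card (B n))" using Bn by (simp add: Suc_le_eq card_gt_0_iff)
    moreover have "1 \<le> pi" using pi_ge_two by linarith
    ultimately show "\<bar>1\<bar> \<le> pi * sqrt (card (B n))" using mult_mono[of 1 pi 1 "sqrt (card (B n))"] by simp
  qed
  ultimately have "norm (complex_of_real (exp (- (\<sigma>2 * 1\<^sup>2 / 2)))) \<le> exp (- (?c * 1\<^sup>2))"
    by (intro LIMSEQ_le_const2) auto
  then have "?c \<le> \<sigma>2 / 2" by (simp only: norm_of_real) simp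
  moreover have "0 < ?c" using p by (intro divide_pos_pos mult_pos_pos zero_less_power) auto
  ultimately show ?thesis by linarith
qed

end

section \<open>Fourier inversion and the local limit\<close>
lemma std_normal_fourier:
  "(\<integral>x. std_normal_density x *\<^sub>R iexp (t * x) \<partial>lborel) = of_real (exp (- (t\<^sup>2 / 2)))"
proof -
  have "char std_normal_distribution t = of_real (exp (- (t\<^sup>2) / 2))"
    by (simp add: char_std_normal_distribution)
  then show ?thesis
    unfolding char_def by (subst (asm) integral_density) auto
qed

lemma scaled_normal_fourier:
  assumes \<sigma>: "0 < \<sigma>"
  shows "\<sigma> *\<^sub>R (\<integral>x. std_normal_density (\<sigma> * x) *\<^sub>R iexp (t * (\<sigma> * x)) \<partial>lborel) = of_real (exp (- (t\<^sup>2 / 2)))"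
  using lborel_integral_real_affine[of \<sigma> "\<lambda>x. std_normal_density x *\<^sub>R iexp (t * x)" 0] \<sigma>
  unfolding std_normal_fourier by simp

lemma gaussian_fourier:
  assumes \<sigma>: "0 < \<sigma>"
  shows "(\<integral>u. exp (- (\<sigma>\<^sup>2 * u\<^sup>2 / 2)) *\<^sub>R iexp (- (u * y)) \<partial>lborel) =
    of_real (2 * pi / \<sigma> * std_normal_density (y / \<sigma>))"
proof -
  define G where "G = (\<integral>u. exp (- (\<sigma>\<^sup>2 * u\<^sup>2 / 2)) *\<^sub>R iexp (- (u * y)) \<partial>lborel)"
  let ?s = "sqrt (2 * pi)"
  have pw: "std_normal_density (\<sigma> * u) *\<^sub>R iexp (- (y / \<sigma>) * (\<sigma> * u)) =
     (1 / ?s) *\<^sub>R (exp (- (\<sigma>\<^sup>2 * u\<^sup>2 / 2)) *\<^sub>R iexp (- (u * y)))" for u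
    using \<sigma> by (simp add: std_normal_density_def power_mult_distrib mult.commute)
  have "\<sigma> *\<^sub>R (1 / ?s) *\<^sub>R G = of_real (exp (- ((- (y / \<sigma>))\<^sup>2 / 2)))"
    using scaled_normal_fourier[OF \<sigma>, of "- (y / \<sigma>)"] unfolding G_def pw integral_scaleR_right .
  then have "of_real (\<sigma> / ?s) * G = of_real (exp (- ((y / \<sigma>)\<^sup>2 / 2)))"
    by (simp add: scaleR_conv_of_real)
  then have "of_real (?s / \<sigma>) * (of_real (\<sigma> / ?s) * G) = of_real (?s / \<sigma> * exp (- ((y / \<sigma>)\<^sup>2 / 2)))"
    by (simp only: of_real_mult)
  moreover have "of_real (?s / \<sigma>) * (of_real (\<sigma> / ?s) * G) = of_real (?s / \<sigma> * (\<sigma> / ?s)) * G"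
    by (simp only: of_real_mult mult.assoc)
  moreover have "?s / \<sigma> * (\<sigma> / ?s) = 1" using \<sigma> by simp
  ultimately have "G = of_real (?s / \<sigma> * exp (- ((y / \<sigma>)\<^sup>2 / 2)))" by simp
  moreover have "?s / \<sigma> * exp (- ((y / \<sigma>)\<^sup>2 / 2)) = 2 * pi / \<sigma> * std_normal_density (y / \<sigma>)"
  proof -
    have "2 * pi / ?s = ?s" by (rule real_div_sqrt) simp
    moreover have "2 * pi / \<sigma> * (1 / ?s) = 2 * pi / ?s / \<sigma>" by (simp add: mult.commute)
    ultimately have eq: "2 * pi / \<sigma> * (1 / ?s) = ?s / \<sigma>" by (simp only:)
    have "std_normal_density z = 1 / ?s * exp (- (z\<^sup>2 / 2))" for z
      by (simp add: std_normal_density_def)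
    then show ?thesis by (simp only: mult.assoc[symmetric] eq)
  qed
  ultimately show ?thesis unfolding G_def by (simp only:)
qed

lemma char_normal:
  assumes \<sigma>: "0 < \<sigma>"
  shows "char (density lborel (normal_density 0 \<sigma>)) t = of_real (exp (- (\<sigma>\<^sup>2 * t\<^sup>2 / 2)))"
proof -
  have "char (density lborel (normal_density 0 \<sigma>)) t = (\<integral>x. normal_density 0 \<sigma> x *\<^sub>R iexp (t * x) \<partial>lborel)"
    unfolding char_def by (subst integral_density) auto
  also have "\<dots> = \<sigma> *\<^sub>R (\<integral>x. normal_density 0 \<sigma> (\<sigma> * x) *\<^sub>R iexp (t * (\<sigma> * x)) \<partial>lborel)"
    using lborel_integral_real_affine[of \<sigma> "\<lambda>x. normal_density 0 \<sigma> x *\<^sub>R iexp (t * x)" 0] \<sigma> by simp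
  also have "\<dots> = (\<integral>x. std_normal_density x *\<^sub>R iexp ((\<sigma> * t) * x) \<partial>lborel)"
  proof -
    have "\<sigma> *\<^sub>R (normal_density 0 \<sigma> (\<sigma> * x) *\<^sub>R iexp (t * (\<sigma> * x))) = std_normal_density x *\<^sub>R iexp ((\<sigma> * t) * x)" for x
    proof -
      have nd: "\<sigma> * normal_density 0 \<sigma> (\<sigma> * x) = std_normal_density x"
        using \<sigma> by (simp add: normal_density_def real_sqrt_mult power_mult_distrib field_simps)
      show ?thesis unfolding scaleR_scaleR nd by (simp add: mult_ac)
    qed
    then show ?thesis by (simp only: integral_scaleR_right[symmetric])
  qed
  also have "\<dots> = of_real (exp (- (\<sigma>\<^sup>2 * t\<^sup>2 / 2)))"
    unfolding std_normal_fourier by (simp add: power_mult_distrib)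
  finally show ?thesis .
qed

lemma integrable_gaussian:
  assumes "0 < (c::real)"
  shows "integrable lborel (\<lambda>u. exp (- (c * u\<^sup>2)))"
proof -
  define s where "s = sqrt (1 / (2 * c))"
  have s: "0 < s" "s\<^sup>2 = 1 / (2 * c)" using assms by (auto simp: s_def)
  have "integrable lborel (\<lambda>u. sqrt (2 * pi * s\<^sup>2) * normal_density 0 s u)"
    using s by (intro integrable_mult_right integrable_normal_density)
  moreover have "sqrt (2 * pi * s\<^sup>2) * normal_density 0 s u = exp (- (c * u\<^sup>2))" for u
    using s(1) assms by (simp add: normal_density_def s(2))
  ultimately show ?thesis by simp
qed

lemma iexp_orthogonal:
  assumes r: "0 < r"
  shows "(\<integral>u. indicator {- pi * r..pi * r} u *\<^sub>R iexp (u * (of_int l / r)) \<partial>lborel) = of_real (if l = 0 then 2 * pi * r else 0)"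
proof (cases "l = 0")
  case True
  have "(\<integral>u. indicator {- pi * r..pi * r} u *\<^sub>R (1 :: complex) \<partial>lborel) = of_real (2 * pi * r)"
    using r by (simp add: scaleR_conv_of_real)
  then show ?thesis using True by simp
next
  case False
  define k where "k = of_int l / r"
  have k: "k \<noteq> 0" using False r by (simp add: k_def)
  define F where "F u = iexp (u * k) / (\<i> * of_real k)" for u
  have "(\<integral>u. indicator {- pi * r..pi * r} u *\<^sub>R iexp (u * k) \<partial>lborel) = F (pi * r) - F (- pi * r)"
  proof (rule integral_FTC_Icc)
    show "- pi * r \<le> pi * r" using r by simp
    fix u
    have "((\<lambda>u. u * k) has_vector_derivative k) (at u)" by (auto intro!: derivative_eq_intros)
    from vector_diff_chain_at[OF this has_vector_derivative_iexp]
    have "((\<lambda>u. iexp (u * k)) has_vector_derivative (of_real k * (\<i> * iexp (u * k)))) (at u)"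
      by (simp add: o_def scaleR_conv_of_real)
    from has_vector_derivative_divide[OF this, of "\<i> * of_real k"]
    have "(F has_vector_derivative iexp (u * k)) (at u)"
      unfolding F_def using k by simp
    then show "(F has_vector_derivative iexp (u * k)) (at u within {- pi * r..pi * r})"
      by (rule has_vector_derivative_at_within)
  qed (intro continuous_intros)
  also have "\<dots> = 0"
  proof -
    have *: "pi * r * k = pi * of_int l" "- pi * r * k = - (pi * of_int l)" using r by (auto simp: k_def)
    have "iexp (pi * of_int l) = iexp (- (pi * of_int l))"
      by (simp only: cis_conv_exp[symmetric]) (simp add: complex_eq_iff sin_npi_int mult.commute)
    then show ?thesis unfolding F_def * by simp
  qed
  finally show ?thesis using False by (simp add: k_def)
qed

text \<open>The inversion integrals for \<open>r n * P n j\<close> and for the Gaussian density differ by at most the \<open>L\<^sup>1\<close> distance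
  of the two Fourier transforms, which does not depend on \<open>j\<close>. It tends to 0 by dominated convergence.\<close>
lemma local_limit:
  fixes \<phi> :: "nat \<Rightarrow> real \<Rightarrow> complex" and r m :: "nat \<Rightarrow> real" and P :: "nat \<Rightarrow> int \<Rightarrow> real"
  assumes \<sigma>: "0 < \<sigma>" and c: "0 < c" and r_pos: "\<And>n. 0 < r n" and r: "filterlim r at_top sequentially"
    and meas: "\<And>n. \<phi> n \<in> borel_measurable borel"
    and inversion: "\<And>n j. of_real (r n * P n j) = of_real (1 / (2 * pi)) *
       (\<integral>u. indicator {- pi * r n..pi * r n} u *\<^sub>R (iexp (- (u * ((of_int j - m n) / r n))) * \<phi> n u) \<partial>lborel)"
    and bound: "\<And>n u. \<bar>u\<bar> \<le> pi * r n \<Longrightarrow> norm (\<phi> n u) \<le> exp (- (c * u\<^sup>2))"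
    and lim: "\<And>u. (\<lambda>n. \<phi> n u) \<longlonglongrightarrow> of_real (exp (- (\<sigma>\<^sup>2 * u\<^sup>2 / 2)))"
  shows "(\<lambda>n. SUP j. \<bar>r n * P n j - 1 / \<sigma> * std_normal_density ((of_int j - m n) / (\<sigma> * r n))\<bar>) \<longlonglongrightarrow> 0"
proof -
  let ?e = "\<lambda>n j. \<bar>r n * P n j - 1 / \<sigma> * std_normal_density ((of_int j - m n) / (\<sigma> * r n))\<bar>"
  define g where "g u = exp (- (\<sigma>\<^sup>2 * u\<^sup>2 / 2))" for u
  define I where "I n = {- pi * r n..pi * r n}" for n
  define \<psi> where "\<psi> n u = indicator (I n) u *\<^sub>R \<phi> n u - of_real (g u)" for n u
  define w where "w u = exp (- (c * u\<^sup>2)) + g u" for u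
  define \<epsilon> where "\<epsilon> n = 1 / (2 * pi) * (\<integral>u. norm (\<psi> n u) \<partial>lborel)" for n
  note meas[measurable]
  have [measurable]: "I n \<in> sets borel" for n by (simp add: I_def)
  have [measurable]: "g \<in> borel_measurable borel" unfolding g_def by measurable
  have int_g: "integrable lborel g"
    using integrable_gaussian[of "\<sigma>\<^sup>2 / 2"] \<sigma> by (simp add: g_def[abs_def])
  have int_w: "integrable lborel w" unfolding w_def using int_g integrable_gaussian[OF c] by simp
  have meas_\<psi>[measurable]: "\<psi> n \<in> borel_measurable borel" for n unfolding \<psi>_def by measurable
  have ind_le: "norm (indicator (I n) u *\<^sub>R \<phi> n u) \<le> exp (- (c * u\<^sup>2))" for n u
    using bound[of u n] by (auto simp: I_def abs_le_iff split: split_indicator)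
  have g_pos: "0 \<le> g u" for u by (simp add: g_def)
  have \<psi>_le: "norm (\<psi> n u) \<le> w u" for n u
    using norm_triangle_ineq4[of "indicator (I n) u *\<^sub>R \<phi> n u" "of_real (g u)"] ind_le[of n u] g_pos[of u]
    unfolding \<psi>_def w_def by (simp add: norm_of_real)
  have \<epsilon>_lim: "\<epsilon> \<longlonglongrightarrow> 0"
  proof -
    have "(\<lambda>n. \<integral>u. norm (\<psi> n u) \<partial>lborel) \<longlonglongrightarrow> (\<integral>u. 0 \<partial>(lborel :: real measure))"
    proof (rule integral_dominated_convergence[where w = w])
      show "AE u in lborel. (\<lambda>n. norm (\<psi> n u)) \<longlonglongrightarrow> 0"
      proof (rule AE_I2)
        fix u :: real
        have "\<forall>\<^sub>F n in sequentially. \<bar>u\<bar> \<le> r n" using r by (simp add: filterlim_at_top)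
        then have "\<forall>\<^sub>F n in sequentially. \<phi> n u - of_real (g u) = \<psi> n u"
        proof eventually_elim
          case (elim n)
          have "r n \<le> pi * r n" using r_pos[of n] pi_ge_two by simp
          then have "u \<in> I n" using elim by (auto simp: I_def)
          then show ?case by (simp add: \<psi>_def)
        qed
        moreover have "(\<lambda>n. \<phi> n u - of_real (g u)) \<longlonglongrightarrow> of_real (g u) - of_real (g u)"
          using lim[of u] unfolding g_def by (intro tendsto_diff tendsto_const)
        ultimately have "(\<lambda>n. \<psi> n u) \<longlonglongrightarrow> 0" by (simp add: tendsto_cong)
        then show "(\<lambda>n. norm (\<psi> n u)) \<longlonglongrightarrow> 0" by (rule tendsto_norm_zero)
      qed
    qed (use int_w \<psi>_le in auto)
    then have "\<epsilon> \<longlonglongrightarrow> 1 / (2 * pi) * 0" unfolding \<epsilon>_def by (intro tendsto_mult tendsto_const) simp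
    then show ?thesis by simp
  qed
  have le: "?e n j \<le> \<epsilon> n" for n j
  proof -
    define y where "y = (of_int j - m n) / r n"
    define A where "A u = indicator (I n) u *\<^sub>R (iexp (- (u * y)) * \<phi> n u)" for u
    define G where "G u = g u *\<^sub>R iexp (- (u * y))" for u
    have [measurable]: "A \<in> borel_measurable borel" "G \<in> borel_measurable borel"
      unfolding A_def G_def by measurable
    have "norm (A u) \<le> exp (- (c * u\<^sup>2))" for u
      using ind_le[of n u] by (simp add: A_def norm_mult)
    then have int_A: "integrable lborel A"
      by (intro Bochner_Integration.integrable_bound[OF integrable_gaussian[OF c]]) auto
    have int_G: "integrable lborel G"
      by (intro Bochner_Integration.integrable_bound[OF int_g]) (auto simp: G_def g_pos)
    have "of_real (r n * P n j - 1 / \<sigma> * std_normal_density (y / \<sigma>)) =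
       of_real (1 / (2 * pi)) * ((\<integral>u. A u \<partial>lborel) - (\<integral>u. G u \<partial>lborel))"
    proof -
      have "(\<integral>u. G u \<partial>lborel) = of_real (2 * pi / \<sigma> * std_normal_density (y / \<sigma>))"
        unfolding G_def g_def by (rule gaussian_fourier[OF \<sigma>])
      moreover have "of_real (r n * P n j) = of_real (1 / (2 * pi)) * (\<integral>u. A u \<partial>lborel)"
        unfolding A_def I_def y_def by (rule inversion)
      moreover have "1 / \<sigma> * std_normal_density (y / \<sigma>) = 1 / (2 * pi) * (2 * pi / \<sigma> * std_normal_density (y / \<sigma>))"
        by simp
      ultimately show ?thesis by (simp only: of_real_diff of_real_mult right_diff_distrib)
    qed
    also have "(\<integral>u. A u \<partial>lborel) - (\<integral>u. G u \<partial>lborel) = (\<integral>u. iexp (- (u * y)) * \<psi> n u \<partial>lborel)"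
    proof -
      have "A u - G u = iexp (- (u * y)) * \<psi> n u" for u
        by (simp add: A_def G_def \<psi>_def scaleR_conv_of_real algebra_simps)
      then show ?thesis using int_A int_G by (simp add: Bochner_Integration.integral_diff[symmetric])
    qed
    finally have "norm (complex_of_real (r n * P n j - 1 / \<sigma> * std_normal_density (y / \<sigma>))) =
       1 / (2 * pi) * norm (\<integral>u. iexp (- (u * y)) * \<psi> n u \<partial>lborel)" by (simp add: norm_mult norm_divide)
    also have "\<dots> \<le> 1 / (2 * pi) * (\<integral>u. norm (iexp (- (u * y)) * \<psi> n u) \<partial>lborel)"
      by (intro mult_left_mono integral_norm_bound) simp
    also have "\<dots> = \<epsilon> n" by (simp add: \<epsilon>_def norm_mult)
    finally have "\<bar>r n * P n j - 1 / \<sigma> * std_normal_density (y / \<sigma>)\<bar> \<le> \<epsilon> n" by (simp only: norm_of_real)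
    moreover have "y / \<sigma> = (of_int j - m n) / (\<sigma> * r n)" by (simp add: y_def mult.commute)
    ultimately show ?thesis by simp
  qed
  show ?thesis
  proof (rule tendsto_sandwich[OF _ _ tendsto_const \<epsilon>_lim])
    have bdd: "bdd_above (range (\<lambda>j. ?e n j))" for n
      using le[of n] by (intro bdd_aboveI2)
    show "\<forall>\<^sub>F n in sequentially. 0 \<le> (SUP j. ?e n j)"
      using cSUP_upper[OF UNIV_I bdd] by (intro always_eventually allI) (rule order_trans[OF abs_ge_zero])
    show "\<forall>\<^sub>F n in sequentially. (SUP j. ?e n j) \<le> \<epsilon> n"
      using le by (intro always_eventually allI cSUP_least) auto
  qed
qed

lemma bexp_integral:
  fixes f :: "'v set \<Rightarrow> 'b \<Rightarrow> complex"
  assumes "\<And>S. S \<subseteq> B \<Longrightarrow> integrable M (f S)"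
  shows "(\<integral>u. bexp p B (\<lambda>S. f S u) \<partial>M) = bexp p B (\<lambda>S. \<integral>u. f S u \<partial>M)"
  unfolding bexp_def using assms by (subst Bochner_Integration.integral_sum) auto

text \<open>The centring \<open>m\<close> cancels, and only the configurations with \<open>N S = j\<close> survive integration over the period.\<close>
lemma bexp_inversion:
  fixes N :: "'v set \<Rightarrow> nat" and m :: real
  assumes r: "0 < r" and B: "finite B"
  shows "of_real (r * bexp p B (\<lambda>S. if int (N S) = j then 1 else 0)) = of_real (1 / (2 * pi)) *
    (\<integral>u. indicator {- pi * r..pi * r} u *\<^sub>R
      (iexp (- (u * ((of_int j - m) / r))) * bexp p B (\<lambda>S. iexp (u * ((real (N S) - m) / r)))) \<partial>lborel)"
proof -
  define f where "f S u = indicator {- pi * r..pi * r} u *\<^sub>R iexp (u * (of_int (int (N S) - j) / r))" for S u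
  have eq: "indicator {- pi * r..pi * r} u *\<^sub>R
      (iexp (- (u * ((of_int j - m) / r))) * bexp p B (\<lambda>S. iexp (u * ((real (N S) - m) / r)))) = bexp p B (\<lambda>S. f S u)" for u
  proof -
    have "iexp (- (u * ((of_int j - m) / r))) * iexp (u * ((real (N S) - m) / r)) = iexp (u * (of_int (int (N S) - j) / r))" for S
    proof -
      have "- (u * ((of_int j - m) / r)) + u * ((real (N S) - m) / r) = u * (of_int (int (N S) - j) / r)"
        by (simp add: diff_divide_distrib right_diff_distrib)
      then show ?thesis unfolding exp_add[symmetric] distrib_left[symmetric] of_real_add[symmetric] by simp
    qed
    then show ?thesis unfolding f_def bexp_cmult[symmetric] scaleR_conv_of_real by simp
  qed
  have "integrable lborel (f S)" for S
  proof -
    have "set_integrable lborel {- pi * r..pi * r} (\<lambda>u. iexp (u * (of_int (int (N S) - j) / r)))"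
      by (intro borel_integrable_atLeastAtMost' continuous_intros)
    then show ?thesis by (simp add: f_def[abs_def] set_integrable_def)
  qed
  then have "(\<integral>u. bexp p B (\<lambda>S. f S u) \<partial>lborel) = bexp p B (\<lambda>S. \<integral>u. f S u \<partial>lborel)"
    by (rule bexp_integral)
  also have "\<dots> = bexp p B (\<lambda>S. of_real (2 * pi * r * (if int (N S) = j then 1 else 0)))"
    unfolding f_def iexp_orthogonal[OF r] by (intro bexp_cong arg_cong[where f = of_real]) auto
  also have "\<dots> = of_real (2 * pi * r * bexp p B (\<lambda>S. if int (N S) = j then 1 else 0))"
    by (simp only: bexp_of_real bexp_cmult)
  finally show ?thesis unfolding eq by simp
qed

lemma borel_measurable_bexp_iexp: "(\<lambda>u. bexp p B (\<lambda>S. iexp (u * a S))) \<in> borel_measurable borel"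
  unfolding bexp_def by (intro borel_measurable_continuous_onI continuous_intros)

section \<open>Site percolation on the lattice\<close>
lemma measurable_open_site: "(\<lambda>\<omega>. \<omega> x) \<in> measurable (site_percolation p) (count_space UNIV)"
proof -
  have "(\<lambda>\<omega>. \<omega> x) \<in> measurable (site_percolation p) (measure_pmf (bernoulli_pmf p))"
    unfolding site_percolation_def by (rule measurable_component_singleton) simp
  then show ?thesis by simp
qed

lemma space_site_percolation: "space (site_percolation p) = UNIV"
  by (simp add: site_percolation_def space_PiM)

lemma sets_open_sites_eq:
  assumes "finite B"
  shows "{\<omega>. open_sites B \<omega> = S} \<in> sets (site_percolation p)"
proof (cases "S \<subseteq> B")
  case True
  have "{\<omega> \<in> space (site_percolation p). \<forall>x\<in>B. \<omega> x = (x \<in> S)} \<in> sets (site_percolation p)"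
  proof (rule sets.sets_Collect_finite_All[OF _ assms])
    fix x
    have "(\<lambda>\<omega>. \<omega> x) -` {x \<in> S} \<inter> space (site_percolation p) \<in> sets (site_percolation p)"
      by (rule measurable_sets[OF measurable_open_site]) simp
    then show "{\<omega> \<in> space (site_percolation p). \<omega> x = (x \<in> S)} \<in> sets (site_percolation p)"
      by (simp add: vimage_def Int_def conj_commute)
  qed
  moreover have "{\<omega> \<in> space (site_percolation p). \<forall>x\<in>B. \<omega> x = (x \<in> S)} = {\<omega>. open_sites B \<omega> = S}"
    using True by (auto simp: space_site_percolation open_sites_def)
  ultimately show ?thesis by simp
next
  case False
  then have "{\<omega>. open_sites B \<omega> = S} = {}" by (auto simp: open_sites_def)
  then show ?thesis by simp
qed

lemma measure_open_sites_eq: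
  fixes B :: "(int ^ 'd) set"
  assumes p: "0 \<le> p" "p \<le> 1" and B: "finite B" and S: "S \<subseteq> B"
  shows "measure (site_percolation p) {\<omega>. open_sites B \<omega> = S} = p ^ card S * (1 - p) ^ card (B - S)"
proof -
  interpret product_prob_space "\<lambda>_. measure_pmf (bernoulli_pmf p)" "UNIV :: (int ^ 'd) set"
    by unfold_locales
  have "{\<omega>. open_sites B \<omega> = S} = prod_emb UNIV (\<lambda>_. measure_pmf (bernoulli_pmf p)) B (Pi\<^sub>E B (\<lambda>x. {x \<in> S}))"
    using S by (auto simp: prod_emb_def open_sites_def PiE_iff restrict_def)
  then have "measure (site_percolation p) {\<omega>. open_sites B \<omega> = S} = (\<Prod>x\<in>B. measure (measure_pmf (bernoulli_pmf p)) {x \<in> S})"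
    unfolding site_percolation_def using B by (simp add: measure_PiM_emb)
  also have "\<dots> = (\<Prod>x\<in>B. if x \<in> S then p else 1 - p)"
    using p by (intro prod.cong refl) (simp add: measure_pmf_single)
  also have "\<dots> = p ^ card S * (1 - p) ^ card (B - S)"
  proof -
    have "B \<inter> S = S" "B \<inter> - S = B - S" using S by auto
    then show ?thesis using B by (simp add: prod.If_cases)
  qed
  finally show ?thesis .
qed

lemma integral_site_percolation:
  fixes F :: "(int ^ 'd) set \<Rightarrow> 'a :: {real_normed_field, banach, second_countable_topology}"
  assumes p: "0 \<le> p" "p \<le> 1" and B: "finite B"
  shows "(\<integral>\<omega>. F (open_sites B \<omega>) \<partial>site_percolation p) = bexp p B F"
proof -
  interpret prob_space "site_percolation p :: (int ^ 'd \<Rightarrow> bool) measure" by (rule prob_space_site_percolation)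
  let ?A = "\<lambda>S. {\<omega>. open_sites B \<omega> = S}"
  have "F (open_sites B \<omega>) = (\<Sum>S\<in>Pow B. indicator (?A S) \<omega> *\<^sub>R F S)" for \<omega>
  proof -
    have "(\<Sum>S\<in>Pow B. indicator (?A S) \<omega> *\<^sub>R F S) = (\<Sum>S\<in>Pow B. if S = open_sites B \<omega> then F S else 0)"
      by (intro sum.cong) (auto simp: indicator_def)
    then show ?thesis using B by (auto simp: open_sites_def)
  qed
  then have "(\<integral>\<omega>. F (open_sites B \<omega>) \<partial>site_percolation p) =
      (\<integral>\<omega>. (\<Sum>S\<in>Pow B. indicator (?A S) \<omega> *\<^sub>R F S) \<partial>site_percolation p)" by simp
  also have "\<dots> = (\<Sum>S\<in>Pow B. (\<integral>\<omega>. indicator (?A S) \<omega> *\<^sub>R F S \<partial>site_percolation p))"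
    using sets_open_sites_eq[OF B]
    by (intro Bochner_Integration.integral_sum integrable_scaleR_left integrable_real_indicator) (auto simp: emeasure_eq_measure)
  also have "\<dots> = bexp p B F"
    unfolding bexp_def
  proof (rule sum.cong)
    fix S assume "S \<in> Pow B"
    then have "measure (site_percolation p) (?A S) = p ^ card S * (1 - p) ^ card (B - S)"
      using p B by (intro measure_open_sites_eq) auto
    moreover have "(\<integral>\<omega>. indicator (?A S) \<omega> *\<^sub>R F S \<partial>site_percolation p) = measure (site_percolation p) (?A S) *\<^sub>R F S"
      using sets_open_sites_eq[OF B, of S p] 
      by (subst integral_scaleR_left) (auto simp: emeasure_eq_measure space_site_percolation)
    ultimately show "(\<integral>\<omega>. indicator (?A S) \<omega> *\<^sub>R F S \<partial>site_percolation p) = (p ^ card S * (1 - p) ^ card (B - S)) *\<^sub>R F S"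
      by simp
  qed simp
  finally show ?thesis .
qed

lemma lattice_adj_iff_norm: "lattice_adj x y \<longleftrightarrow> norm ((\<chi> i. real_of_int ((x - y) $ i)) :: real ^ 'd) = 1"
  for x y :: "int ^ 'd"
proof -
  have "(\<chi> i. real_of_int (x $ i)) - (\<chi> i. real_of_int (y $ i)) = ((\<chi> i. real_of_int ((x - y) $ i)) :: real ^ 'd)"
    by (simp add: vec_eq_iff)
  then show ?thesis by (simp add: lattice_adj_def dist_norm)
qed

lemma lattice_nbrs_subset:
  "{y. lattice_adj x y} \<subseteq> (\<lambda>f. \<chi> i. x $ i + f i) ` (Pi\<^sub>E UNIV (\<lambda>_. {-1, 0, 1}))" for x :: "int ^ 'd"
proof
  fix y assume "y \<in> {y. lattice_adj x y}"
  then have n: "norm ((\<chi> i. real_of_int ((x - y) $ i)) :: real ^ 'd) = 1" by (simp add: lattice_adj_iff_norm)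
  have "\<bar>x $ i - y $ i\<bar> \<le> 1" for i
  proof -
    have "\<bar>((\<chi> i. real_of_int ((x - y) $ i)) :: real ^ 'd) $ i\<bar> \<le> 1"
      using component_le_norm_cart[of "(\<chi> i. real_of_int ((x - y) $ i)) :: real ^ 'd" i] n by simp
    then have "\<bar>real_of_int (x $ i - y $ i)\<bar> \<le> 1" by simp
    then show ?thesis by linarith
  qed
  then have "y $ i - x $ i \<in> {-1, 0, 1}" for i by (smt (verit) insertCI)
  then have "(\<lambda>i. y $ i - x $ i) \<in> Pi\<^sub>E UNIV (\<lambda>_. {-1, 0, 1})" by (auto simp: PiE_iff)
  moreover have "y = (\<chi> i. x $ i + (y $ i - x $ i))" by (simp add: vec_eq_iff)
  ultimately show "y \<in> (\<lambda>f. \<chi> i. x $ i + f i) ` (Pi\<^sub>E UNIV (\<lambda>_. {-1, 0, 1}))"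
    by (intro image_eqI[where x = "\<lambda>i. y $ i - x $ i"])
qed

text \<open>Adjacent sites differ by at most 1 in each coordinate, which gives the crude degree bound \<open>3\<^bsup>d\<^esup>\<close>; translations
  make the lattice transitive.\<close>
interpretation lattice: transitive_site_graph "lattice_adj :: int ^ 'd \<Rightarrow> int ^ 'd \<Rightarrow> bool" "3 ^ CARD('d::finite)"
proof
  fix x y :: "int ^ 'd"
  show "lattice_adj x y \<Longrightarrow> lattice_adj y x" by (simp add: lattice_adj_def dist_commute)
  show "\<not> lattice_adj x x" by (simp add: lattice_adj_def)
  let ?F = "Pi\<^sub>E UNIV (\<lambda>_ :: 'd. {-1, 0, 1 :: int})"
  have fin: "finite ?F" by (intro finite_PiE) auto
  have card: "card ?F = 3 ^ CARD('d)" by (simp add: card_PiE numeral_3_eq_3)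
  show "finite {y. lattice_adj x y}"
    using finite_subset[OF lattice_nbrs_subset[of x]] fin by auto
  have "card {y. lattice_adj x y} \<le> card ((\<lambda>f. \<chi> i. x $ i + f i) ` ?F)"
    using lattice_nbrs_subset[of x] fin by (intro card_mono) auto
  also have "\<dots> \<le> 3 ^ CARD('d)" using card_image_le[OF fin] card by simp
  finally show "card {y. lattice_adj x y} \<le> 3 ^ CARD('d)" .
  show "1 \<le> (3::nat) ^ CARD('d)" by simp
  show "\<exists>\<tau>. bij \<tau> \<and> (\<forall>a b. lattice_adj (\<tau> a) (\<tau> b) = lattice_adj a b) \<and> \<tau> x = y"
  proof (intro exI conjI allI)
    show "bij (\<lambda>a. a + (y - x))" by (rule bij_plus_right)
    show "lattice_adj (a + (y - x)) (b + (y - x)) = lattice_adj a b" for a b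
      by (simp add: lattice_adj_iff_norm)
    show "x + (y - x) = y" by simp
  qed
qed

lemma num_clusters_eq: "num_clusters B \<omega> = card (lattice.clusters (open_sites B \<omega>))"
proof -
  have "open_edges B \<omega> = lattice.edges (open_sites B \<omega>)"
    by (simp add: open_edges_def lattice.edges_def)
  then have "open_clusters B \<omega> = lattice.clusters (open_sites B \<omega>)"
    by (auto simp: open_clusters_def lattice.clusters_def lattice.cluster_def quotient_def)
  then show ?thesis by (simp add: num_clusters_def)
qed

lemma real_num_clusters: "real (num_clusters B \<omega>) = lattice.num (open_sites B \<omega>)"
  by (simp add: num_clusters_eq lattice.num_eq)

lemma infinite_lattice: "infinite (UNIV :: (int ^ 'd::finite) set)"
proof -
  have "inj (\<lambda>k::int. (\<chi> i. k) :: int ^ 'd)" by (auto simp: inj_def vec_eq_iff)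
  then have "infinite (range (\<lambda>k::int. (\<chi> i. k) :: int ^ 'd))" using infinite_UNIV_int finite_imageD by blast
  then show ?thesis by (rule infinite_super[OF subset_UNIV])
qed

text \<open>Any \<open>N\<close> given points eventually all belong to \<open>B m\<close>.\<close>
lemma card_at_top_of_liminf:
  fixes B :: "nat \<Rightarrow> 'a set"
  assumes inf: "infinite (UNIV :: 'a set)" and fin: "\<And>n. 1 \<le> n \<Longrightarrow> finite (B n)" and lim: "set_liminf B = UNIV"
  shows "filterlim (\<lambda>n. real (card (B n))) at_top sequentially"
proof (rule filterlim_compose[OF filterlim_real_sequentially], unfold filterlim_at_top, rule allI)
  fix N
  obtain A :: "'a set" where A: "finite A" "card A = N" using infinite_arbitrarily_large[OF inf] by blast
  have "\<forall>\<^sub>F m in sequentially. x \<in> B m" for x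
  proof -
    have "x \<in> set_liminf B" using lim by simp
    then obtain n where "\<And>m. n \<le> m \<Longrightarrow> x \<in> B m" by (auto simp: set_liminf_def)
    then show ?thesis by (auto simp: eventually_sequentially)
  qed
  then have "\<forall>\<^sub>F m in sequentially. \<forall>x\<in>A. x \<in> B m" using A(1) by (simp add: eventually_ball_finite)
  then show "\<forall>\<^sub>F m in sequentially. N \<le> card (B m)"
    using eventually_ge_at_top[of 1]
  proof eventually_elim
    case (elim m)
    then show ?case using card_mono[OF fin, of m A] A(2) by auto
  qed
qed

lemma weak_conv_m_shift:
  assumes "weak_conv_m (\<lambda>n. M (Suc n)) M'"
  shows "weak_conv_m M M'"
  unfolding weak_conv_m_def weak_conv_def
proof (intro allI impI)
  fix x assume "isCont (cdf M') x"
  then have "(\<lambda>n. cdf (M (Suc n)) x) \<longlonglongrightarrow> cdf M' x"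
    using assms by (simp add: weak_conv_m_def weak_conv_def)
  then show "(\<lambda>n. cdf (M n) x) \<longlonglongrightarrow> cdf M' x" by (rule LIMSEQ_imp_Suc)
qed


lemma outer_boundary_eq: "outer_boundary B = lattice.outer_bd B"
  by (simp add: outer_boundary_def lattice.outer_bd_def)

lemma mean_clusters_eq:
  fixes B :: "(int ^ 'd::finite) set"
  assumes "0 < p" "p < 1" "finite B"
  shows "mean_clusters p B = bexp p B lattice.num"
  unfolding mean_clusters_def real_num_clusters using assms by (intro integral_site_percolation) auto

lemma prob_num_clusters_eq:
  fixes B :: "(int ^ 'd::finite) set"
  assumes "0 < p" "p < 1" "finite B"
  shows "measure (site_percolation p) {\<omega> \<in> space (site_percolation p). int (num_clusters B \<omega>) = j} =
    bexp p B (\<lambda>S. if int (card (lattice.clusters S)) = j then 1 else 0)"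
proof -
  let ?A = "{\<omega> \<in> space (site_percolation p). int (num_clusters B \<omega>) = j}"
  have "measure (site_percolation p) ?A = (\<integral>\<omega>. indicator ?A \<omega> \<partial>site_percolation p)"
    by (simp add: Int_absorb2 subset_iff)
  also have "\<dots> = (\<integral>\<omega>. (\<lambda>S. if int (card (lattice.clusters S)) = j then 1 else 0) (open_sites B \<omega>) \<partial>site_percolation p)"
    by (intro Bochner_Integration.integral_cong) (auto simp: num_clusters_eq)
  also have "\<dots> = bexp p B (\<lambda>S. if int (card (lattice.clusters S)) = j then 1 else 0)"
    using assms by (intro integral_site_percolation) auto
  finally show ?thesis .
qed

definition std_clusters :: "real \<Rightarrow> (int ^ 'd) set \<Rightarrow> (int ^ 'd \<Rightarrow> bool) \<Rightarrow> real" where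
  "std_clusters p B \<omega> = (real (num_clusters B \<omega>) - mean_clusters p B) / sqrt (real (card B))"

lemma measurable_std_clusters:
  "finite B \<Longrightarrow> std_clusters p B \<in> borel_measurable (site_percolation p)"
proof -
  assume "finite B"
  then have "num_clusters B \<in> measurable (site_percolation p) (count_space UNIV)" by (rule measurable_num_clusters)
  then have "(\<lambda>\<omega>. real (num_clusters B \<omega>)) \<in> borel_measurable (site_percolation p)"
    by (rule measurable_compose) simp
  then show ?thesis unfolding std_clusters_def by measurable
qed

lemma char_std_clusters:
  fixes B :: "(int ^ 'd::finite) set"
  assumes p: "0 < p" "p < 1" and B: "finite B"
  shows "char (distr (site_percolation p) borel (std_clusters p B)) t =
    bexp p B (\<lambda>S. iexp (t * lattice.std_csum p B (\<lambda>_. 1) S))"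
proof -
  have "char (distr (site_percolation p) borel (std_clusters p B)) t =
      (\<integral>\<omega>. iexp (t * std_clusters p B \<omega>) \<partial>site_percolation p)"
    unfolding char_def using measurable_std_clusters[OF B] by (subst integral_distr) auto
  also have "\<dots> = (\<integral>\<omega>. (\<lambda>S. iexp (t * lattice.std_csum p B (\<lambda>_. 1) S)) (open_sites B \<omega>) \<partial>site_percolation p)"
    by (simp add: std_clusters_def lattice.std_csum_def mean_clusters_eq[OF p B] real_num_clusters lattice.num_def)
  also have "\<dots> = bexp p B (\<lambda>S. iexp (t * lattice.std_csum p B (\<lambda>_. 1) S))"
    using p B by (intro integral_site_percolation) auto
  finally show ?thesis .
qed

text \<open>Convergence of characteristic functions gives the central limit theorem by Levy's continuity theorem; the
  decay bound, rescaled by \<open>sqrt |B|\<close>, is the domination required for the local limit.\<close>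
lemma limit_theorems:
  fixes B :: "nat \<Rightarrow> (int ^ 'd::finite) set"
  assumes p: "0 < p" "p < 1" and B: "lattice.folner B"
    and card: "filterlim (\<lambda>n. real (card (B n))) at_top sequentially"
    and \<sigma>: "0 < \<sigma>" and var: "(\<lambda>n. bvar p (B n) lattice.num / card (B n)) \<longlonglongrightarrow> \<sigma>\<^sup>2"
  shows "weak_conv_m (\<lambda>n. distr (site_percolation p) borel (std_clusters p (B n)))
      (density lborel (normal_density 0 \<sigma>))" (is ?CLT)
    and "(\<lambda>n. SUP j::int. \<bar>sqrt (real (card (B n))) *
            measure (site_percolation p)
              {\<omega> \<in> space (site_percolation p). int (num_clusters (B n) \<omega>) = j}
          - 1 / \<sigma> * std_normal_density
              ((real_of_int j - mean_clusters p (B n)) / (\<sigma> * sqrt (real (card (B n)))))\<bar>) \<longlonglongrightarrow> 0" (is ?LCLT)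
proof -
  have Bn: "finite (B n)" "B n \<noteq> {}" for n using B by (auto simp: lattice.folner_def)
  define r where "r n = sqrt (real (card (B n)))" for n
  have r_pos: "0 < r n" for n using Bn[of n] by (simp add: r_def card_gt_0_iff)
  have r: "filterlim r at_top sequentially"
    unfolding r_def by (rule filterlim_compose[OF sqrt_at_top card])
  define \<phi> where "\<phi> n u = bexp p (B n) (\<lambda>S. iexp (u * lattice.std_csum p (B n) (\<lambda>_. 1) S))" for n u
  have lim: "(\<lambda>n. \<phi> n u) \<longlonglongrightarrow> of_real (exp (- (\<sigma>\<^sup>2 * u\<^sup>2 / 2)))" for u
    unfolding \<phi>_def by (rule lattice.cf_limit[OF p B card var])
  interpret P: prob_space "site_percolation p :: (int ^ 'd \<Rightarrow> bool) measure" by (rule prob_space_site_percolation)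
  show ?CLT
  proof (rule levy_continuity)
    show "real_distribution (distr (site_percolation p) borel (std_clusters p (B n)))" for n
      using measurable_std_clusters[OF Bn(1)] by (intro P.real_distribution_distr)
    show "real_distribution (density lborel (normal_density 0 \<sigma>))"
      using prob_space_normal_density[OF \<sigma>] by (auto simp: real_distribution_def real_distribution_axioms_def)
    show "(\<lambda>n. char (distr (site_percolation p) borel (std_clusters p (B n))) t) \<longlonglongrightarrow>
        char (density lborel (normal_density 0 \<sigma>)) t" for t
      using lim[of t] by (simp only: char_std_clusters[OF p Bn(1)] char_normal[OF \<sigma>] \<phi>_def)
  qed
  let ?D = "3 ^ CARD('d) :: nat"
  define c where "c = p * (1 - p) ^ (?D + 1) / (18 * (real ?D + 1)\<^sup>2)"
  have c: "0 < c" unfolding c_def using p by (intro divide_pos_pos mult_pos_pos zero_less_power add_nonneg_pos) auto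
  show ?LCLT
    unfolding r_def[symmetric]
  proof (rule local_limit[OF \<sigma> c r_pos r _ _ _ lim])
    show "\<phi> n \<in> borel_measurable borel" for n
      unfolding \<phi>_def by (rule borel_measurable_bexp_iexp)
    show "norm (\<phi> n u) \<le> exp (- (c * u\<^sup>2))" if "\<bar>u\<bar> \<le> pi * r n" for n u
      using lattice.cf_std_decay[OF p Bn[of n], of u] that unfolding \<phi>_def c_def r_def by simp
    show "complex_of_real (r n * measure (site_percolation p)
              {\<omega> \<in> space (site_percolation p). int (num_clusters (B n) \<omega>) = j}) = of_real (1 / (2 * pi)) *
       (\<integral>u. indicator {- pi * r n..pi * r n} u *\<^sub>R
         (iexp (- (u * ((of_int j - mean_clusters p (B n)) / r n))) * \<phi> n u) \<partial>lborel)" for n j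
      using bexp_inversion[OF r_pos[of n] Bn(1)[of n], where N = "\<lambda>S. card (lattice.clusters S)" and m = "mean_clusters p (B n)"]
      by (simp add: prob_num_clusters_eq[OF p Bn(1)] \<phi>_def lattice.std_csum_def r_def mean_clusters_eq[OF p Bn(1)]
          lattice.num_eq flip: lattice.num_def)
  qed
qed

theorem theorem3p1:
  fixes p :: real
  assumes "CARD('d::finite) \<ge> 2"
    and "0 < p" and "p < 1"
  shows "\<exists>\<sigma>>0. \<forall>B :: nat \<Rightarrow> (int ^ 'd) set.
    (\<forall>n\<ge>1. finite (B n) \<and> B n \<noteq> {}) \<and>
    vanishing_relative_boundary B \<and>
    set_liminf B = UNIV \<longrightarrow>
      weak_conv_m
        (\<lambda>n. distr (site_percolation p) borel
          (\<lambda>\<omega>. (real (num_clusters (B n) \<omega>) - mean_clusters p (B n)) / sqrt (real (card (B n)))))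
        (density lborel (normal_density 0 \<sigma>)) \<and>
      (\<lambda>n. SUP j::int.
        \<bar>sqrt (real (card (B n))) *
            measure (site_percolation p)
              {\<omega> \<in> space (site_percolation p). int (num_clusters (B n) \<omega>) = j}
          - 1 / \<sigma> * std_normal_density
              ((real_of_int j - mean_clusters p (B n)) / (\<sigma> * sqrt (real (card (B n)))))\<bar>)
        \<longlonglongrightarrow> 0"
proof -
  note p = assms(2,3)
  obtain \<sigma>2 where \<sigma>2: "\<And>B :: nat \<Rightarrow> (int ^ 'd) set. lattice.folner B \<Longrightarrow>
      (\<lambda>n. bvar p (B n) lattice.num / card (B n)) \<longlonglongrightarrow> \<sigma>2"
    using lattice.variance_limit[OF p] by blast
  \<comment> \<open>A variance limit \<open>\<sigma>2\<close> that is not positive is possible only if no admissible sequence exists; the value 1 then serves.\<close>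
  define \<sigma> where "\<sigma> = (if 0 < \<sigma>2 then sqrt \<sigma>2 else 1)"
  have \<sigma>: "0 < \<sigma>" by (simp add: \<sigma>_def)
  show ?thesis
  proof (intro exI[of _ \<sigma>] conjI[OF \<sigma>] allI impI)
    fix B :: "nat \<Rightarrow> (int ^ 'd) set"
    assume B: "(\<forall>n\<ge>1. finite (B n) \<and> B n \<noteq> {}) \<and> vanishing_relative_boundary B \<and> set_liminf B = UNIV"
    \<comment> \<open>\<open>B 0\<close> is unconstrained and may be infinite, so the limit theorems are applied to the shifted sequence.\<close>
    let ?B = "\<lambda>n. B (Suc n)"
    have "(\<lambda>n. real (card (outer_boundary (?B n))) / real (card (?B n))) \<longlonglongrightarrow> 0"
      using B unfolding vanishing_relative_boundary_def by (intro LIMSEQ_Suc) auto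
    then have fol: "lattice.folner ?B"
      using B by (simp add: lattice.folner_def outer_boundary_eq)
    have "filterlim (\<lambda>n. real (card (B n))) at_top sequentially"
      using B by (intro card_at_top_of_liminf infinite_lattice) auto
    then have card: "filterlim (\<lambda>n. real (card (?B n))) at_top sequentially"
      by (rule filterlim_compose[OF _ filterlim_Suc])
    have "0 < \<sigma>2" by (rule lattice.variance_positive[OF p fol card \<sigma>2[OF fol]])
    then have "\<sigma>2 = \<sigma>\<^sup>2" by (simp add: \<sigma>_def)
    note lim = limit_theorems[OF p fol card \<sigma> \<sigma>2[OF fol, unfolded this]]
    show "weak_conv_m
        (\<lambda>n. distr (site_percolation p) borel
          (\<lambda>\<omega>. (real (num_clusters (B n) \<omega>) - mean_clusters p (B n)) / sqrt (real (card (B n)))))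
        (density lborel (normal_density 0 \<sigma>)) \<and>
      (\<lambda>n. SUP j::int.
        \<bar>sqrt (real (card (B n))) *
            measure (site_percolation p)
              {\<omega> \<in> space (site_percolation p). int (num_clusters (B n) \<omega>) = j}
          - 1 / \<sigma> * std_normal_density
              ((real_of_int j - mean_clusters p (B n)) / (\<sigma> * sqrt (real (card (B n)))))\<bar>)
        \<longlonglongrightarrow> 0"
      by (rule conjI, rule weak_conv_m_shift, rule lim(1)[unfolded std_clusters_def[abs_def]],
          rule LIMSEQ_imp_Suc, rule lim(2))
  qed
qed

end
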